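(* Let $C \subset \mathbb{P}^n$ be an $(n-k)$-rope supported on the line $L$ with homogeneous ideal $I_C = ((I_L)^2, [x_0,\dots,x_r]B)$. Then $I_C$ has the graded free resolution $$0 \to G_n \xrightarrow{d_n'} \cdots \to G_2 \xrightarrow{d_2'} G_1 \xrightarrow{d_1'} I_C \to 0,$$ where $$G_i := D_i \oplus \left(\textstyle\bigwedge^{i-1}P \otimes Q\right),\qquad D_n := 0,$$ $$d_i' := \begin{pmatrix} d_i & (-1)^i\mu_i \\ 0 & \delta_{i-1}\otimes \operatorname{id}_Q\end{pmatrix}\quad (2 \leq i \leq n-1),\qquad d_1' := \begin{pmatrix} d_1 & -\mu_1\end{pmatrix},\qquad d_n' := \begin{pmatrix} (-1)^n\mu_n \\ \delta_{n-1}\otimes\operatorname{id}_Q\end{pmatrix}.$$ This resolution is minimal if and only if the rope $C\subset\mathbb{P}^n$ is non-degenerate (i.e. not contained in a hyperplane).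
   Context: $K$ is an arbitrary field, $n\ge 3$, $r:=n-2$, $R=K[x_0,\dots,x_r,t,u]$ is the coordinate ring of $\mathbb{P}^n$, $L$ is the line with $I_L=(x_0,\dots,x_r)$, and $S=K[t,u]$ is its coordinate ring. A curve is a closed locally Cohen-Macaulay projective subscheme of pure dimension one. A rope supported on $L$ is a curve $C$ with support $L$ whose homogeneous ideal $I_C$ contains $I_L^2$; an $(n-k)$-rope is a rope of degree $n-k$ (here $1\le k\le n-2$). The homogeneous ideal of an $(n-k)$-rope on $L$ can be written as $I_C=((I_L)^2,[x_0,\dots,x_r]B)$, where $B$ is an $(r+1)\times k$ matrix over $S$ whose maximal minors have no common zero on $L\cong\mathbb{P}^1$ (written $\operatorname{codim} I_k(B)=2$) and which gives a graded map $\varphi_B:\bigoplus_{j=1}^k S(-\beta_j-1)\to S^{r+1}(-1)$, $\beta_j\ge0$. Notation: $P=R^{n-1}(-1)=\bigoplus_{i=0}^r Re_i$; the Koszul complex resolving $I_L$ is $0\to\bigwedge^{n-1}P\xrightarrow{\delta_{n-1}}\cdots\to\bigwedge^2P\xrightarrow{\delta_2}P\xrightarrow{\delta_1}I_L\to0$ with $\delta_1(e_i)=x_i$. The map $\partial_i:\bigwedge^iP\to\bigwedge^{i-1}P\otimes P$ is defined by $\partial_i(u_1\wedge\dots\wedge u_i)=\sum_{j=1}^i(-1)^{j+1}u_1\wedge\dots\wedge\widehat{u_j}\wedge\dots\wedge u_i\otimes u_j$; it is split-injective. For $i\ge1$ put $D_i:=(\bigwedge^iP\otimes P)/\partial_{i+1}(\bigwedge^{i+1}P)$,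 a free $R$-module, and $D_0:=R$. For $i\ge2$, $d_i:D_i\to D_{i-1}$ is the map induced by $\delta_i\otimes\operatorname{id}_P$, and $d_1:D_1\to(I_L)^2$ is the map sending the class of $e_i\otimes e_j$ to $x_ix_j$. Let $Q:=\bigoplus_{j=1}^kR(-\beta_j-1)$ and let $\tau_B:Q\to P$ be the extension of $\varphi_B$ to $R$. For $i\ge2$, $\mu_i:\bigwedge^{i-1}P\otimes Q\to D_{i-1}$ is the composition of $\operatorname{id}\otimes\tau_B:\bigwedge^{i-1}P\otimes Q\to\bigwedge^{i-1}P\otimes P$ with the projection to $D_{i-1}$, and $\mu_1$ is the composition $Q\xrightarrow{\tau_B}P\xrightarrow{\delta_1}R$. *)

theory Defs
  imports
    "HOL-Library.Poly_Mapping"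
    "HOL-Library.Extended_Nat"
    "HOL-Algebra.Algebra"
    "Jordan_Normal_Form.Determinant"
    "Jordan_Normal_Form.DL_Submatrix"
begin

section \<open>The coordinate rings\<close>

text \<open>
  Polynomials over \<open>'k\<close> in variables indexed by natural numbers.  For projective \<open>n\<close>-space,
  the variables \<open>0, \<dots>, n - 2\<close> are \<open>x\<^sub>0, \<dots>, x\<^sub>r\<close> with \<open>r = n - 2\<close>, and the variables
  \<open>n - 1\<close> and \<open>n\<close> are \<open>t\<close> and \<open>u\<close>.
\<close>

type_synonym 'k mpol = "(nat \<Rightarrow>\<^sub>0 nat) \<Rightarrow>\<^sub>0 'k"

definition var :: "nat \<Rightarrow> 'k::field mpol" where
  "var i = Poly_Mapping.single (Poly_Mapping.single i 1) 1"

definition const_poly :: "'k \<Rightarrow> 'k::field mpol" where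
  "const_poly c = Poly_Mapping.single 0 c"

definition monom_deg :: "(nat \<Rightarrow>\<^sub>0 nat) \<Rightarrow> nat" where
  "monom_deg m = (\<Sum>i\<in>Poly_Mapping.keys m. Poly_Mapping.lookup m i)"

definition polys :: "nat set \<Rightarrow> 'k::field mpol set" where
  "polys V = {p. \<forall>m\<in>Poly_Mapping.keys p. Poly_Mapping.keys m \<subseteq> V}"

text \<open>The zero polynomial is homogeneous of every degree.\<close>

definition homog :: "int \<Rightarrow> 'k::field mpol \<Rightarrow> bool" where
  "homog d p \<longleftrightarrow> (\<forall>m\<in>Poly_Mapping.keys p. int (monom_deg m) = d)"

definition RR :: "nat \<Rightarrow> 'k::field mpol ring" where
  "RR n = \<lparr>carrier = polys {..n}, monoid.mult = (*), one = 1, ring.zero = 0, ring.add = (+)\<rparr>"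

definition SS_carrier :: "nat \<Rightarrow> 'k::field mpol set" where
  "SS_carrier n = polys {n - 1, n}"

definition RR_comp :: "nat \<Rightarrow> int \<Rightarrow> 'k::field mpol set" where
  "RR_comp n d = {p \<in> carrier (RR n). homog d p}"

definition irrelevant_ideal :: "nat \<Rightarrow> 'k::field mpol set" where
  "irrelevant_ideal n = Idl\<^bsub>RR n\<^esub> (var ` {..n})"

definition line_ideal :: "nat \<Rightarrow> 'k::field mpol set" where
  "line_ideal n = Idl\<^bsub>RR n\<^esub> (var ` {..n - 2})"


section \<open>Closed subschemes of projective space\<close>

text \<open>
  A closed subscheme of projective \<open>n\<close>-space is represented by its homogeneous ideal, that is,
  by a saturated homogeneous ideal of \<open>RR n\<close>; a subscheme is contained in another one iff the
  ideals are contained in each other the other way round.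
\<close>

definition homogeneous_ideal :: "nat \<Rightarrow> 'k::field mpol set \<Rightarrow> bool" where
  "homogeneous_ideal n I \<longleftrightarrow>
     ideal I (RR n) \<and> I = Idl\<^bsub>RR n\<^esub> {f \<in> I. \<exists>d. homog d f}"

definition saturated_ideal :: "nat \<Rightarrow> 'k::field mpol set \<Rightarrow> bool" where
  "saturated_ideal n I \<longleftrightarrow>
     (\<forall>f\<in>carrier (RR n). (\<forall>i\<le>n. \<exists>N. var i ^ N * f \<in> I) \<longrightarrow> f \<in> I)"

definition closed_subscheme :: "nat \<Rightarrow> 'k::field mpol set \<Rightarrow> bool" where
  "closed_subscheme n I \<longleftrightarrow> homogeneous_ideal n I \<and> saturated_ideal n I"

text \<open>The points of Proj are the homogeneous prime ideals not containing the irrelevant ideal.\<close>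

definition Proj :: "nat \<Rightarrow> 'k::field mpol set set" where
  "Proj n = {p. primeideal p (RR n) \<and> homogeneous_ideal n p \<and> \<not> irrelevant_ideal n \<subseteq> p}"

definition support :: "nat \<Rightarrow> 'k::field mpol set \<Rightarrow> 'k mpol set set" where
  "support n I = {p \<in> Proj n. I \<subseteq> p}"

definition chain_dim :: "'a set set \<Rightarrow> enat" where
  "chain_dim V = Sup {enat m | m.
     \<exists>c::nat \<Rightarrow> 'a set. (\<forall>i\<le>m. c i \<in> V) \<and> (\<forall>i<m. c i \<subset> c (Suc i))}"

text \<open>
  The irreducible components correspond to the minimal primes of the support; each of them,
  i.e. the set of points specialising the generic point \<open>p\<close>, must have dimension one.
\<close>

definition pure_dim_one :: "nat \<Rightarrow> 'k::field mpol set \<Rightarrow> bool" where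
  "pure_dim_one n I \<longleftrightarrow>
     (\<forall>p\<in>support n I. (\<forall>q\<in>support n I. q \<subseteq> p \<longrightarrow> q = p) \<longrightarrow> chain_dim (support n p) = 1)"

subsection \<open>Local rings and Cohen-Macaulayness\<close>

definition krull_dim :: "('a, 'm) ring_scheme \<Rightarrow> enat" where
  "krull_dim A = chain_dim {p. primeideal p A}"

definition regular_sequence :: "('a, 'm) ring_scheme \<Rightarrow> 'a list \<Rightarrow> bool" where
  "regular_sequence A as \<longleftrightarrow>
     set as \<subseteq> carrier A \<and>
     (\<forall>i<length as. \<forall>y\<in>carrier A.
        as ! i \<otimes>\<^bsub>A\<^esub> y \<in> Idl\<^bsub>A\<^esub> (set (take i as)) \<longrightarrow> y \<in> Idl\<^bsub>A\<^esub> (set (take i as))) \<and>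
     Idl\<^bsub>A\<^esub> (set as) \<noteq> carrier A"

text \<open>In a local ring the maximal ideal is the set of non-units.\<close>

definition local_depth :: "('a, 'm) ring_scheme \<Rightarrow> enat" where
  "local_depth A = Sup {enat (length as) | as.
     regular_sequence A as \<and> set as \<subseteq> carrier A - Units A}"

definition cohen_macaulay_local :: "('a, 'm) ring_scheme \<Rightarrow> bool" where
  "cohen_macaulay_local A \<longleftrightarrow> local_depth A = krull_dim A"

text \<open>
  The local ring at the point \<open>p\<close> of the subscheme with ideal \<open>I\<close> is the degree zero part of the
  localisation of \<open>R/I\<close> at the homogeneous elements outside \<open>p\<close>.  It is presented by fractions
  of elements of \<open>R\<close> of equal degree.
\<close>

definition fractions :: "nat \<Rightarrow> 'k::field mpol set \<Rightarrow> ('k mpol \<times> 'k mpol) set" where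
  "fractions n p = {(a, b). (\<exists>d. a \<in> RR_comp n d \<and> b \<in> RR_comp n d) \<and> b \<notin> p}"

definition frac_rel ::
  "nat \<Rightarrow> 'k::field mpol set \<Rightarrow> 'k mpol set \<Rightarrow> (('k mpol \<times> 'k mpol) \<times> ('k mpol \<times> 'k mpol)) set" where
  "frac_rel n I p = {((a, b), (a', b')).
     (a, b) \<in> fractions n p \<and> (a', b') \<in> fractions n p \<and>
     (\<exists>d. \<exists>s\<in>RR_comp n d. s \<notin> p \<and> s * (a * b' - a' * b) \<in> I)}"

definition local_ring ::
  "nat \<Rightarrow> 'k::field mpol set \<Rightarrow> 'k mpol set \<Rightarrow> ('k mpol \<times> 'k mpol) set ring" where
  "local_ring n I p = \<lparr>
     carrier = fractions n p // frac_rel n I p,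
     monoid.mult = (\<lambda>V W. \<Union>(a, b)\<in>V. \<Union>(c, d)\<in>W. frac_rel n I p `` {(a * c, b * d)}),
     one = frac_rel n I p `` {(1, 1)},
     ring.zero = frac_rel n I p `` {(0, 1)},
     ring.add = (\<lambda>V W. \<Union>(a, b)\<in>V. \<Union>(c, d)\<in>W. frac_rel n I p `` {(a * d + c * b, b * d)})\<rparr>"

definition locally_cohen_macaulay :: "nat \<Rightarrow> 'k::field mpol set \<Rightarrow> bool" where
  "locally_cohen_macaulay n I \<longleftrightarrow> (\<forall>p\<in>support n I. cohen_macaulay_local (local_ring n I p))"

subsection \<open>Curves, ropes, degree, degeneracy\<close>

definition curve :: "nat \<Rightarrow> 'k::field mpol set \<Rightarrow> bool" where
  "curve n I \<longleftrightarrow> closed_subscheme n I \<and> pure_dim_one n I \<and> locally_cohen_macaulay n I"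

definition rope :: "nat \<Rightarrow> 'k::field mpol set \<Rightarrow> bool" where
  "rope n I \<longleftrightarrow> curve n I \<and> support n I = support n (line_ideal n) \<and>
     ideal_prod (RR n) (line_ideal n) (line_ideal n) \<subseteq> I"

definition kdim :: "'k::field mpol set \<Rightarrow> nat" where
  "kdim V = vector_space.dim (\<lambda>c p. const_poly c * p) V"

definition hilbert_function :: "nat \<Rightarrow> 'k::field mpol set \<Rightarrow> nat \<Rightarrow> int" where
  "hilbert_function n I d =
     int (kdim (RR_comp n (int d) :: 'k mpol set)) - int (kdim (I \<inter> RR_comp n (int d)))"

text \<open>
  The degree of a curve is the leading coefficient of its Hilbert polynomial, which is linear.
\<close>

definition curve_has_degree :: "nat \<Rightarrow> 'k::field mpol set \<Rightarrow> nat \<Rightarrow> bool" where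
  "curve_has_degree n I e \<longleftrightarrow>
     (\<exists>c::int. \<exists>d0. \<forall>d\<ge>d0. hilbert_function n I d = int e * int d + c)"

definition nondegenerate :: "nat \<Rightarrow> 'k::field mpol set \<Rightarrow> bool" where
  "nondegenerate n I \<longleftrightarrow>
     \<not> (\<exists>l\<in>RR_comp n 1. l \<noteq> 0 \<and> Idl\<^bsub>RR n\<^esub> {l} \<subseteq> I)"

text \<open>The ideal generated by the square of \<open>I\<^sub>L\<close> and the entries of \<open>[x\<^sub>0, \<dots>, x\<^sub>r] B\<close>.\<close>

definition rope_ideal :: "nat \<Rightarrow> 'k::field mpol mat \<Rightarrow> 'k mpol set" where
  "rope_ideal n B = Idl\<^bsub>RR n\<^esub> (ideal_prod (RR n) (line_ideal n) (line_ideal n) \<union>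
     {\<Sum>i<n - 1. var i * B $$ (i, j) | j. j < dim_col B})"

text \<open>No point of \<open>L\<close> (in the scheme sense, as \<open>'k\<close> need not be algebraically closed) is a zero
  of all maximal minors.\<close>

definition no_common_zero_of_maximal_minors :: "nat \<Rightarrow> 'k::field mpol mat \<Rightarrow> bool" where
  "no_common_zero_of_maximal_minors n B \<longleftrightarrow>
     \<not> (\<exists>p\<in>support n (line_ideal n).
          \<forall>I. I \<subseteq> {..<dim_row B} \<and> card I = dim_col B \<longrightarrow>
              det (submatrix B I {..<dim_col B}) \<in> p)"


section \<open>Graded modules\<close>

record ('a, 'b) graded_module = "('a, 'b) module" +
  gcomp :: "int \<Rightarrow> 'b set"

definition linear_map ::
  "('a, 'm) ring_scheme \<Rightarrow> ('a, 'b, 'p) module_scheme \<Rightarrow> ('a, 'c, 'q) module_scheme \<Rightarrow>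
   ('b \<Rightarrow> 'c) \<Rightarrow> bool" where
  "linear_map R M N f \<longleftrightarrow>
     f \<in> carrier M \<rightarrow> carrier N \<and>
     (\<forall>x\<in>carrier M. \<forall>y\<in>carrier M. f (x \<oplus>\<^bsub>M\<^esub> y) = f x \<oplus>\<^bsub>N\<^esub> f y) \<and>
     (\<forall>a\<in>carrier R. \<forall>x\<in>carrier M. f (a \<odot>\<^bsub>M\<^esub> x) = a \<odot>\<^bsub>N\<^esub> f x)"

definition graded_hom ::
  "nat \<Rightarrow> ('k::field mpol, 'b) graded_module \<Rightarrow> ('k mpol, 'c) graded_module \<Rightarrow> ('b \<Rightarrow> 'c) \<Rightarrow> bool" where
  "graded_hom n M N f \<longleftrightarrow>
     linear_map (RR n) M N f \<and> (\<forall>d. f ` gcomp M d \<subseteq> gcomp N d)"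

definition graded_iso ::
  "nat \<Rightarrow> ('k::field mpol, 'b) graded_module \<Rightarrow> ('k mpol, 'c) graded_module \<Rightarrow> ('b \<Rightarrow> 'c) \<Rightarrow> bool" where
  "graded_iso n M N f \<longleftrightarrow>
     linear_map (RR n) M N f \<and> bij_betw f (carrier M) (carrier N) \<and>
     (\<forall>d. f ` gcomp M d = gcomp N d)"

definition regular_module :: "nat \<Rightarrow> ('k::field mpol, 'k mpol) graded_module" where
  "regular_module n = \<lparr>carrier = carrier (RR n), monoid.mult = (*), one = 1, ring.zero = 0, ring.add = (+),
     module.smult = (*), gcomp = RR_comp n\<rparr>"

text \<open>
  The free module on the (finite) set \<open>V\<close>, the generator \<open>x\<close> having degree \<open>w x\<close>, i.e. the direct
  sum of the modules \<open>R(- w x)\<close>.  Elements are coordinate functions, extended by zero outside \<open>V\<close>.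
  The ring operations of the module record carry no meaning.
\<close>

definition free_module :: "nat \<Rightarrow> 'i set \<Rightarrow> ('i \<Rightarrow> int) \<Rightarrow> ('k::field mpol, 'i \<Rightarrow> 'k mpol) graded_module" where
  "free_module n V w = \<lparr>
     carrier = {f. (\<forall>x\<in>V. f x \<in> carrier (RR n)) \<and> (\<forall>x. x \<notin> V \<longrightarrow> f x = 0)},
     monoid.mult = undefined, one = undefined,
     ring.zero = (\<lambda>_. 0), ring.add = (\<lambda>f g x. f x + g x), module.smult = (\<lambda>a f x. a * f x),
     gcomp = (\<lambda>d. {f. (\<forall>x\<in>V. f x \<in> RR_comp n (d - w x)) \<and> (\<forall>x. x \<notin> V \<longrightarrow> f x = 0)})\<rparr>"

definition quotient_module ::
  "('a, 'b) graded_module \<Rightarrow> 'b set \<Rightarrow> ('a, 'b set) graded_module" where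
  "quotient_module M N = \<lparr>
     carrier = a_rcosets\<^bsub>M\<^esub> N, monoid.mult = undefined, one = undefined,
     ring.zero = N, ring.add = set_add M, module.smult = (\<lambda>a V. \<Union>x\<in>V. N +>\<^bsub>M\<^esub> (a \<odot>\<^bsub>M\<^esub> x)),
     gcomp = (\<lambda>d. (\<lambda>x. N +>\<^bsub>M\<^esub> x) ` gcomp M d)\<rparr>"

definition direct_sum ::
  "('a, 'b) graded_module \<Rightarrow> ('a, 'c) graded_module \<Rightarrow> ('a, 'b \<times> 'c) graded_module" where
  "direct_sum M N = \<lparr>
     carrier = carrier M \<times> carrier N, monoid.mult = undefined, one = undefined,
     ring.zero = (\<zero>\<^bsub>M\<^esub>, \<zero>\<^bsub>N\<^esub>),
     ring.add = (\<lambda>(x, y) (x', y'). (x \<oplus>\<^bsub>M\<^esub> x', y \<oplus>\<^bsub>N\<^esub> y')),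
     module.smult = (\<lambda>a (x, y). (a \<odot>\<^bsub>M\<^esub> x, a \<odot>\<^bsub>N\<^esub> y)),
     gcomp = (\<lambda>d. gcomp M d \<times> gcomp N d)\<rparr>"

definition graded_free :: "nat \<Rightarrow> ('k::field mpol, 'b) graded_module \<Rightarrow> bool" where
  "graded_free n M \<longleftrightarrow> module (RR n) M \<and>
     (\<exists>(m::nat) (w::nat \<Rightarrow> int) \<phi>. graded_iso n (free_module n {..<m} w) M \<phi>)"

text \<open>
  \<open>0 \<rightarrow> G N \<rightarrow> \<dots> \<rightarrow> G 2 \<rightarrow> G 1 \<rightarrow> I \<rightarrow> 0\<close> with maps \<open>d i : G i \<rightarrow> G (i - 1)\<close> for \<open>2 \<le> i \<le> N\<close> and
  augmentation \<open>e : G 1 \<rightarrow> I \<subseteq> R\<close>.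
\<close>

definition graded_free_resolution ::
  "nat \<Rightarrow> nat \<Rightarrow> (nat \<Rightarrow> ('k::field mpol, 'b) graded_module) \<Rightarrow> (nat \<Rightarrow> 'b \<Rightarrow> 'b) \<Rightarrow>
   ('b \<Rightarrow> 'k mpol) \<Rightarrow> 'k mpol set \<Rightarrow> bool" where
  "graded_free_resolution n N G d e I \<longleftrightarrow>
     (\<forall>i\<in>{1..N}. graded_free n (G i)) \<and>
     (\<forall>i\<in>{2..N}. graded_hom n (G i) (G (i - 1)) (d i)) \<and>
     graded_hom n (G 1) (regular_module n) e \<and>
     e ` carrier (G 1) = I \<and>
     a_kernel (G 1) (regular_module n) e = d 2 ` carrier (G 2) \<and>
     (\<forall>i\<in>{2..<N}. a_kernel (G i) (G (i - 1)) (d i) = d (Suc i) ` carrier (G (Suc i))) \<and>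
     inj_on (d N) (carrier (G N))"

definition ideal_times_module ::
  "'a set \<Rightarrow> ('a, 'b) graded_module \<Rightarrow> 'b set" where
  "ideal_times_module I M = generate (add_monoid M) {a \<odot>\<^bsub>M\<^esub> x | a x. a \<in> I \<and> x \<in> carrier M}"

definition minimal_resolution ::
  "nat \<Rightarrow> nat \<Rightarrow> (nat \<Rightarrow> ('k::field mpol, 'b) graded_module) \<Rightarrow> (nat \<Rightarrow> 'b \<Rightarrow> 'b) \<Rightarrow> bool" where
  "minimal_resolution n N G d \<longleftrightarrow>
     (\<forall>i\<in>{2..N}. d i ` carrier (G i) \<subseteq> ideal_times_module (irrelevant_ideal n) (G (i - 1)))"


section \<open>The modules and maps of the resolution\<close>

text \<open>
  The exterior power \<open>\<And>\<^sup>i P\<close> of the free module \<open>P\<close> with basis \<open>e\<^sub>0, \<dots>, e\<^sub>r\<close> is the free module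
  on the \<open>i\<close>-element subsets \<open>I\<close> of \<open>{0, \<dots>, r}\<close>: the set \<open>I = {a\<^sub>1 < \<dots> < a\<^sub>i}\<close> stands for
  \<open>e\<^sub>a\<^sub>1 \<and> \<dots> \<and> e\<^sub>a\<^sub>i\<close>.  Tensor products of free modules have the pairs of basis elements as a basis.
  A basis element \<open>q\<^sub>j\<close> of \<open>Q\<close> is represented by \<open>j < k\<close>.
\<close>

definition ext_basis :: "nat \<Rightarrow> nat \<Rightarrow> nat set set" where
  "ext_basis n i = {I. I \<subseteq> {..<n - 1} \<and> card I = i}"

definition ext_power :: "nat \<Rightarrow> nat \<Rightarrow> ('k::field mpol, nat set \<Rightarrow> 'k mpol) graded_module" where
  "ext_power n i = free_module n (ext_basis n i) (\<lambda>I. int (card I))"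

definition ext_tensor_P ::
  "nat \<Rightarrow> nat \<Rightarrow> ('k::field mpol, nat set \<times> nat \<Rightarrow> 'k mpol) graded_module" where
  "ext_tensor_P n i =
     free_module n (ext_basis n i \<times> {..<n - 1}) (\<lambda>(I, l). int (card I) + 1)"

definition ext_tensor_Q ::
  "nat \<Rightarrow> nat \<Rightarrow> (nat \<Rightarrow> nat) \<Rightarrow> nat \<Rightarrow> ('k::field mpol, nat set \<times> nat \<Rightarrow> 'k mpol) graded_module" where
  "ext_tensor_Q n k \<beta> i =
     free_module n (ext_basis n i \<times> {..<k}) (\<lambda>(I, j). int (card I) + int (\<beta> j) + 1)"

definition linear_extension :: "'i set \<Rightarrow> ('i \<Rightarrow> 'j \<Rightarrow> 'k::field mpol) \<Rightarrow> ('i \<Rightarrow> 'k mpol) \<Rightarrow> 'j \<Rightarrow> 'k mpol" where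
  "linear_extension V F f = (\<lambda>y. \<Sum>x\<in>V. f x * F x y)"

definition basis_vec :: "'j \<Rightarrow> 'j \<Rightarrow> 'k::field mpol" where
  "basis_vec y = (\<lambda>z. if z = y then 1 else 0)"

text \<open>If \<open>a\<close> is the \<open>j\<close>-th smallest element of \<open>I\<close>, this is \<open>(-1)\<^bsup>j+1\<^esup>\<close>.\<close>

definition position_sign :: "nat \<Rightarrow> nat set \<Rightarrow> 'k::field mpol" where
  "position_sign a I = (- 1) ^ card {b \<in> I. b < a}"

text \<open>The Koszul differential from \<open>\<And>\<^sup>i P\<close> to \<open>\<And>\<^bsup>i-1\<^esup> P\<close>, where \<open>\<And>\<^sup>0 P = R\<close>.\<close>

definition koszul :: "nat \<Rightarrow> nat \<Rightarrow> (nat set \<Rightarrow> 'k::field mpol) \<Rightarrow> nat set \<Rightarrow> 'k mpol" where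
  "koszul n i = linear_extension (ext_basis n i)
     (\<lambda>I J. \<Sum>a\<in>I. position_sign a I * var a * basis_vec (I - {a}) J)"

definition partial :: "nat \<Rightarrow> nat \<Rightarrow> (nat set \<Rightarrow> 'k::field mpol) \<Rightarrow> nat set \<times> nat \<Rightarrow> 'k mpol" where
  "partial n i = linear_extension (ext_basis n i)
     (\<lambda>I z. \<Sum>a\<in>I. position_sign a I * basis_vec (I - {a}, a) z)"

text \<open>\<open>f \<otimes> id\<close> and \<open>id \<otimes> f\<close>: apply the \<open>R\<close>-linear \<open>f\<close> to each slice of the coordinate function.\<close>

definition tensor_id ::
  "(('i \<Rightarrow> 'k::field mpol) \<Rightarrow> 'j \<Rightarrow> 'k mpol) \<Rightarrow> ('i \<times> 'l \<Rightarrow> 'k mpol) \<Rightarrow> 'j \<times> 'l \<Rightarrow> 'k mpol" where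
  "tensor_id f z = (\<lambda>(j, l). f (\<lambda>i. z (i, l)) j)"

definition id_tensor ::
  "(('i \<Rightarrow> 'k::field mpol) \<Rightarrow> 'j \<Rightarrow> 'k mpol) \<Rightarrow> ('l \<times> 'i \<Rightarrow> 'k mpol) \<Rightarrow> 'l \<times> 'j \<Rightarrow> 'k mpol" where
  "id_tensor f z = (\<lambda>(l, j). f (\<lambda>i. z (l, i)) j)"

definition partial_image :: "nat \<Rightarrow> nat \<Rightarrow> (nat set \<times> nat \<Rightarrow> 'k::field mpol) set" where
  "partial_image n i = partial n (Suc i) ` carrier (ext_power n (Suc i))"

text \<open>The case \<open>i = n\<close> of this definition is the zero module, see \<open>D_n_eq_zero\<close> below.\<close>

definition D_module :: "nat \<Rightarrow> nat \<Rightarrow> ('k::field mpol, (nat set \<times> nat \<Rightarrow> 'k mpol) set) graded_module" where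
  "D_module n i = quotient_module (ext_tensor_P n i) (partial_image n i)"

definition D_proj ::
  "nat \<Rightarrow> nat \<Rightarrow> (nat set \<times> nat \<Rightarrow> 'k::field mpol) \<Rightarrow> (nat set \<times> nat \<Rightarrow> 'k mpol) set" where
  "D_proj n i z = partial_image n i +>\<^bsub>ext_tensor_P n i\<^esub> z"

text \<open>The map \<open>d\<^sub>i : D\<^sub>i \<rightarrow> D\<^bsub>i-1\<^esub>\<close> for \<open>i \<ge> 2\<close>; on a coset the union is over equal sets.\<close>

definition d_map ::
  "nat \<Rightarrow> nat \<Rightarrow> (nat set \<times> nat \<Rightarrow> 'k::field mpol) set \<Rightarrow> (nat set \<times> nat \<Rightarrow> 'k mpol) set" where
  "d_map n i V = (\<Union>z\<in>V. D_proj n (i - 1) (tensor_id (koszul n i) z))"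

text \<open>The map \<open>d\<^sub>1 : D\<^sub>1 \<rightarrow> I\<^sub>L\<^sup>2\<close>, induced by \<open>e\<^sub>i \<otimes> e\<^sub>j \<mapsto> x\<^sub>i x\<^sub>j\<close>, which is constant on cosets.\<close>

definition d1_map :: "nat \<Rightarrow> (nat set \<times> nat \<Rightarrow> 'k::field mpol) set \<Rightarrow> 'k mpol" where
  "d1_map n V = the_elem ((\<lambda>z. \<Sum>i<n - 1. \<Sum>j<n - 1. z ({i}, j) * (var i * var j)) ` V)"

definition tau :: "nat \<Rightarrow> 'k::field mpol mat \<Rightarrow> (nat \<Rightarrow> 'k mpol) \<Rightarrow> nat \<Rightarrow> 'k mpol" where
  "tau n B = linear_extension {..<dim_col B} (\<lambda>j l. if l < n - 1 then B $$ (l, j) else 0)"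

text \<open>The map \<open>\<mu>\<^sub>i\<close> for \<open>i \<ge> 2\<close>.\<close>

definition mu ::
  "nat \<Rightarrow> 'k::field mpol mat \<Rightarrow> nat \<Rightarrow> (nat set \<times> nat \<Rightarrow> 'k mpol) \<Rightarrow> (nat set \<times> nat \<Rightarrow> 'k mpol) set" where
  "mu n B i z = D_proj n (i - 1) (id_tensor (tau n B) z)"

text \<open>The map \<open>\<mu>\<^sub>1\<close>, where \<open>Q\<close> is identified with \<open>\<And>\<^sup>0 P \<otimes> Q\<close>.\<close>

definition mu1 :: "nat \<Rightarrow> 'k::field mpol mat \<Rightarrow> (nat set \<times> nat \<Rightarrow> 'k mpol) \<Rightarrow> 'k mpol" where
  "mu1 n B z = (\<Sum>l<n - 1. tau n B (\<lambda>j. z ({}, j)) l * var l)"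

definition G_module ::
  "nat \<Rightarrow> nat \<Rightarrow> (nat \<Rightarrow> nat) \<Rightarrow> nat \<Rightarrow>
   ('k::field mpol, (nat set \<times> nat \<Rightarrow> 'k mpol) set \<times> (nat set \<times> nat \<Rightarrow> 'k mpol)) graded_module" where
  "G_module n k \<beta> i = direct_sum (D_module n i) (ext_tensor_Q n k \<beta> (i - 1))"

text \<open>The maps \<open>d\<^sub>i'\<close> for \<open>2 \<le> i \<le> n\<close>.\<close>

definition dd ::
  "nat \<Rightarrow> 'k::field mpol mat \<Rightarrow> nat \<Rightarrow>
   (nat set \<times> nat \<Rightarrow> 'k mpol) set \<times> (nat set \<times> nat \<Rightarrow> 'k mpol) \<Rightarrow>
   (nat set \<times> nat \<Rightarrow> 'k mpol) set \<times> (nat set \<times> nat \<Rightarrow> 'k mpol)" where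
  "dd n B i = (\<lambda>(V, z).
     (if i < n
      then d_map n i V \<oplus>\<^bsub>D_module n (i - 1)\<^esub> ((- 1) ^ i \<odot>\<^bsub>D_module n (i - 1)\<^esub> mu n B i z)
      else (- 1) ^ i \<odot>\<^bsub>D_module n (i - 1)\<^esub> mu n B i z,
      tensor_id (koszul n (i - 1)) z))"

definition dd1 ::
  "nat \<Rightarrow> 'k::field mpol mat \<Rightarrow>
   (nat set \<times> nat \<Rightarrow> 'k mpol) set \<times> (nat set \<times> nat \<Rightarrow> 'k mpol) \<Rightarrow> 'k mpol" where
  "dd1 n B = (\<lambda>(V, z). d1_map n V - mu1 n B z)"

lemma ext_basis_eq_empty:
  assumes "n \<ge> 1" "i \<ge> n"
  shows "ext_basis n i = {}"
proof -
  have "card I \<noteq> i" if "I \<subseteq> {..<n - 1}" for I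
  proof -
    have "card I \<le> n - 1" using card_mono[OF finite_lessThan that] by simp
    with assms show ?thesis by linarith
  qed
  then show ?thesis unfolding ext_basis_def by blast
qed

lemma D_n_eq_zero:
  assumes "n \<ge> 1"
  shows "carrier (D_module n n :: ('k::field mpol, _) graded_module) = {\<zero>\<^bsub>D_module n n\<^esub>}"
proof -
  have E: "ext_basis n n = {}" "ext_basis n (Suc n) = {}"
    using ext_basis_eq_empty[OF assms] by auto
  have P: "carrier (ext_power n (Suc n) :: ('k mpol, _) graded_module) = {\<lambda>_. 0}"
    unfolding ext_power_def free_module_def E by auto
  have N: "(partial_image n n :: (nat set \<times> nat \<Rightarrow> 'k mpol) set) = {\<lambda>_. 0}"
    unfolding partial_image_def P unfolding partial_def E linear_extension_def
    by (simp only: sum.empty image_insert image_empty)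
  have C: "carrier (ext_tensor_P n n :: ('k mpol, _) graded_module) = {\<lambda>_. 0}"
    unfolding ext_tensor_P_def free_module_def E by auto
  have A: "(\<lambda>_. 0) \<oplus>\<^bsub>ext_tensor_P n n\<^esub> (\<lambda>_. 0) = (\<lambda>_. 0 :: 'k mpol)"
    unfolding ext_tensor_P_def free_module_def by simp
  have c: "carrier (D_module n n :: ('k mpol, _) graded_module) =
      a_rcosets\<^bsub>ext_tensor_P n n\<^esub> (partial_image n n)"
    and z: "\<zero>\<^bsub>D_module n n\<^esub> = (partial_image n n :: (nat set \<times> nat \<Rightarrow> 'k mpol) set)"
    unfolding D_module_def quotient_module_def by simp_all
  show ?thesis
    unfolding c z A_RCOSETS_def' C N a_r_coset_def' by (simp add: A)
qed

end

theory Submission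
  imports Defs "HOL-Library.Function_Algebras"
begin

text \<open>
  The resolution is a mapping cone.  Let \<open>S = R / I\<^sub>L\<close>.  The Koszul complex tensored with \<open>Q\<close>
  resolves \<open>S \<otimes> Q\<close>, and the modules \<open>D\<^sub>i\<close>, continued by \<open>D\<^sub>0 = R\<close>, resolve \<open>R / I\<^sub>L\<^sup>2\<close>.  The maps \<open>\<mu>\<^sub>i\<close>
  form a chain map between these complexes, because \<open>\<delta>\<close> and \<open>\<tau>\<^sub>B\<close> act on different tensor factors
  (\<open>tensor_koszul_tau\<close>).  On homology it induces the map \<open>S \<otimes> Q \<rightarrow> R / I\<^sub>L\<^sup>2\<close> that sends \<open>q\<^sub>j\<close> to the
  \<open>j\<close>-th entry of \<open>[x\<^sub>0, \<dots>, x\<^sub>r] B\<close>; its image is \<open>I\<^sub>C / I\<^sub>L\<^sup>2\<close>.  Hence the cone resolves \<open>I\<^sub>C\<close> as soon as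
  this map is injective.  Since \<open>I\<^sub>L / I\<^sub>L\<^sup>2\<close> is the free \<open>S\<close>-module on \<open>x\<^sub>0, \<dots>, x\<^sub>r\<close>, the map is
  multiplication by \<open>B\<close>, which is injective because some maximal minor of \<open>B\<close> is not zero: otherwise
  all of them would vanish at the generic point of \<open>L\<close> (\<open>B_injective\<close>).

  The Koszul complex must be shown exact over a field of any characteristic, so the homotopy that
  divides by the degree is not available.  Instead, every variable \<open>x\<^sub>a\<close> has a homotopy of its own,
  which divides by \<open>x\<^sub>a\<close> and multiplies by \<open>e\<^sub>a\<close>; it contracts the complex to the part in which neither
  \<open>x\<^sub>a\<close> nor \<open>e\<^sub>a\<close> occurs (\<open>homotopy_formula\<close>).  After all variables have been used nothing is left in
  positive exterior degree (\<open>contraction_exact\<close>).  The complex \<open>D\<close> is the quotient of the Koszul complex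
  tensored with \<open>P\<close> by another Koszul complex, embedded by the injective maps \<open>\<partial>\<close>, which anticommute with
  the differentials (\<open>koszul_partial\<close>); its exactness follows by a diagram chase (\<open>D_exact\<close>, \<open>D_exact_1\<close>).
  A second chase gives the exactness of the cone (\<open>cone_exact\<close>, \<open>cone_exact_1\<close>).

  Elements of \<open>D\<^sub>i\<close> are cosets of coordinate functions.  All computations take place with
  representatives, that is, with pairs \<open>(z, y)\<close> of coordinate functions; they are carried over to
  \<open>G\<^sub>i\<close> along the surjection \<open>cover\<close>.

  As to minimality, the entries of \<open>d'\<^sub>i\<close> are up to sign variables and entries of \<open>B\<close>.  No column of \<open>B\<close>
  vanishes, by injectivity, so the entries lie in the irrelevant ideal exactly if no column of \<open>B\<close>
  consists of constants, i.e. if \<open>\<beta>\<^sub>j \<ge> 1\<close> for all \<open>j\<close>.  Non-degeneracy is the same condition: a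
  constant column makes the corresponding generator of \<open>I\<^sub>C\<close> a nonzero linear form, and in the absence
  of such columns \<open>I\<^sub>C\<close> is generated in degrees at least two (\<open>nondegenerate_iff\<close>).
\<close>

section \<open>Polynomials and ideals generated by variables\<close>

text \<open>
  A polynomial is a sum of terms, so identities between additive operators can be checked on a
  single term.
\<close>

lemma mpol_additive_eqI:
  fixes F G :: "'k::field mpol \<Rightarrow> 'b::ab_group_add"
  assumes "\<And>f g. F (f + g) = F f + F g" "\<And>f g. G (f + g) = G f + G g"
    and "\<And>m c. F (Poly_Mapping.single m c) = G (Poly_Mapping.single m c)"
  shows "F f = G f"
proof (induction f rule: update_induct)
  case const
  have "F 0 = 0" "G 0 = 0" using assms(1)[of 0 0] assms(2)[of 0 0] by simp_all
  then show ?case by simp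
next
  case (update f a b)
  have "Poly_Mapping.update a b f = f + Poly_Mapping.single a b"
    using update(1) by (intro poly_mapping_eqI)
      (auto simp: lookup_update lookup_add lookup_single not_in_keys_iff_lookup_eq_zero)
  then show ?case using assms update by simp
qed

lemma polys_0 [simp, intro]: "0 \<in> polys V"
  and polys_1 [simp, intro]: "1 \<in> polys V"
  by (auto simp: polys_def)

lemma polys_add [intro]: "f \<in> polys V \<Longrightarrow> g \<in> polys V \<Longrightarrow> f + g \<in> polys V"
  unfolding polys_def using Poly_Mapping.keys_add[of f g] by blast

lemma polys_uminus [intro]: "f \<in> polys V \<Longrightarrow> - f \<in> polys V"
  unfolding polys_def by (auto simp: in_keys_iff)

lemma polys_diff [intro]: "f \<in> polys V \<Longrightarrow> g \<in> polys V \<Longrightarrow> f - g \<in> polys V"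
  using polys_add[of f V "- g"] polys_uminus[of g V] by simp

lemma keys_add_nat: "Poly_Mapping.keys (a + b :: nat \<Rightarrow>\<^sub>0 nat) = Poly_Mapping.keys a \<union> Poly_Mapping.keys b"
  by (auto simp: in_keys_iff lookup_add)

lemma polys_mult [intro]: "f \<in> polys V \<Longrightarrow> g \<in> polys V \<Longrightarrow> f * g \<in> polys V"
  unfolding polys_def
proof safe
  fix m i assume "\<forall>m\<in>Poly_Mapping.keys f. Poly_Mapping.keys m \<subseteq> V" "\<forall>m\<in>Poly_Mapping.keys g. Poly_Mapping.keys m \<subseteq> V"
    and m: "m \<in> Poly_Mapping.keys (f * g)" "i \<in> Poly_Mapping.keys m"
  moreover obtain a b where "m = a + b" "a \<in> Poly_Mapping.keys f" "b \<in> Poly_Mapping.keys g"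
    using m(1) Poly_Mapping.keys_mult[of f g] by blast
  ultimately show "i \<in> V" by (auto simp: keys_add_nat)
qed

lemma polys_sum [intro]: "(\<And>i. i \<in> A \<Longrightarrow> f i \<in> polys V) \<Longrightarrow> sum f A \<in> polys V"
  by (induction A rule: infinite_finite_induct) auto

lemma polys_var [simp]: "a \<in> V \<Longrightarrow> var a \<in> polys V"
  by (auto simp: polys_def var_def)

lemma var_neq_0 [simp]: "var a \<noteq> (0 :: 'k::field mpol)"
  by (metis lookup_single_eq lookup_zero var_def one_neq_zero)

lemma lookup_var_0 [simp]: "Poly_Mapping.lookup (var a) 0 = 0"
  by (metis lookup_single_not_eq lookup_single_eq lookup_zero one_neq_zero var_def)

lemma polys_mono: "V \<subseteq> W \<Longrightarrow> polys V \<subseteq> polys W"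
  by (auto simp: polys_def)

lemma polys_sign [simp, intro]: "(- 1) ^ i \<in> polys V"
  by (induction i) auto

lemma monom_deg_eq: "finite A \<Longrightarrow> Poly_Mapping.keys m \<subseteq> A \<Longrightarrow> monom_deg m = (\<Sum>i\<in>A. Poly_Mapping.lookup m i)"
  unfolding monom_deg_def by (rule sum.mono_neutral_left) (auto simp: in_keys_iff)

lemma monom_deg_add [simp]: "monom_deg (a + b) = monom_deg a + monom_deg b"
proof -
  let ?A = "Poly_Mapping.keys a \<union> Poly_Mapping.keys b"
  have "monom_deg (a + b) = (\<Sum>i\<in>?A. Poly_Mapping.lookup (a + b) i)"
    by (rule monom_deg_eq) (auto simp: keys_add_nat)
  also have "\<dots> = (\<Sum>i\<in>?A. Poly_Mapping.lookup a i) + (\<Sum>i\<in>?A. Poly_Mapping.lookup b i)"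
    by (simp add: lookup_add sum.distrib)
  finally show ?thesis by (simp add: monom_deg_eq[of ?A])
qed

lemma monom_deg_eq_0_iff: "monom_deg m = 0 \<longleftrightarrow> m = 0"
  by (auto simp: monom_deg_def in_keys_iff intro!: poly_mapping_eqI)

lemma monom_deg_single [simp]: "monom_deg (Poly_Mapping.single i c) = c"
  by (simp add: monom_deg_def)

lemma homog_0 [simp, intro]: "homog d 0"
  and homog_1 [simp, intro]: "homog 0 1"
  by (auto simp: homog_def monom_deg_def)

lemma homog_add [intro]: "homog d f \<Longrightarrow> homog d g \<Longrightarrow> homog d (f + g)"
  unfolding homog_def using Poly_Mapping.keys_add[of f g] by blast

lemma homog_sum: "(\<And>x. x \<in> A \<Longrightarrow> homog d (f x)) \<Longrightarrow> homog d (sum f A)"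
  by (induction A rule: infinite_finite_induct) auto

lemma homog_uminus [intro]: "homog d f \<Longrightarrow> homog d (- f)"
  unfolding homog_def by (auto simp: in_keys_iff)

lemma homog_mult: "homog d f \<Longrightarrow> homog e g \<Longrightarrow> d + e = s \<Longrightarrow> homog s (f * g)"
  unfolding homog_def
proof
  fix m assume "\<forall>m\<in>Poly_Mapping.keys f. int (monom_deg m) = d" "\<forall>m\<in>Poly_Mapping.keys g. int (monom_deg m) = e"
    and s: "d + e = s" and m: "m \<in> Poly_Mapping.keys (f * g)"
  moreover obtain a b where "m = a + b" "a \<in> Poly_Mapping.keys f" "b \<in> Poly_Mapping.keys g"
    using m Poly_Mapping.keys_mult[of f g] by blast
  ultimately show "int (monom_deg m) = s" by auto
qed

lemma homog_sign [simp, intro]: "homog 0 ((- 1) ^ i)"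
  by (induction i) (auto intro: homog_mult)

lemma homog_var [simp, intro]: "homog 1 (var a)"
  by (auto simp: homog_def var_def)

lemma RR_comp_polys: "f \<in> RR_comp n d \<Longrightarrow> f \<in> polys {..n}"
  by (simp add: RR_comp_def RR_def)

lemma carrier_RR [simp]: "carrier (RR n) = polys {..n}"
  and add_RR [simp]: "ring.add (RR n) = (+)"
  and mult_RR [simp]: "monoid.mult (RR n) = (*)"
  and zero_RR [simp]: "ring.zero (RR n) = 0"
  and one_RR [simp]: "monoid.one (RR n) = 1"
  by (simp_all add: RR_def)

text \<open>
  The substitution of zero for the variables in \<open>A\<close>.  It is a ring homomorphism (\<open>restr_mult\<close>), and
  its kernel is the ideal generated by the variables in \<open>A\<close> (\<open>Idl_vars_eq\<close>).
\<close>

definition restr :: "nat set \<Rightarrow> 'k::field mpol \<Rightarrow> 'k mpol" where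
  "restr A f = Abs_poly_mapping (\<lambda>m. Poly_Mapping.lookup f m when Poly_Mapping.keys m \<inter> A = {})"

lemma lookup_restr: "Poly_Mapping.lookup (restr A f) m = (Poly_Mapping.lookup f m when Poly_Mapping.keys m \<inter> A = {})"
  unfolding restr_def
proof (subst lookup_Abs_poly_mapping)
  show "finite {m. (Poly_Mapping.lookup f m when Poly_Mapping.keys m \<inter> A = {}) \<noteq> 0}"
    by (rule finite_subset[OF _ finite_lookup[of f]]) auto
qed simp

lemma restr_add: "restr A (f + g) = restr A f + restr A g"
  by (rule poly_mapping_eqI) (auto simp: lookup_restr lookup_add when_def)

lemma restr_0 [simp]: "restr A 0 = 0"
  by (rule poly_mapping_eqI) (auto simp: lookup_restr when_def)

lemma restr_sum: "restr A (sum f Z) = (\<Sum>x\<in>Z. restr A (f x))"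
  by (induction Z rule: infinite_finite_induct) (auto simp: restr_add)

lemma restr_single: "restr A (Poly_Mapping.single m c) = (if Poly_Mapping.keys m \<inter> A = {} then Poly_Mapping.single m c else 0)"
  by (rule poly_mapping_eqI) (auto simp: lookup_restr lookup_single when_def)

lemma restr_mult: "restr A (f * g) = restr A f * restr A g"
proof (rule mpol_additive_eqI[where F = "\<lambda>f. restr A (f * g)"])
  show "restr A (Poly_Mapping.single m c * g) = restr A (Poly_Mapping.single m c) * restr A g" for m c
    by (rule mpol_additive_eqI[where F = "\<lambda>g. restr A (Poly_Mapping.single m c * g)"])
      (auto simp: algebra_simps restr_add mult_single restr_single keys_add_nat)
qed (auto simp: algebra_simps restr_add)

lemma restr_var: "restr A (var a) = (if a \<in> A then 0 else var a)"
  by (simp add: var_def restr_single)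

lemma restr_eq_0_iff: "restr A f = 0 \<longleftrightarrow> (\<forall>m\<in>Poly_Mapping.keys f. Poly_Mapping.keys m \<inter> A \<noteq> {})"
  by (auto simp: poly_mapping_eq_iff fun_eq_iff lookup_restr when_def in_keys_iff)

lemma restr_id: "f \<in> polys V \<Longrightarrow> V \<inter> A = {} \<Longrightarrow> restr A f = f"
proof (rule poly_mapping_eqI)
  fix m assume f: "f \<in> polys V" "V \<inter> A = {}"
  have "Poly_Mapping.keys m \<inter> A = {}" if "Poly_Mapping.lookup f m \<noteq> 0"
    using f that unfolding polys_def in_keys_iff[of m f, symmetric] by blast
  then show "Poly_Mapping.lookup (restr A f) m = Poly_Mapping.lookup f m"
    by (auto simp: lookup_restr when_def)
qed

lemma restr_restr: "restr A (restr A' f) = restr (A \<union> A') f"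
  by (rule poly_mapping_eqI) (auto simp: lookup_restr when_def)

lemma restr_polys [intro]: "f \<in> polys V \<Longrightarrow> restr A f \<in> polys (V - A)"
  unfolding polys_def
proof safe
  fix m i assume f: "\<forall>m\<in>Poly_Mapping.keys f. Poly_Mapping.keys m \<subseteq> V"
    and m: "m \<in> Poly_Mapping.keys (restr A f)" "i \<in> Poly_Mapping.keys m"
  have "m \<in> Poly_Mapping.keys f" "Poly_Mapping.keys m \<inter> A = {}"
    using m(1) by (auto simp: in_keys_iff[of m] lookup_restr when_def split: if_splits)
  then show "i \<in> V" "i \<in> A \<Longrightarrow> False" using f m(2) by blast+
qed

text \<open>
  The quotient in the division by the variable \<open>a\<close>, with remainder \<open>restr {a} f\<close> (\<open>var_quo\<close>).
\<close>

definition quo :: "nat \<Rightarrow> 'k::field mpol \<Rightarrow> 'k mpol" where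
  "quo a f = Poly_Mapping.map_key (\<lambda>m. m + Poly_Mapping.single a 1) f"

lemma inj_shift: "inj (\<lambda>m. m + Poly_Mapping.single a (1::nat))"
  by (simp add: inj_def)

lemma lookup_quo: "Poly_Mapping.lookup (quo a f) m = Poly_Mapping.lookup f (m + Poly_Mapping.single a 1)"
  unfolding quo_def by (subst map_key.rep_eq[OF inj_shift]) simp

lemma quo_add: "quo a (f + g) = quo a f + quo a g"
  by (rule poly_mapping_eqI) (auto simp: lookup_quo lookup_add)

lemma quo_0 [simp]: "quo a 0 = 0"
  by (rule poly_mapping_eqI) (auto simp: lookup_quo)

lemma quo_uminus: "quo a (- f) = - quo a f"
  by (rule poly_mapping_eqI) (auto simp: lookup_quo)

lemma quo_sum: "quo a (sum f Z) = (\<Sum>x\<in>Z. quo a (f x))"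
  by (induction Z rule: infinite_finite_induct) (auto simp: quo_add)

lemma quo_sign: "quo a ((- 1) ^ i * f) = (- 1) ^ i * quo a f"
  by (cases "even i") (auto simp: quo_uminus)

lemma quo_polys [intro]: "f \<in> polys V \<Longrightarrow> quo a f \<in> polys V"
  unfolding polys_def
proof safe
  fix m i assume f: "\<forall>m\<in>Poly_Mapping.keys f. Poly_Mapping.keys m \<subseteq> V"
    and m: "m \<in> Poly_Mapping.keys (quo a f)" "i \<in> Poly_Mapping.keys m"
  have "m + Poly_Mapping.single a 1 \<in> Poly_Mapping.keys f"
    using m(1) by (simp add: in_keys_iff[of _ f] in_keys_iff[of _ "quo a f"] lookup_quo)
  then show "i \<in> V" using f m(2) by (force simp: keys_add_nat)
qed

lemma var_times_single: "var a * Poly_Mapping.single m c = Poly_Mapping.single (m + Poly_Mapping.single a 1) c"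
  by (simp add: var_def mult_single add.commute)

lemma single_factor:
  assumes "a \<in> Poly_Mapping.keys m"
  obtains m' where "m = m' + Poly_Mapping.single a (1::nat)"
proof
  show "m = (m - Poly_Mapping.single a 1) + Poly_Mapping.single a 1"
    using assms by (intro poly_mapping_eqI) (auto simp: lookup_add lookup_minus lookup_single when_def in_keys_iff)
qed

lemma quo_single_shift: "quo a (Poly_Mapping.single (m + Poly_Mapping.single a 1) c) = Poly_Mapping.single m c"
  by (rule poly_mapping_eqI) (auto simp: lookup_quo lookup_single)

lemma quo_single_0:
  assumes "a \<notin> Poly_Mapping.keys m"
  shows "quo a (Poly_Mapping.single m c) = 0"
proof (rule poly_mapping_eqI)
  fix m'
  have "m \<noteq> m' + Poly_Mapping.single a 1" using assms by (auto simp: keys_add_nat)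
  then show "Poly_Mapping.lookup (quo a (Poly_Mapping.single m c)) m' = Poly_Mapping.lookup 0 m'"
    by (simp add: lookup_quo lookup_single)
qed

lemma quo_var_same: "quo a (var a * f) = f"
  by (rule mpol_additive_eqI[where F = "\<lambda>f. quo a (var a * f)" and G = "\<lambda>f. f"])
    (simp_all only: algebra_simps quo_add var_times_single quo_single_shift)

lemma quo_var_other:
  assumes "a \<noteq> b" shows "quo a (var b * f) = var b * quo a f"
proof (rule mpol_additive_eqI[where F = "\<lambda>f. quo a (var b * f)"])
  fix m c
  show "quo a (var b * Poly_Mapping.single m c) = var b * quo a (Poly_Mapping.single m c)"
  proof (cases "a \<in> Poly_Mapping.keys m")
    case True
    then obtain m' where m: "m = m' + Poly_Mapping.single a (1::nat)" by (rule single_factor)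
    have "m + Poly_Mapping.single b 1 = (m' + Poly_Mapping.single b 1) + Poly_Mapping.single a 1"
      unfolding m by (simp add: ac_simps)
    then have "quo a (Poly_Mapping.single (m + Poly_Mapping.single b 1) c) = Poly_Mapping.single (m' + Poly_Mapping.single b 1) c"
      by (simp only: quo_single_shift)
    then show ?thesis unfolding m by (simp only: var_times_single quo_single_shift)
  next
    case False
    then have "a \<notin> Poly_Mapping.keys (m + Poly_Mapping.single b 1)"
      using assms by (simp add: keys_add_nat)
    from quo_single_0[OF this] show ?thesis
      by (simp only: var_times_single quo_single_0[OF False] mult_zero_right)
  qed
qed (simp_all add: algebra_simps quo_add)

lemma var_quo: "var a * quo a f = f - restr {a} f"
proof (rule mpol_additive_eqI[where F = "\<lambda>f. var a * quo a f"])
  fix m c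
  show "var a * quo a (Poly_Mapping.single m c) = Poly_Mapping.single m c - restr {a} (Poly_Mapping.single m c)"
  proof (cases "a \<in> Poly_Mapping.keys m")
    case True
    then obtain m' where m: "m = m' + Poly_Mapping.single a (1::nat)" by (rule single_factor)
    show ?thesis unfolding m
      by (simp only: var_times_single quo_single_shift restr_single keys_add_nat) simp
  next
    case False
    then show ?thesis by (simp add: quo_single_0 restr_single)
  qed
qed (simp_all add: algebra_simps quo_add restr_add)

text \<open>
  The variables are split off one at a time: \<open>f\<close> differs from \<open>var a * quo a f\<close> by a polynomial in
  which \<open>a\<close> no longer occurs.
\<close>

lemma restr_eq_0_obtain:
  assumes "finite A" "restr A f = 0" "f \<in> polys V"
  shows "\<exists>g. (\<forall>a. g a \<in> polys V) \<and> f = (\<Sum>a\<in>A. var a * g a)"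
  using assms
proof (induction A arbitrary: f)
  case empty
  then have "f = 0" by (subst (asm) restr_id[of _ V]) auto
  then show ?case by (intro exI[of _ "\<lambda>_. 0"]) auto
next
  case (insert a A)
  have "restr A (restr {a} f) = 0" using insert.prems by (simp add: restr_restr)
  moreover have "restr {a} f \<in> polys V" using restr_polys[OF insert.prems(2)] polys_mono by blast
  ultimately obtain g where g: "\<forall>a. g a \<in> polys V" "restr {a} f = (\<Sum>b\<in>A. var b * g b)"
    using insert.IH by blast
  have "f = var a * quo a f + (\<Sum>b\<in>A. var b * g b)" by (simp add: var_quo flip: g(2))
  also have "(\<Sum>b\<in>A. var b * g b) = (\<Sum>b\<in>A. var b * (g(a := quo a f)) b)"
    by (rule sum.cong) (use insert.hyps in auto)
  finally show ?case using g(1) quo_polys[OF insert.prems(2)] insert.hyps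
    by (intro exI[of _ "g(a := quo a f)"]) auto
qed

lemma cring_RR: "cring (RR n :: 'k::field mpol ring)"
proof (rule cringI)
  show "abelian_group (RR n :: 'k mpol ring)"
  proof (rule abelian_groupI)
    fix x :: "'k mpol" assume "x \<in> carrier (RR n)"
    then show "\<exists>y\<in>carrier (RR n). y \<oplus>\<^bsub>RR n\<^esub> x = \<zero>\<^bsub>RR n\<^esub>"
      by (intro bexI[of _ "- x"]) auto
  qed (auto simp: algebra_simps)
  show "Group.comm_monoid (RR n :: 'k mpol ring)"
    by (rule comm_monoidI) (auto simp: algebra_simps)
qed (auto simp: algebra_simps)

lemma ideal_RR_iff: "ideal I (RR n :: 'k::field mpol ring) \<longleftrightarrow> I \<subseteq> polys {..n} \<and> 0 \<in> I \<and>
   (\<forall>f\<in>I. \<forall>g\<in>I. f + g \<in> I) \<and> (\<forall>f\<in>I. \<forall>g\<in>polys {..n}. g * f \<in> I)"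
proof -
  interpret cring "RR n :: 'k mpol ring" by (rule cring_RR)
  have neg: "\<ominus>\<^bsub>RR n\<^esub> f = - f" if "f \<in> polys {..n}" for f :: "'k mpol"
    by (rule minus_equality) (use that in auto)
  show ?thesis
  proof
    assume I: "ideal I (RR n)"
    interpret ideal I "RR n" by fact
    show "I \<subseteq> polys {..n} \<and> 0 \<in> I \<and> (\<forall>f\<in>I. \<forall>g\<in>I. f + g \<in> I) \<and> (\<forall>f\<in>I. \<forall>g\<in>polys {..n}. g * f \<in> I)"
      using a_subset a_closed zero_closed I_l_closed additive_subgroup.zero_closed[OF is_additive_subgroup] by auto
  next
    assume I: "I \<subseteq> polys {..n} \<and> 0 \<in> I \<and> (\<forall>f\<in>I. \<forall>g\<in>I. f + g \<in> I) \<and> (\<forall>f\<in>I. \<forall>g\<in>polys {..n}. g * f \<in> I)"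
    show "ideal I (RR n)"
    proof (rule idealI)
      show "ring (RR n :: 'k mpol ring)" by (rule ring_axioms)
      have m1: "- f \<in> I" if "f \<in> I" for f
      proof -
        have "(- 1) * f \<in> I" using I that polys_uminus[OF polys_1] by blast
        then show ?thesis by simp
      qed
      show "subgroup I (add_monoid (RR n))"
      proof (rule subgroup.intro)
        show "inv\<^bsub>add_monoid (RR n)\<^esub> f \<in> I" if "f \<in> I" for f
          using neg[of f] m1[OF that] that I unfolding a_inv_def by auto
      qed (use I in auto)
    qed (use I in \<open>auto simp: mult.commute\<close>)
  qed
qed

lemma Idl_polys_iff:
  assumes "S \<subseteq> polys {..n}"
  shows "ideal (Idl\<^bsub>RR n\<^esub> S) (RR n :: 'k::field mpol ring)" "S \<subseteq> Idl\<^bsub>RR n\<^esub> S"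
    "\<And>I. ideal I (RR n) \<Longrightarrow> S \<subseteq> I \<Longrightarrow> Idl\<^bsub>RR n\<^esub> S \<subseteq> I"
proof -
  interpret cring "RR n :: 'k mpol ring" by (rule cring_RR)
  show "ideal (Idl\<^bsub>RR n\<^esub> S) (RR n :: 'k::field mpol ring)" "S \<subseteq> Idl\<^bsub>RR n\<^esub> S"
    "\<And>I. ideal I (RR n) \<Longrightarrow> S \<subseteq> I \<Longrightarrow> Idl\<^bsub>RR n\<^esub> S \<subseteq> I"
    using genideal_ideal genideal_self genideal_minimal assms by auto
qed

lemma ideal_RR_sum:
  "ideal I (RR n) \<Longrightarrow> (\<And>x. x \<in> Z \<Longrightarrow> f x \<in> I) \<Longrightarrow> sum f Z \<in> I"
  by (induction Z rule: infinite_finite_induct) (auto simp: ideal_RR_iff)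

lemma Idl_vars_eq:
  assumes "A \<subseteq> {..n}"
  shows "Idl\<^bsub>RR n\<^esub> (var ` A) = {f \<in> polys {..n}. restr A (f :: 'k::field mpol) = 0}" (is "_ = ?I")
proof
  have S: "var ` A \<subseteq> (polys {..n} :: 'k mpol set)" using assms by auto
  have "ideal ?I (RR n)" by (auto simp: ideal_RR_iff restr_add restr_mult)
  moreover have "var ` A \<subseteq> ?I" using S by (auto simp: restr_var)
  ultimately show "Idl\<^bsub>RR n\<^esub> (var ` A) \<subseteq> ?I" using Idl_polys_iff[OF S] by blast
  have fin: "finite A" using assms finite_subset by blast
  show "?I \<subseteq> Idl\<^bsub>RR n\<^esub> (var ` A)"
  proof
    fix f assume "f \<in> ?I"
    then obtain g where g: "\<forall>a. g a \<in> polys {..n}" "f = (\<Sum>a\<in>A. var a * g a)"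
      using restr_eq_0_obtain[OF fin] by blast
    have "var a * g a \<in> Idl\<^bsub>RR n\<^esub> (var ` A)" if "a \<in> A" for a
      using Idl_polys_iff(1,2)[OF S] g(1) that unfolding ideal_RR_iff
      by (metis mult.commute image_subset_iff)
    then show "f \<in> Idl\<^bsub>RR n\<^esub> (var ` A)" unfolding g(2)
      by (rule ideal_RR_sum[OF Idl_polys_iff(1)[OF S]])
  qed
qed

lemma line_ideal_eq: "line_ideal n = {f \<in> polys {..n}. restr {..n - 2} (f :: 'k::field mpol) = 0}"
  unfolding line_ideal_def by (rule Idl_vars_eq) auto

lemma irrelevant_ideal_eq: "irrelevant_ideal n = {f \<in> polys {..n}. Poly_Mapping.lookup (f :: 'k::field mpol) 0 = 0}"
proof -
  have "restr {..n} f = 0 \<longleftrightarrow> Poly_Mapping.lookup f 0 = 0" if "f \<in> polys {..n}" for f :: "'k mpol"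
  proof -
    have "Poly_Mapping.keys m \<inter> {..n} \<noteq> {} \<longleftrightarrow> m \<noteq> 0" if "m \<in> Poly_Mapping.keys f" for m
    proof -
      have "Poly_Mapping.keys m \<subseteq> {..n}" using that \<open>f \<in> _\<close> by (auto simp: polys_def)
      then have "Poly_Mapping.keys m \<inter> {..n} = Poly_Mapping.keys m" by blast
      then show ?thesis by (auto simp: poly_mapping_eq_iff fun_eq_iff in_keys_iff set_eq_iff)
    qed
    then show ?thesis by (auto simp: restr_eq_0_iff in_keys_iff)
  qed
  then show ?thesis unfolding irrelevant_ideal_def by (subst Idl_vars_eq) auto
qed

text \<open>
  This is the generic point of the line.  The ideal is prime because it is the kernel of a
  ring homomorphism into an integral domain.
\<close>

lemma line_ideal_in_support:
  assumes "n \<ge> 2"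
  shows "(line_ideal n :: 'k::field mpol set) \<in> support n (line_ideal n)"
proof -
  let ?L = "line_ideal n :: 'k mpol set"
  have S: "var ` {..n - 2} \<subseteq> (polys {..n} :: 'k mpol set)" by auto
  have id: "ideal ?L (RR n)" unfolding line_ideal_def by (rule Idl_polys_iff[OF S])
  have vn: "var n \<notin> ?L" 
  proof
    assume "var n \<in> ?L"
    then have "restr {..n - 2} (var n :: 'k mpol) = 0" by (simp add: line_ideal_eq)
    then have "(var n :: 'k mpol) = 0" using assms by (simp add: restr_var split: if_splits)
    then show False by simp
  qed
  have "primeideal ?L (RR n)"
  proof (rule primeidealI[OF id cring_RR])
    show "carrier (RR n) \<noteq> ?L" using vn polys_var[of n "{..n}"] by auto
    show "a \<in> ?L \<or> b \<in> ?L" if "a \<in> carrier (RR n)" "b \<in> carrier (RR n)" "a \<otimes>\<^bsub>RR n\<^esub> b \<in> ?L" for a b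
      using that by (auto simp: line_ideal_eq restr_mult)
  qed
  moreover have "homogeneous_ideal n ?L"
    unfolding homogeneous_ideal_def
  proof (intro conjI id)
    let ?H = "{f \<in> ?L. \<exists>d. homog d f}"
    have sub: "?L \<subseteq> polys {..n}" by (auto simp: line_ideal_eq)
    have H: "?H \<subseteq> polys {..n}" using sub by blast
    have "var ` {..n - 2} \<subseteq> ?H" using Idl_polys_iff(2)[OF S] homog_var by (auto simp: line_ideal_def)
    then have "var ` {..n - 2} \<subseteq> Idl\<^bsub>RR n\<^esub> ?H" using Idl_polys_iff(2)[OF H] by (rule subset_trans)
    from Idl_polys_iff(3)[OF S Idl_polys_iff(1)[OF H] this]
    have "?L \<subseteq> Idl\<^bsub>RR n\<^esub> ?H" by (simp only: line_ideal_def)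
    moreover have "Idl\<^bsub>RR n\<^esub> ?H \<subseteq> ?L" by (rule Idl_polys_iff(3)[OF H id]) auto
    ultimately show "?L = Idl\<^bsub>RR n\<^esub> ?H" by blast
  qed
  moreover have "var n \<in> (irrelevant_ideal n :: 'k mpol set)" by (simp add: irrelevant_ideal_eq)
  ultimately show ?thesis using vn unfolding support_def Proj_def by auto
qed

section \<open>Exactness of the Koszul complex\<close>

text \<open>
  The common carrier of the graded free modules on \<open>V\<close>.  As the values outside \<open>V\<close> vanish, asking
  for polynomials at every argument is no restriction and saves case distinctions.
\<close>

definition coords :: "nat \<Rightarrow> 'i set \<Rightarrow> ('i \<Rightarrow> 'k::field mpol) set" where
  "coords n V = {f. (\<forall>x. f x \<in> polys {..n}) \<and> (\<forall>x. x \<notin> V \<longrightarrow> f x = 0)}"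

lemma carrier_free_module: "carrier (free_module n V w) = coords n V"
  by (auto simp: free_module_def coords_def)

lemma coordsD: "f \<in> coords n V \<Longrightarrow> f x \<in> polys {..n}" "f \<in> coords n V \<Longrightarrow> x \<notin> V \<Longrightarrow> f x = 0"
  by (auto simp: coords_def)

lemma coords_0 [simp, intro]: "0 \<in> coords n V"
  by (auto simp: coords_def)

lemma coords_add [intro]: "f \<in> coords n V \<Longrightarrow> g \<in> coords n V \<Longrightarrow> f + g \<in> coords n V"
  and coords_diff [intro]: "f \<in> coords n V \<Longrightarrow> g \<in> coords n V \<Longrightarrow> f - g \<in> coords n V"
  and coords_uminus [intro]: "f \<in> coords n V \<Longrightarrow> - f \<in> coords n V"
  and coords_smult: "p \<in> polys {..n} \<Longrightarrow> f \<in> coords n V \<Longrightarrow> (\<lambda>x. p * f x) \<in> coords n V"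
  by (auto simp: coords_def)

lemma coords_slice: "z \<in> coords n (V \<times> W) \<Longrightarrow> (\<lambda>x. z (x, l)) \<in> coords n V"
  by (auto simp: coords_def)

lemma finite_ext_basis [simp, intro]: "finite (ext_basis n i)"
  by (rule finite_subset[of _ "Pow {..<n - 1}"]) (auto simp: ext_basis_def)

lemma ext_basis_finite: "I \<in> ext_basis n i \<Longrightarrow> finite I"
  by (auto simp: ext_basis_def intro: finite_subset)

lemma ext_basis_insert: "a \<notin> J \<Longrightarrow> insert a J \<in> ext_basis n (Suc i) \<longleftrightarrow> a < n - 1 \<and> J \<in> ext_basis n i"
proof -
  assume a: "a \<notin> J"
  have "insert a J \<subseteq> {..<n - 1} \<Longrightarrow> finite J" by (auto intro: finite_subset)
  moreover have "J \<subseteq> {..<n - 1} \<Longrightarrow> finite J" by (auto intro: finite_subset)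
  ultimately show ?thesis using a by (auto simp: ext_basis_def)
qed

lemma ext_basis_0: "ext_basis n 0 = {{}}"
proof -
  have "finite I" if "I \<subseteq> {..<n - 1}" for I using that by (rule finite_subset) simp
  then show ?thesis unfolding ext_basis_def by auto
qed

text \<open>
  The terms cancel in pairs.  Comparing the sum with its negative would prove this only when two is
  invertible; the induction works in every characteristic.
\<close>

lemma sum_antisymmetric:
  fixes g :: "'a \<Rightarrow> 'a \<Rightarrow> 'b::ab_group_add"
  assumes "finite A" "\<And>a b. a \<in> A \<Longrightarrow> b \<in> A \<Longrightarrow> a \<noteq> b \<Longrightarrow> g a b = - g b a"
  shows "(\<Sum>a\<in>A. \<Sum>b\<in>A - {a}. g a b) = 0"
  using assms
proof (induction A)
  case (insert c A)
  have "(\<Sum>a\<in>A. \<Sum>b\<in>insert c A - {a}. g a b) = (\<Sum>a\<in>A. g a c + (\<Sum>b\<in>A - {a}. g a b))"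
  proof (rule sum.cong)
    fix a assume "a \<in> A"
    then have "insert c A - {a} = insert c (A - {a})" using insert.hyps by auto
    then show "(\<Sum>b\<in>insert c A - {a}. g a b) = g a c + (\<Sum>b\<in>A - {a}. g a b)"
      using insert.hyps by simp
  qed simp
  also have "\<dots> = (\<Sum>a\<in>A. g a c) + (\<Sum>a\<in>A. \<Sum>b\<in>A - {a}. g a b)" by (simp add: sum.distrib)
  also have "(\<Sum>a\<in>A. \<Sum>b\<in>A - {a}. g a b) = 0" by (rule insert.IH) (use insert.prems in blast)
  also have "(\<Sum>a\<in>A. g a c) = (\<Sum>a\<in>A. - g c a)"
    by (intro sum.cong refl insert.prems) (use insert.hyps in auto)
  finally show ?case using insert.hyps by (simp add: sum_negf)
qed simp

lemma position_sign_insert [simp]: "position_sign a (insert a J) = position_sign a J"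
  unfolding position_sign_def by (rule arg_cong[where f = "\<lambda>A. (- 1) ^ card A"]) auto

lemma position_sign_square [simp]:
  "position_sign a J * position_sign a J = (1 :: 'k::field mpol)"
  "position_sign a J * (position_sign a J * x) = (x :: 'k::field mpol)"
proof -
  show "position_sign a J * position_sign a J = (1 :: 'k::field mpol)"
    by (simp add: position_sign_def flip: power_add mult_2)
  then show "position_sign a J * (position_sign a J * x) = (x :: 'k::field mpol)"
    by (simp flip: mult.assoc)
qed

text \<open>
  Adding \<open>a\<close> and \<open>b\<close> to \<open>J\<close> in the two possible orders produces opposite signs.  This is the reason for
  \<open>\<delta>\<delta> = 0\<close>, for \<open>\<delta>\<partial> = - \<partial>\<delta>\<close>, and for the cancellation in the homotopy formula.
\<close>

lemma position_sign_swap: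
  assumes "a \<noteq> b" "a \<notin> J" "b \<notin> J"
  shows "position_sign a J * position_sign b (insert a J) =
    - (position_sign b J * position_sign a (insert b J) :: 'k::field mpol)"
proof -
  have main: "position_sign a J * position_sign b (insert a J) =
      - (position_sign b J * position_sign a (insert b J) :: 'k mpol)"
    if "a < b" "a \<notin> J" for a b
  proof -
    have "{c \<in> insert a J. c < b} = insert a {c \<in> J. c < b}" using that by auto
    then have "card {c \<in> insert a J. c < b} = Suc (card {c \<in> J. c < b})" using that by simp
    moreover have "{c \<in> insert b J. c < a} = {c \<in> J. c < a}" using that by auto
    ultimately show ?thesis by (simp add: position_sign_def)
  qed
  show ?thesis
  proof (cases "a < b")
    case False
    then show ?thesis using main[of b a] assms by simp
  qed (use main assms in auto)
qed

text \<open>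
  The Koszul differential from the point of view of the target: the coordinate at \<open>J\<close> collects the
  contributions of the sets \<open>insert a J\<close>.  In this form it is the same expression in all exterior degrees.
\<close>

definition contraction :: "nat \<Rightarrow> (nat set \<Rightarrow> 'k::field mpol) \<Rightarrow> nat set \<Rightarrow> 'k mpol" where
  "contraction n f J = (\<Sum>a\<in>{..<n - 1} - J. position_sign a J * (var a * f (insert a J)))"

lemma koszul_eq:
  assumes "f \<in> coords n (ext_basis n i)"
  shows "koszul n i f = contraction n f"
proof
  fix J
  have "koszul n i f J = (\<Sum>I\<in>ext_basis n i. \<Sum>a<n - 1.
      if a \<notin> J \<and> I = insert a J then position_sign a J * (var a * f (insert a J)) else 0)"
    unfolding koszul_def linear_extension_def
  proof (rule sum.cong)
    fix I assume "I \<in> ext_basis n i"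
    then have I: "I \<subseteq> {..<n - 1}" by (simp add: ext_basis_def)
    have "f I * (\<Sum>a\<in>I. position_sign a I * var a * basis_vec (I - {a}) J) =
        (\<Sum>a\<in>I. if a \<notin> J \<and> I = insert a J then position_sign a J * (var a * f (insert a J)) else 0)"
      unfolding sum_distrib_left
    proof (rule sum.cong)
      fix a assume a: "a \<in> I"
      show "f I * (position_sign a I * var a * basis_vec (I - {a}) J) =
        (if a \<notin> J \<and> I = insert a J then position_sign a J * (var a * f (insert a J)) else 0)"
      proof (cases "J = I - {a}")
        case True
        then have J: "I - {a} = J" "a \<notin> J" "insert a J = I" using a by auto
        have "position_sign a I = (position_sign a J :: 'a mpol)" unfolding J(3)[symmetric] by simp
        then show ?thesis using J by (simp add: basis_vec_def)
      next
        case False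
        then have "\<not> (a \<notin> J \<and> I = insert a J)" by auto
        then show ?thesis using False by (simp only: basis_vec_def if_False mult_zero_right)
      qed
    qed simp
    also have "\<dots> = (\<Sum>a<n - 1. if a \<notin> J \<and> I = insert a J then position_sign a J * (var a * f (insert a J)) else 0)"
      by (rule sum.mono_neutral_left) (use I in auto)
    finally show "f I * (\<Sum>a\<in>I. position_sign a I * var a * basis_vec (I - {a}) J) = \<dots>" .
  qed simp
  also have "\<dots> = (\<Sum>a<n - 1. if a \<notin> J then position_sign a J * (var a * f (insert a J)) else 0)"
  proof (subst sum.swap, rule sum.cong)
    fix a
    show "(\<Sum>I\<in>ext_basis n i. if a \<notin> J \<and> I = insert a J then position_sign a J * (var a * f (insert a J)) else 0) =
      (if a \<notin> J then position_sign a J * (var a * f (insert a J)) else 0)"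
      using coordsD(2)[OF assms, of "insert a J"] by (cases "a \<in> J") auto
  qed simp
  also have "\<dots> = contraction n f J" unfolding contraction_def
    by (rule sum.mono_neutral_cong_right) auto
  finally show "koszul n i f J = contraction n f J" .
qed

lemma partial_eq:
  fixes f :: "nat set \<Rightarrow> 'k::field mpol"
  assumes "f \<in> coords n (ext_basis n i)"
  shows "partial n i f (J, l) = (if l \<in> J then 0 else position_sign l J * f (insert l J))"
proof -
  have "partial n i f (J, l) = (\<Sum>I\<in>ext_basis n i.
      if l \<notin> J \<and> I = insert l J then position_sign l J * f (insert l J) else 0)"
    unfolding partial_def linear_extension_def
  proof (rule sum.cong)
    fix I assume "I \<in> ext_basis n i"
    then have I: "finite I" by (rule ext_basis_finite)
    have "(\<Sum>a\<in>I. position_sign a I * basis_vec (I - {a}, a) (J, l) :: 'k mpol) =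
        (\<Sum>a\<in>I. if l = a then (if l \<notin> J \<and> I = insert l J then position_sign l J else 0) else 0)"
    proof (rule sum.cong)
      fix a assume a: "a \<in> I"
      show "(position_sign a I * basis_vec (I - {a}, a) (J, l) :: 'k mpol) =
        (if l = a then (if l \<notin> J \<and> I = insert l J then position_sign l J else 0) else 0)"
      proof (cases "l = a \<and> J = I - {a}")
        case True
        then have J: "I - {a} = J" "a \<notin> J" "insert a J = I" "l = a" using a by auto
        have "position_sign a I = (position_sign a J :: 'k mpol)" unfolding J(3)[symmetric] by simp
        then show ?thesis using J by (simp add: basis_vec_def)
      next
        case False
        then have "\<not> (l = a \<and> a \<notin> J \<and> I = insert a J)" by auto
        then show ?thesis using False by (auto simp: basis_vec_def)
      qed
    qed simp
    then show "f I * (\<Sum>a\<in>I. position_sign a I * basis_vec (I - {a}, a) (J, l)) =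
      (if l \<notin> J \<and> I = insert l J then position_sign l J * f (insert l J) else 0)"
      using I by (auto simp: mult.commute)
  qed simp
  also have "\<dots> = (if l \<in> J then 0 else position_sign l J * f (insert l J))"
    using coordsD(2)[OF assms, of "insert l J"] by (cases "l \<in> J") auto
  finally show ?thesis .
qed

lemma polys_position_sign [simp, intro]: "position_sign a J \<in> polys V"
  by (simp add: position_sign_def)

lemma contraction_coords:
  assumes "f \<in> coords n (ext_basis n (Suc i))"
  shows "contraction n f \<in> coords n (ext_basis n i)"
  unfolding coords_def
proof safe
  fix J
  show "contraction n f J \<in> polys {..n}" unfolding contraction_def
    by (intro polys_sum polys_mult coordsD(1)[OF assms]) auto
  assume "J \<notin> ext_basis n i"
  then have "f (insert a J) = 0" if "a \<notin> J" for a
    using coordsD(2)[OF assms, of "insert a J"] ext_basis_insert[OF that] by auto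
  then show "contraction n f J = 0" unfolding contraction_def by (intro sum.neutral) auto
qed

lemma contraction_add: "contraction n (f + g) = contraction n f + contraction n g"
  by (auto simp: contraction_def fun_eq_iff algebra_simps sum.distrib)

lemma contraction_diff: "contraction n (f - g) = contraction n f - contraction n g"
  by (auto simp: contraction_def fun_eq_iff algebra_simps sum_subtractf)

lemma contraction_0 [simp]: "contraction n 0 = 0"
  by (auto simp: contraction_def fun_eq_iff)

lemma contraction_contraction: "contraction n (contraction n f) = 0"
proof
  fix J
  let ?A = "{..<n - 1} - J"
  let ?g = "\<lambda>a b. position_sign a J * position_sign b (insert a J) * (var a * var b * f (insert a (insert b J)))"
  have "contraction n (contraction n f) J = (\<Sum>a\<in>?A. \<Sum>b\<in>?A - {a}. ?g a b)"
    unfolding contraction_def sum_distrib_left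
    by (intro sum.cong) (auto simp: ac_simps insert_commute)
  also have "\<dots> = 0"
  proof (rule sum_antisymmetric)
    fix a b assume "a \<in> ?A" "b \<in> ?A" "a \<noteq> b"
    then show "?g a b = - ?g b a" using position_sign_swap[of a b J, where 'k = 'a]
      by (simp add: insert_commute mult.commute[of "var a"])
  qed simp
  finally show "contraction n (contraction n f) J = 0 J" by simp
qed

text \<open>
  Exterior multiplication by \<open>e\<^sub>a\<close> after division of the coefficients by \<open>x\<^sub>a\<close>.
\<close>

definition homotopy :: "nat \<Rightarrow> (nat set \<Rightarrow> 'k::field mpol) \<Rightarrow> nat set \<Rightarrow> 'k mpol" where
  "homotopy a f I = (if a \<in> I then position_sign a (I - {a}) * quo a (f (I - {a})) else 0)"

lemma quo_position_sign: "quo a (position_sign b J * f) = position_sign b J * quo a f"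
  by (simp add: position_sign_def quo_sign)

text \<open>
  Contracting \<open>e\<^sub>a\<close> multiplies by \<open>x\<^sub>a\<close> and so undoes the division by \<open>x\<^sub>a\<close> up to the remainder; this
  gives the right-hand side.  The contractions of the other \<open>e\<^sub>b\<close> commute with the division by \<open>x\<^sub>a\<close>,
  and their contributions to the two compositions have opposite signs.
\<close>

lemma homotopy_formula:
  assumes "a < n - 1"
  shows "contraction n (homotopy a f) J + homotopy a (contraction n f) J =
    f J - (if a \<in> J then 0 else restr {a} (f J))"
proof (cases "a \<in> J")
  case False
  have "contraction n (homotopy a f) J =
      (\<Sum>b\<in>{..<n - 1} - J. if b = a then var a * quo a (f J) else 0)"
    unfolding contraction_def
  proof (rule sum.cong)
    fix b assume b: "b \<in> {..<n - 1} - J"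
    show "position_sign b J * (var b * homotopy a f (insert b J)) = (if b = a then var a * quo a (f J) else 0)"
    proof (cases "b = a")
      case True
      have "insert a J - {a} = J" using False by auto
      then show ?thesis using True by (simp add: homotopy_def mult.left_commute)
    next
      case b: False
      then show ?thesis using False by (simp add: homotopy_def)
    qed
  qed simp
  also have "\<dots> = var a * quo a (f J)" using assms False by simp
  finally show ?thesis using False by (simp add: homotopy_def var_quo)
next
  case True
  define J' where "J' = J - {a}"
  have J: "J = insert a J'" "a \<notin> J'" using True by (auto simp: J'_def)
  let ?A = "{..<n - 1} - J"
  let ?g = "\<lambda>b. var b * quo a (f (insert b J'))"
  have A: "{..<n - 1} - J' = insert a ?A" using assms J by auto
  have "homotopy a (contraction n f) J = position_sign a J' * quo a (contraction n f J')"
    using True by (simp add: homotopy_def J'_def)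
  also have "contraction n f J' = position_sign a J' * (var a * f J) +
      (\<Sum>b\<in>?A. position_sign b J' * (var b * f (insert b J')))"
    unfolding contraction_def A using J by (subst sum.insert) auto
  also have "quo a \<dots> = position_sign a J' * f J + (\<Sum>b\<in>?A. position_sign b J' * ?g b)"
    unfolding quo_add quo_sum quo_position_sign quo_var_same
    by (intro arg_cong2[where f = "(+)"] refl sum.cong) (auto simp: quo_var_other J)
  also have "position_sign a J' * \<dots> = f J + (\<Sum>b\<in>?A. position_sign a J' * (position_sign b J' * ?g b))"
    by (simp add: distrib_left sum_distrib_left)
  finally have 1: "homotopy a (contraction n f) J = \<dots>" .
  have "contraction n (homotopy a f) J = (\<Sum>b\<in>?A. - (position_sign a J' * (position_sign b J' * ?g b)))"
    unfolding contraction_def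
  proof (rule sum.cong)
    fix b assume b: "b \<in> ?A"
    have e: "insert b J - {a} = insert b J'" using J b by auto
    have "position_sign a J' * position_sign b (insert a J') =
        - (position_sign b J' * position_sign a (insert b J') :: 'a mpol)"
      by (rule position_sign_swap) (use J b in auto)
    then have "position_sign a J' * (position_sign a J' * position_sign b (insert a J')) * position_sign a (insert b J') =
        position_sign a J' * (- (position_sign b J' * position_sign a (insert b J')) :: 'a mpol) * position_sign a (insert b J')"
      by simp
    then have s: "position_sign b J * position_sign a (insert b J') = - (position_sign a J' * position_sign b J' :: 'a mpol)"
      unfolding J(1)[symmetric] by (simp add: mult.assoc) 
    have "position_sign b J * (var b * homotopy a f (insert b J)) =
        (position_sign b J * position_sign a (insert b J')) * ?g b"
      using True by (simp add: homotopy_def e ac_simps)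
    then show "position_sign b J * (var b * homotopy a f (insert b J)) = - (position_sign a J' * (position_sign b J' * ?g b))"
      unfolding s by (simp add: mult.assoc)
  qed simp
  then show ?thesis using True unfolding 1 by (simp add: sum_negf)
qed

lemma homotopy_coords:
  assumes "f \<in> coords n (ext_basis n i)" "a < n - 1"
  shows "homotopy a f \<in> coords n (ext_basis n (Suc i))"
  unfolding coords_def
proof safe
  fix I
  show "homotopy a f I \<in> polys {..n}"
    using coordsD(1)[OF assms(1), of "I - {a}"] by (auto simp: homotopy_def)
  assume I: "I \<notin> ext_basis n (Suc i)"
  show "homotopy a f I = 0"
  proof (cases "a \<in> I")
    case True
    then have "I = insert a (I - {a})" by auto
    then have "I - {a} \<notin> ext_basis n i" using I ext_basis_insert[of a "I - {a}" n i] assms(2) by auto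
    then show ?thesis using coordsD(2)[OF assms(1)] by (simp add: homotopy_def position_sign_def)
  qed (simp add: homotopy_def)
qed

text \<open>
  Subtracting the boundaries given by the homotopies for \<open>a = 0, 1, \<dots>, m - 1\<close> turns the cycle \<open>f\<close> into a
  homologous cycle whose coordinates vanish at all sets meeting \<open>{..<m}\<close>.  For \<open>m = n - 1\<close> these are all
  sets that occur in positive exterior degree.
\<close>

lemma contraction_exact:
  assumes f: "f \<in> coords n (ext_basis n (Suc i))" "contraction n f = 0"
  shows "\<exists>w\<in>coords n (ext_basis n (Suc (Suc i))). f = contraction n w"
proof -
  have "m \<le> n - 1 \<Longrightarrow> \<exists>g w. g \<in> coords n (ext_basis n (Suc i)) \<and> w \<in> coords n (ext_basis n (Suc (Suc i))) \<and>
      f = g + contraction n w \<and> contraction n g = 0 \<and> (\<forall>J. J \<inter> {..<m} \<noteq> {} \<longrightarrow> g J = 0)" for m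
  proof (induction m)
    case 0
    have "f = f + contraction n 0" by simp
    then show ?case using f coords_0 by blast
  next
    case (Suc m)
    then obtain g w where g: "g \<in> coords n (ext_basis n (Suc i))" "w \<in> coords n (ext_basis n (Suc (Suc i)))"
      "f = g + contraction n w" "contraction n g = 0" "\<And>J. J \<inter> {..<m} \<noteq> {} \<Longrightarrow> g J = 0" by (meson Suc_leD)
    have m: "m < n - 1" using Suc by simp
    let ?h = "homotopy m g"
    have h: "?h \<in> coords n (ext_basis n (Suc (Suc i)))" by (rule homotopy_coords[OF g(1) m])
    have gh: "(g - contraction n ?h) J = (if m \<in> J then 0 else restr {m} (g J))" for J
    proof -
      have "homotopy m (contraction n g) J = 0" by (simp add: g(4) homotopy_def)
      then have c: "contraction n ?h J = g J - (if m \<in> J then 0 else restr {m} (g J))"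
        using homotopy_formula[OF m, of g J] by simp
      show ?thesis by (simp add: fun_diff_def c)
    qed
    show ?case
    proof (rule exI[of _ "g - contraction n ?h"], rule exI[of _ "w + ?h"], intro conjI allI impI)
      show "f = g - contraction n ?h + contraction n (w + ?h)" by (simp add: g(3) contraction_add)
      show "contraction n (g - contraction n ?h) = 0" by (simp add: contraction_diff contraction_contraction g(4))
      fix J assume "J \<inter> {..<Suc m} \<noteq> {}"
      then have "m \<in> J \<or> J \<inter> {..<m} \<noteq> {}" by (auto simp: lessThan_Suc)
      then show "(g - contraction n ?h) J = 0" unfolding gh using g(5)[of J] by (elim disjE) simp_all
    qed (intro coords_diff coords_add g h contraction_coords)+
  qed
  from this[of "n - 1"] obtain g w where g: "g \<in> coords n (ext_basis n (Suc i))" "w \<in> coords n (ext_basis n (Suc (Suc i)))"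
      "f = g + contraction n w" "\<And>J. J \<inter> {..<n - 1} \<noteq> {} \<Longrightarrow> g J = 0" by blast
  have "g J = 0" for J
  proof (cases "J \<in> ext_basis n (Suc i)")
    case True
    then have "J \<subseteq> {..<n - 1}" "J \<noteq> {}" by (auto simp: ext_basis_def)
    then show ?thesis using g(4) by blast
  qed (use coordsD(2)[OF g(1)] in auto)
  then have "g = 0" by (simp add: fun_eq_iff)
  then have "f = contraction n w" using g(3) by (simp only: add_0)
  then show ?thesis using g(2) by blast
qed

section \<open>The complex resolving the square of the ideal of the line\<close>

lemma tensor_id_apply: "tensor_id f z (J, l) = f (\<lambda>i. z (i, l)) J"
  by (simp add: tensor_id_def)

lemma coords_prodI:
  assumes "\<And>x y. z (x, y) \<in> polys {..n}" "\<And>x y. \<not> (x \<in> V \<and> y \<in> W) \<Longrightarrow> z (x, y) = 0"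
  shows "z \<in> coords n (V \<times> W)"
  using assms by (auto simp: coords_def)

lemma tensor_koszul_coords:
  assumes "z \<in> coords n (ext_basis n (Suc i) \<times> W)"
  shows "tensor_id (koszul n (Suc i)) z \<in> coords n (ext_basis n i \<times> W)"
proof (rule coords_prodI)
  fix J l
  have s: "(\<lambda>I. z (I, l)) \<in> coords n (ext_basis n (Suc i))" using assms by (rule coords_slice)
  note c = contraction_coords[OF s]
  show "tensor_id (koszul n (Suc i)) z (J, l) \<in> polys {..n}"
    using coordsD(1)[OF c] by (simp add: tensor_id_apply koszul_eq[OF s])
  assume J: "\<not> (J \<in> ext_basis n i \<and> l \<in> W)"
  show "tensor_id (koszul n (Suc i)) z (J, l) = 0"
  proof (cases "l \<in> W")
    case True
    then show ?thesis using coordsD(2)[OF c] J by (simp add: tensor_id_apply koszul_eq[OF s])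
  next
    case False
    then have "(\<lambda>I. z (I, l)) = 0" using coordsD(2)[OF assms] by (auto simp: fun_eq_iff)
    then have "contraction n (\<lambda>I. z (I, l)) J = 0" by (simp only: contraction_0 zero_fun_apply)
    then show ?thesis by (simp add: tensor_id_apply koszul_eq[OF s])
  qed
qed

text \<open>
  The Koszul complex tensored with the free module on \<open>W\<close> is a direct sum of copies of the Koszul
  complex, one for each slice.
\<close>

lemma tensor_koszul_exact:
  assumes z: "z \<in> coords n (ext_basis n (Suc i) \<times> W)" "tensor_id (koszul n (Suc i)) z = 0"
  shows "\<exists>w\<in>coords n (ext_basis n (Suc (Suc i)) \<times> W). z = tensor_id (koszul n (Suc (Suc i))) w"
proof -
  have "\<exists>w\<in>coords n (ext_basis n (Suc (Suc i))). (\<lambda>I. z (I, l)) = contraction n w" for l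
  proof (rule contraction_exact)
    show s: "(\<lambda>I. z (I, l)) \<in> coords n (ext_basis n (Suc i))" using z(1) by (rule coords_slice)
    have "contraction n (\<lambda>I. z (I, l)) J = 0" for J
      using fun_cong[OF z(2), of "(J, l)"] by (simp add: tensor_id_apply koszul_eq[OF s])
    then show "contraction n (\<lambda>I. z (I, l)) = 0" by (simp add: fun_eq_iff)
  qed
  then obtain w where w: "\<And>l. w l \<in> coords n (ext_basis n (Suc (Suc i)))"
    "\<And>l. (\<lambda>I. z (I, l)) = contraction n (w l)" by metis
  let ?w = "\<lambda>(I, l). if l \<in> W then w l I else 0"
  have w': "?w \<in> coords n (ext_basis n (Suc (Suc i)) \<times> W)"
    using w(1) by (auto simp: coords_def)
  moreover have "z (J, l) = tensor_id (koszul n (Suc (Suc i))) ?w (J, l)" for J l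
  proof (cases "l \<in> W")
    case True
    then have "(\<lambda>I. ?w (I, l)) = w l" by simp
    then show ?thesis using fun_cong[OF w(2)[of l], of J] koszul_eq[OF w(1)[of l]]
      by (simp add: tensor_id_apply)
  next
    case False
    have "tensor_id (koszul n (Suc (Suc i))) ?w (J, l) = 0"
      using coordsD(2)[OF tensor_koszul_coords[OF w'], of "(J, l)"] False by simp
    then show ?thesis using coordsD(2)[OF z(1), of "(J, l)"] False by simp
  qed
  then have "z = tensor_id (koszul n (Suc (Suc i))) ?w" by auto
  ultimately show ?thesis by blast
qed

lemma linear_extension_add: "linear_extension V F (f + g) = linear_extension V F f + linear_extension V F g"
  by (auto simp: linear_extension_def fun_eq_iff algebra_simps sum.distrib)

lemma linear_extension_smult: "linear_extension V F (\<lambda>x. p * f x) = (\<lambda>y. p * linear_extension V F f y)"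
  by (auto simp: linear_extension_def fun_eq_iff algebra_simps sum_distrib_left)

lemma tensor_koszul_add: "tensor_id (koszul n i) (f + g) = tensor_id (koszul n i) f + tensor_id (koszul n i) g"
  using linear_extension_add[of "ext_basis n i"]
  by (force simp: tensor_id_apply fun_eq_iff koszul_def plus_fun_def)

lemma tensor_koszul_smult: "tensor_id (koszul n i) (\<lambda>x. p * f x) = (\<lambda>y. p * tensor_id (koszul n i) f y)"
  by (auto simp: tensor_id_apply fun_eq_iff koszul_def linear_extension_smult)

lemma tensor_koszul_uminus: "tensor_id (koszul n i) (- f) = - tensor_id (koszul n i) f"
  using tensor_koszul_smult[of n i "- 1" f] by (simp add: fun_Compl_def)

lemma tensor_koszul_diff: "tensor_id (koszul n i) (f - g) = tensor_id (koszul n i) f - tensor_id (koszul n i) g"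
  using tensor_koszul_add[of n i f "- g"] by (simp add: tensor_koszul_uminus)

lemma tensor_koszul_0: "tensor_id (koszul n i) 0 = 0"
  using tensor_koszul_add[of n i 0 0] by simp

lemma tensor_koszul_koszul:
  assumes z: "z \<in> coords n (ext_basis n (Suc (Suc i)) \<times> W)"
  shows "tensor_id (koszul n (Suc i)) (tensor_id (koszul n (Suc (Suc i))) z) = 0"
proof -
  have "tensor_id (koszul n (Suc i)) (tensor_id (koszul n (Suc (Suc i))) z) (J, l) = 0" for J l
  proof -
    have s: "(\<lambda>I. z (I, l)) \<in> coords n (ext_basis n (Suc (Suc i)))" using z by (rule coords_slice)
    have "(\<lambda>I. tensor_id (koszul n (Suc (Suc i))) z (I, l)) = contraction n (\<lambda>I. z (I, l))"
      by (simp add: tensor_id_apply koszul_eq[OF s])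
    then show ?thesis using koszul_eq[OF contraction_coords[OF s]]
      by (simp add: tensor_id_apply[of "koszul n (Suc i)"] contraction_contraction)
  qed
  then show ?thesis by (simp add: fun_eq_iff)
qed

lemma partial_add: "partial n i (f + g) = partial n i f + partial n i g"
  by (simp add: partial_def linear_extension_add)

lemma partial_smult: "partial n i (\<lambda>x. p * f x) = (\<lambda>y. p * partial n i f y)"
  by (simp add: partial_def linear_extension_smult)

lemma partial_uminus: "partial n i (- f) = - partial n i f"
  using partial_smult[of n i "- 1" f] by (simp add: fun_Compl_def)

lemma partial_diff: "partial n i (f - g) = partial n i f - partial n i g"
  using partial_add[of n i f "- g"] by (simp add: partial_uminus)

lemma partial_0: "partial n i 0 = 0"
  using partial_add[of n i 0 0] by simp

lemma partial_coords:
  assumes "y \<in> coords n (ext_basis n (Suc i))"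
  shows "partial n (Suc i) y \<in> coords n (ext_basis n i \<times> {..<n - 1})"
proof (rule coords_prodI)
  fix J l
  show "partial n (Suc i) y (J, l) \<in> polys {..n}"
    using coordsD(1)[OF assms] by (auto simp: partial_eq[OF assms])
  assume "\<not> (J \<in> ext_basis n i \<and> l \<in> {..<n - 1})"
  then have "l \<notin> J \<Longrightarrow> y (insert l J) = 0"
    using coordsD(2)[OF assms, of "insert l J"] ext_basis_insert[of l J n i] by auto
  then show "partial n (Suc i) y (J, l) = 0" by (auto simp: partial_eq[OF assms])
qed

lemma position_sign_neq_0 [simp]: "position_sign a J \<noteq> (0 :: 'k::field mpol)"
  by (simp add: position_sign_def)

text \<open>
  For \<open>l \<in> I\<close>, the coordinate of \<open>\<partial>y\<close> at \<open>(I - {l}, l)\<close> is up to sign the coordinate of \<open>y\<close> at \<open>I\<close>.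
\<close>

lemma partial_eq_0:
  assumes "y \<in> coords n (ext_basis n (Suc i))" "partial n (Suc i) y = 0"
  shows "y = 0"
proof -
  have "y I = 0" for I
  proof (cases "I \<in> ext_basis n (Suc i)")
    case True
    then obtain l where l: "l \<in> I" by (fastforce simp: ext_basis_def)
    then have "insert l (I - {l}) = I" by auto
    then show ?thesis using fun_cong[OF assms(2), of "(I - {l}, l)"] by (simp add: partial_eq[OF assms(1)])
  qed (use coordsD(2)[OF assms(1)] in auto)
  then show ?thesis by (simp add: fun_eq_iff)
qed

text \<open>
  On both sides two elements of the index set are removed, one into the second tensor factor and one
  contracted against its variable, but in opposite orders; hence the sign.
\<close>

lemma koszul_partial:
  assumes y: "y \<in> coords n (ext_basis n (Suc (Suc i)))"
  shows "tensor_id (koszul n (Suc i)) (partial n (Suc (Suc i)) y) = - partial n (Suc i) (koszul n (Suc (Suc i)) y)"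
proof -
  have "tensor_id (koszul n (Suc i)) (partial n (Suc (Suc i)) y) (J, l) = - partial n (Suc i) (koszul n (Suc (Suc i)) y) (J, l)" for J l
  proof -
    note c = contraction_coords[OF y]
    note p = partial_coords[OF y]
    have 1: "tensor_id (koszul n (Suc i)) (partial n (Suc (Suc i)) y) (J, l) =
      (\<Sum>a\<in>{..<n - 1} - J. position_sign a J * (var a * (if l \<in> insert a J then 0 else position_sign l (insert a J) * y (insert l (insert a J)))))"
      using koszul_eq[OF coords_slice[OF p, of l]] by (simp only: tensor_id_apply contraction_def partial_eq[OF y])
    have 2: "partial n (Suc i) (koszul n (Suc (Suc i)) y) (J, l) =
      (if l \<in> J then 0 else position_sign l J * (\<Sum>a\<in>{..<n - 1} - insert l J. position_sign a (insert l J) * (var a * y (insert a (insert l J)))))"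
      by (simp only: koszul_eq[OF y] partial_eq[OF c] contraction_def)
    show ?thesis
    proof (cases "l \<in> J")
      case True
      then show ?thesis unfolding 1 2 by simp
    next
      case False
      have "(\<Sum>a\<in>{..<n - 1} - J. position_sign a J * (var a * (if l \<in> insert a J then 0 else position_sign l (insert a J) * y (insert l (insert a J))))) =
        (\<Sum>a\<in>{..<n - 1} - insert l J. - (position_sign l J * (position_sign a (insert l J) * (var a * y (insert a (insert l J))))))"
      proof (rule sum.mono_neutral_cong_right)
        fix a assume a: "a \<in> {..<n - 1} - insert l J"
        then have "position_sign a J * position_sign l (insert a J) = - (position_sign l J * position_sign a (insert l J) :: 'a mpol)"
          using False by (intro position_sign_swap) auto
        then have "(position_sign a J * position_sign l (insert a J)) * (var a * y (insert a (insert l J))) =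
          - (position_sign l J * position_sign a (insert l J)) * (var a * y (insert a (insert l J)))" by simp
        then show "position_sign a J * (var a * (if l \<in> insert a J then 0 else position_sign l (insert a J) * y (insert l (insert a J)))) =
          - (position_sign l J * (position_sign a (insert l J) * (var a * y (insert a (insert l J)))))"
          using a False by (simp add: ac_simps insert_commute)
      qed auto
      then show ?thesis unfolding 1 2 using False by (simp add: sum_negf sum_distrib_left)
    qed
  qed
  then show ?thesis by (simp add: fun_eq_iff)
qed

lemma partial_image_eq: "partial_image n i = partial n (Suc i) ` coords n (ext_basis n (Suc i))"
  by (simp add: partial_image_def ext_power_def carrier_free_module)

lemma partial_imageI: "y \<in> coords n (ext_basis n (Suc i)) \<Longrightarrow> partial n (Suc i) y \<in> partial_image n i"
  by (simp add: partial_image_eq)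

text \<open>
  The part of the chase that is common to all degrees: \<open>y\<close> is the boundary of some \<open>y'\<close>, and by
  \<open>koszul_partial\<close> the representative \<open>z + \<partial>y'\<close> of the class of \<open>z\<close> is a cycle already before passing
  to the quotient.
\<close>

lemma D_exact_step:
  assumes z: "z \<in> coords n (ext_basis n (Suc i) \<times> {..<n - 1})"
    and y: "y \<in> coords n (ext_basis n (Suc i))" "koszul n (Suc i) y = 0"
    and zy: "tensor_id (koszul n (Suc i)) z = partial n (Suc i) y"
  shows "\<exists>w\<in>coords n (ext_basis n (Suc (Suc i)) \<times> {..<n - 1}).
    z - tensor_id (koszul n (Suc (Suc i))) w \<in> partial_image n (Suc i)"
proof -
  obtain y' where y': "y' \<in> coords n (ext_basis n (Suc (Suc i)))" "y = koszul n (Suc (Suc i)) y'"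
    using contraction_exact[OF y(1)] y koszul_eq by metis
  have "tensor_id (koszul n (Suc i)) (z + partial n (Suc (Suc i)) y') = 0"
    by (simp only: tensor_koszul_add zy koszul_partial[OF y'(1)] y'(2)) simp
  moreover have "z + partial n (Suc (Suc i)) y' \<in> coords n (ext_basis n (Suc i) \<times> {..<n - 1})"
    using z partial_coords[OF y'(1)] by blast
  ultimately obtain w where w: "w \<in> coords n (ext_basis n (Suc (Suc i)) \<times> {..<n - 1})"
      "z + partial n (Suc (Suc i)) y' = tensor_id (koszul n (Suc (Suc i))) w"
    using tensor_koszul_exact by blast
  have "z - tensor_id (koszul n (Suc (Suc i))) w = partial n (Suc (Suc i)) (- y')"
    unfolding w(2)[symmetric] partial_uminus by simp
  then show ?thesis using w(1) partial_imageI[OF coords_uminus[OF y'(1)]] by metis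
qed

text \<open>
  If the class of \<open>z\<close> is a cycle then \<open>\<delta>z = \<partial>y\<close> for some \<open>y\<close>.  It follows that \<open>\<partial>\<delta>y = - \<delta>\<partial>y = - \<delta>\<delta>z = 0\<close>,
  hence \<open>\<delta>y = 0\<close> as \<open>\<partial>\<close> is injective.
\<close>

lemma D_exact:
  assumes z: "z \<in> coords n (ext_basis n (Suc (Suc i)) \<times> {..<n - 1})"
    and zy: "tensor_id (koszul n (Suc (Suc i))) z \<in> partial_image n (Suc i)"
  shows "\<exists>w\<in>coords n (ext_basis n (Suc (Suc (Suc i))) \<times> {..<n - 1}).
    z - tensor_id (koszul n (Suc (Suc (Suc i)))) w \<in> partial_image n (Suc (Suc i))"
proof -
  obtain y where y: "y \<in> coords n (ext_basis n (Suc (Suc i)))"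
    "tensor_id (koszul n (Suc (Suc i))) z = partial n (Suc (Suc i)) y"
    using zy by (auto simp: partial_image_eq)
  have "0 = tensor_id (koszul n (Suc i)) (tensor_id (koszul n (Suc (Suc i))) z)"
    by (rule tensor_koszul_koszul[OF z, symmetric])
  also have "\<dots> = - partial n (Suc i) (koszul n (Suc (Suc i)) y)"
    unfolding y(2) by (rule koszul_partial[OF y(1)])
  finally have "partial n (Suc i) (koszul n (Suc (Suc i)) y) = 0" by simp
  then have "koszul n (Suc (Suc i)) y = 0"
    by (intro partial_eq_0) (auto simp: koszul_eq[OF y(1)] contraction_coords[OF y(1)])
  then show ?thesis using D_exact_step[OF z y(1) _ y(2)] by blast
qed

text \<open>
  The map \<open>d\<^sub>1\<close> on representatives.
\<close>

definition quadratic_form :: "nat \<Rightarrow> (nat set \<times> nat \<Rightarrow> 'k::field mpol) \<Rightarrow> 'k mpol" where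
  "quadratic_form n z = (\<Sum>i<n - 1. \<Sum>j<n - 1. z ({i}, j) * (var i * var j))"

text \<open>
  With \<open>P\<close> and \<open>\<And>\<^sup>0P \<otimes> P\<close> identified, \<open>\<partial>\<^sub>1\<close> is the identity.  So \<open>\<delta>z = \<partial>y\<close> holds for an element \<open>y\<close> of \<open>P\<close>,
  and \<open>\<delta>y\<close> is the quadratic form of \<open>z\<close>.
\<close>

lemma D_exact_1:
  assumes z: "z \<in> coords n (ext_basis n 1 \<times> {..<n - 1})" and q: "quadratic_form n z = 0"
  shows "\<exists>w\<in>coords n (ext_basis n 2 \<times> {..<n - 1}). z - tensor_id (koszul n 2) w \<in> partial_image n 1"
proof -
  let ?z = "tensor_id (koszul n (Suc 0)) z"
  have z0: "z \<in> coords n (ext_basis n (Suc 0) \<times> {..<n - 1})" using z by simp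
  have zc: "?z \<in> coords n ({{}} \<times> {..<n - 1})" using tensor_koszul_coords[OF z0] by (simp add: ext_basis_0)
  \<comment> \<open>The element of \<open>P\<close> with coordinate \<open>?z ({}, l)\<close> at \<open>e\<^sub>l\<close>, i.e. the preimage of \<open>?z\<close> under \<open>\<partial>\<^sub>1\<close>.\<close>
  define y where "y = (\<lambda>I. if card I = 1 then ?z ({}, the_elem I) else 0)"
  have y1: "y I \<in> polys {..n}" for I
    using coordsD(1)[OF zc] by (simp add: y_def)
  have y2: "y I = 0" if "I \<notin> ext_basis n (Suc 0)" for I
  proof (cases "card I = 1")
    case True
    then obtain x where "I = {x}" by (auto simp: card_1_singleton_iff)
    then show ?thesis using that coordsD(2)[OF zc, of "({}, x)"] by (simp add: y_def ext_basis_def)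
  qed (simp add: y_def)
  have y: "y \<in> coords n (ext_basis n (Suc 0))" using y1 y2 by (auto simp: coords_def)
  have zs: "?z ({}, l) = (\<Sum>i<n - 1. var i * z ({i}, l))" for l
    using koszul_eq[OF coords_slice[OF z0, of l]] by (simp add: tensor_id_apply contraction_def position_sign_def)
  have "koszul n (Suc 0) y J = 0" for J
  proof (cases "J = {}")
    case True
    have "koszul n (Suc 0) y {} = (\<Sum>j<n - 1. \<Sum>i<n - 1. z ({i}, j) * (var i * var j))"
      unfolding koszul_eq[OF y] contraction_def
      by (simp add: position_sign_def y_def zs sum_distrib_left ac_simps)
    also have "\<dots> = quadratic_form n z" unfolding quadratic_form_def by (rule sum.swap)
    finally show ?thesis using True q by simp
  next
    case False
    then show ?thesis using coordsD(2)[OF contraction_coords[OF y], of J] by (simp add: koszul_eq[OF y] ext_basis_0)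
  qed
  then have ky: "koszul n (Suc 0) y = 0" by (simp add: fun_eq_iff)
  have "?z (J, l) = partial n (Suc 0) y (J, l)" for J l
  proof (cases "J = {}")
    case True
    then show ?thesis unfolding partial_eq[OF y] by (simp add: y_def position_sign_def)
  next
    case False
    then have "l \<notin> J \<Longrightarrow> insert l J \<notin> ext_basis n (Suc 0)"
      using ext_basis_insert[of l J n 0] by (simp add: ext_basis_0)
    then show ?thesis using False coordsD(2)[OF zc, of "(J, l)"] y2 by (simp add: partial_eq[OF y])
  qed
  then have "tensor_id (koszul n (Suc 0)) z = partial n (Suc 0) y" by (simp add: fun_eq_iff)
  from D_exact_step[OF z0 y ky this] show ?thesis by (simp add: numeral_2_eq_2)
qed

lemma quadratic_form_partial:
  assumes "y \<in> coords n (ext_basis n 2)"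
  shows "quadratic_form n (partial n 2 y) = 0"
proof -
  let ?g = "\<lambda>i j. (position_sign j {i} * y {i, j}) * (var i * var j)"
  have "quadratic_form n (partial n 2 y) = (\<Sum>i<n - 1. \<Sum>j\<in>{..<n - 1} - {i}. ?g i j)"
    unfolding quadratic_form_def partial_eq[OF assms]
    by (intro sum.cong refl sum.mono_neutral_cong_right) (auto simp: insert_commute)
  also have "\<dots> = 0"
  proof (rule sum_antisymmetric)
    fix a b :: nat assume "a \<noteq> b"
    then have "position_sign b {a} = - (position_sign a {b} :: 'a mpol)"
      using position_sign_swap[of a b "{}", where 'k = 'a] by (simp add: position_sign_def[of _ "{}"])
    then show "?g a b = - ?g b a" by (simp add: insert_commute mult.commute[of "var a"])
  qed simp
  finally show ?thesis .
qed

lemma quadratic_form_koszul: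
  assumes "w \<in> coords n (ext_basis n 2 \<times> {..<n - 1})"
  shows "quadratic_form n (tensor_id (koszul n 2) w) = 0"
proof -
  have w: "w \<in> coords n (ext_basis n (Suc (Suc 0)) \<times> {..<n - 1})" using assms by (simp add: numeral_2_eq_2)
  let ?z = "tensor_id (koszul n 2) w"
  have z: "?z \<in> coords n (ext_basis n (Suc 0) \<times> {..<n - 1})"
    using tensor_koszul_coords[OF w] by (simp add: numeral_2_eq_2)
  have "tensor_id (koszul n (Suc 0)) ?z = 0" using tensor_koszul_koszul[OF w] by (simp add: numeral_2_eq_2)
  then have 0: "tensor_id (koszul n (Suc 0)) ?z ({}, l) = 0" for l by simp
  have "contraction n (\<lambda>I. ?z (I, l)) {} = 0" for l
    using 0[of l] unfolding tensor_id_apply[of "koszul n (Suc 0)"] koszul_eq[OF coords_slice[OF z, of l]] .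
  then have "(\<Sum>i<n - 1. var i * ?z ({i}, l)) = 0" for l
    by (simp add: contraction_def position_sign_def)
  then have "(\<Sum>j<n - 1. var j * (\<Sum>i<n - 1. var i * ?z ({i}, j))) = 0" by simp
  then show ?thesis unfolding quadratic_form_def by (subst sum.swap) (simp add: sum_distrib_left ac_simps)
qed

section \<open>Graded free modules\<close>

lemma free_module_simps [simp]:
  "f \<oplus>\<^bsub>free_module n V w\<^esub> g = f + g"
  "\<zero>\<^bsub>free_module n V w\<^esub> = 0"
  "p \<odot>\<^bsub>free_module n V w\<^esub> f = (\<lambda>x. p * f x)"
  by (simp_all add: free_module_def plus_fun_def zero_fun_def)

lemma gcomp_free_module:
  "gcomp (free_module n V w) d = {f \<in> coords n V. \<forall>x. homog (d - w x) (f x)}"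
proof -
  have "f \<in> gcomp (free_module n V w) d \<longleftrightarrow> f \<in> {f \<in> coords n V. \<forall>x. homog (d - w x) (f x)}" for f :: "'a \<Rightarrow> 'b mpol"
    unfolding free_module_def coords_def RR_comp_def carrier_RR using homog_0 polys_0
    by (simp, metis (no_types, lifting))
  then show ?thesis by blast
qed

lemma homog_position_sign_mult: "homog d f \<Longrightarrow> homog d (position_sign a J * f)"
  unfolding position_sign_def by (rule homog_mult[OF homog_sign]) simp_all

lemma module_free_module: "module (RR n) (free_module n V w)"
proof (rule moduleI[OF cring_RR])
  show "abelian_group (free_module n V w)"
  proof (rule abelian_groupI, unfold carrier_free_module)
    fix x assume "x \<in> coords n V"
    then show "\<exists>y\<in>coords n V. y \<oplus>\<^bsub>free_module n V w\<^esub> x = \<zero>\<^bsub>free_module n V w\<^esub>"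
      by (intro bexI[of _ "- x"]) (simp_all add: coords_uminus)
  qed (simp_all add: coords_add ac_simps)
qed (auto simp: carrier_free_module coords_smult algebra_simps fun_eq_iff)

lemma direct_sum_simps [simp]:
  "(x, y) \<oplus>\<^bsub>direct_sum M N\<^esub> (x', y') = (x \<oplus>\<^bsub>M\<^esub> x', y \<oplus>\<^bsub>N\<^esub> y')"
  "\<zero>\<^bsub>direct_sum M N\<^esub> = (\<zero>\<^bsub>M\<^esub>, \<zero>\<^bsub>N\<^esub>)"
  "a \<odot>\<^bsub>direct_sum M N\<^esub> (x, y) = (a \<odot>\<^bsub>M\<^esub> x, a \<odot>\<^bsub>N\<^esub> y)"
  "carrier (direct_sum M N) = carrier M \<times> carrier N"
  "gcomp (direct_sum M N) d = gcomp M d \<times> gcomp N d"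
  by (simp_all add: direct_sum_def)

lemma module_direct_sum:
  assumes "module R M" "module R N"
  shows "module R (direct_sum M N)"
proof -
  interpret M: module R M by fact
  interpret N: module R N by fact
  show ?thesis
  proof (rule moduleI[OF M.is_cring])
    show "abelian_group (direct_sum M N)"
    proof (rule abelian_groupI)
      fix x assume "x \<in> carrier (direct_sum M N)"
      then obtain y z where "x = (y, z)" "y \<in> carrier M" "z \<in> carrier N" by auto
      then show "\<exists>y\<in>carrier (direct_sum M N). y \<oplus>\<^bsub>direct_sum M N\<^esub> x = \<zero>\<^bsub>direct_sum M N\<^esub>"
        by (intro bexI[of _ "(\<ominus>\<^bsub>M\<^esub> y, \<ominus>\<^bsub>N\<^esub> z)"]) (auto simp: M.l_neg N.l_neg)
    qed (auto simp: M.a_ac N.a_ac)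
  qed (auto simp: M.smult_l_distr N.smult_l_distr M.smult_r_distr N.smult_r_distr M.smult_assoc1 N.smult_assoc1)
qed

text \<open>
  The quotient modules inherit the module axioms from the free modules that cover them.
\<close>

lemma module_surjective_image:
  assumes "module R M" and lin: "linear_map R M N f" and surj: "f ` carrier M = carrier N"
    and zero: "f \<zero>\<^bsub>M\<^esub> = \<zero>\<^bsub>N\<^esub>"
  shows "module R N"
proof -
  interpret M: module R M by fact
  have add: "f x \<oplus>\<^bsub>N\<^esub> f y = f (x \<oplus>\<^bsub>M\<^esub> y)" if "x \<in> carrier M" "y \<in> carrier M" for x y
    using lin that by (simp add: linear_map_def)
  have smult: "a \<odot>\<^bsub>N\<^esub> f x = f (a \<odot>\<^bsub>M\<^esub> x)" if "a \<in> carrier R" "x \<in> carrier M" for a x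
    using lin that by (simp add: linear_map_def)
  show ?thesis
  proof (rule moduleI[OF M.is_cring], unfold surj[symmetric])
    show "abelian_group N"
    proof (rule abelian_groupI, unfold surj[symmetric])
      fix x assume "x \<in> f ` carrier M"
      then obtain y where y: "y \<in> carrier M" "x = f y" by blast
      then have "f (\<ominus>\<^bsub>M\<^esub> y) \<oplus>\<^bsub>N\<^esub> x = \<zero>\<^bsub>N\<^esub>" by (simp add: add M.l_neg zero)
      then show "\<exists>y\<in>f ` carrier M. y \<oplus>\<^bsub>N\<^esub> x = \<zero>\<^bsub>N\<^esub>" using y M.a_inv_closed by blast
    qed (auto simp: add zero[symmetric] M.a_ac)
  qed (auto simp: add smult M.smult_l_distr M.smult_r_distr M.smult_assoc1)
qed

lemma graded_iso_comp:
  assumes "graded_iso n M N f" "graded_iso n N L g"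
  shows "graded_iso n M L (g \<circ> f)"
proof -
  have "linear_map (RR n) M L (g \<circ> f)" using assms unfolding graded_iso_def linear_map_def
    by (auto simp: Pi_iff)
  moreover have "bij_betw (g \<circ> f) (carrier M) (carrier L)"
    using assms by (auto simp: graded_iso_def intro: bij_betw_trans)
  moreover have "(g \<circ> f) ` gcomp M d = gcomp L d" for d
    using assms unfolding graded_iso_def image_comp[symmetric] by simp
  ultimately show ?thesis by (simp add: graded_iso_def)
qed

lemma graded_iso_reindex:
  assumes h: "bij_betw h V W"
  shows "graded_iso n (free_module n V (w \<circ> h)) (free_module n W w)
    (\<lambda>f x. if x \<in> W then f (inv_into V h x) else 0)" (is "graded_iso n ?M ?N ?f")
proof -
  let ?g = "\<lambda>f x. if x \<in> V then f (h x) else 0"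
  have inj: "inj_on h V" and im: "h ` V = W" using h by (auto simp: bij_betw_def)
  have 1: "?f f \<in> coords n W" "?g (?f f) = f" if "f \<in> coords n V" for f :: "'a \<Rightarrow> 'c mpol"
    using that im inj by (auto simp: coords_def fun_eq_iff inv_into_f_f)
  have 2: "?g f \<in> coords n V" "?f (?g f) = f" if "f \<in> coords n W" for f :: "'b \<Rightarrow> 'c mpol"
    using that im by (auto simp: coords_def fun_eq_iff inv_into_into f_inv_into_f)
  have lin: "linear_map (RR n) ?M ?N ?f"
    unfolding linear_map_def by (auto simp: carrier_free_module 1 fun_eq_iff)
  have bij: "bij_betw ?f (carrier ?M) (carrier ?N)" unfolding carrier_free_module
    by (rule bij_betw_byWitness[where f' = ?g]) (use 1 2 in auto)
  have "bij_betw ?f (gcomp ?M d) (gcomp ?N d)" for d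
    by (rule bij_betw_byWitness[where f' = ?g])
      (use 1 2 im in \<open>auto simp: gcomp_free_module f_inv_into_f inv_into_f_f[OF inj] split: if_splits\<close>)
  then have "?f ` gcomp ?M d = gcomp ?N d" for d by (rule bij_betw_imp_surj_on)
  then show ?thesis using lin bij by (simp add: graded_iso_def)
qed

lemma graded_freeI:
  assumes "finite V" "module (RR n) M" "graded_iso n (free_module n V w) M \<phi>"
  shows "graded_free n M"
proof -
  obtain h where h: "bij_betw h {..<card V} V"
    using ex_bij_betw_nat_finite[OF assms(1)] by (auto simp: atLeast0LessThan)
  show ?thesis unfolding graded_free_def
    using assms(2) graded_iso_comp[OF graded_iso_reindex[OF h] assms(3)] by blast
qed

section \<open>The modules of the resolution\<close>

text \<open>
  Coordinate functions of the elements of \<open>\<And>\<^sup>iP \<otimes> P\<close> and of \<open>\<And>\<^sup>iP \<otimes> Q\<close>.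
\<close>

abbreviation TP :: "nat \<Rightarrow> nat \<Rightarrow> (nat set \<times> nat \<Rightarrow> 'k::field mpol) set" where
  "TP n i \<equiv> coords n (ext_basis n i \<times> {..<n - 1})"

abbreviation TQ :: "nat \<Rightarrow> nat \<Rightarrow> nat \<Rightarrow> (nat set \<times> nat \<Rightarrow> 'k::field mpol) set" where
  "TQ n k i \<equiv> coords n (ext_basis n i \<times> {..<k})"

lemma ext_tensor_P_simps [simp]:
  "carrier (ext_tensor_P n i) = TP n i"
  "f \<oplus>\<^bsub>ext_tensor_P n i\<^esub> g = f + g"
  "\<zero>\<^bsub>ext_tensor_P n i\<^esub> = 0"
  "p \<odot>\<^bsub>ext_tensor_P n i\<^esub> f = (\<lambda>x. p * f x)"
  by (simp_all add: ext_tensor_P_def carrier_free_module)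

lemma ext_tensor_Q_simps [simp]:
  "carrier (ext_tensor_Q n k \<beta> i) = TQ n k i"
  "f \<oplus>\<^bsub>ext_tensor_Q n k \<beta> i\<^esub> g = f + g"
  "\<zero>\<^bsub>ext_tensor_Q n k \<beta> i\<^esub> = 0"
  "p \<odot>\<^bsub>ext_tensor_Q n k \<beta> i\<^esub> f = (\<lambda>x. p * f x)"
  by (simp_all add: ext_tensor_Q_def carrier_free_module)

lemma partial_image_0 [simp]: "0 \<in> partial_image n i"
  unfolding partial_image_eq by (rule image_eqI[of _ _ 0]) (simp_all add: partial_0)

lemma partial_image_add: "p \<in> partial_image n i \<Longrightarrow> q \<in> partial_image n i \<Longrightarrow> p + q \<in> partial_image n i"
  unfolding partial_image_eq by (auto simp: partial_add[symmetric] intro!: imageI simp del: plus_fun_apply)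

lemma partial_image_diff: "p \<in> partial_image n i \<Longrightarrow> q \<in> partial_image n i \<Longrightarrow> p - q \<in> partial_image n i"
  unfolding partial_image_eq by (auto simp: partial_diff[symmetric] intro!: imageI simp del: minus_apply)

lemma partial_image_smult: "a \<in> polys {..n} \<Longrightarrow> p \<in> partial_image n i \<Longrightarrow> (\<lambda>x. a * p x) \<in> partial_image n i"
  unfolding partial_image_eq by (auto simp: partial_smult[symmetric] coords_smult intro!: imageI)

lemma D_proj_eq: "D_proj n i z = (\<lambda>p. p + z) ` partial_image n i"
  unfolding D_proj_def a_r_coset_def' by auto

lemma D_proj_eq_iff:
  fixes z z' :: "nat set \<times> nat \<Rightarrow> 'k::field mpol"
  shows "D_proj n i z = D_proj n i z' \<longleftrightarrow> z - z' \<in> partial_image n i"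
proof
  assume "D_proj n i z = D_proj n i z'"
  then have "z \<in> D_proj n i z'" using partial_image_0 unfolding D_proj_eq by force
  then show "z - z' \<in> partial_image n i" unfolding D_proj_eq by (auto simp del: plus_fun_apply minus_apply)
next
  assume d: "z - z' \<in> partial_image n i"
  show "D_proj n i z = D_proj n i z'" unfolding D_proj_eq
  proof safe
    fix p :: "nat set \<times> nat \<Rightarrow> 'k mpol"
    assume p: "p \<in> partial_image n i"
    have "p + z = (p + (z - z')) + z'" by simp
    then show "p + z \<in> (\<lambda>p. p + z') ` partial_image n i" using partial_image_add[OF p d] by blast
  next
    fix p :: "nat set \<times> nat \<Rightarrow> 'k mpol"
    assume p: "p \<in> partial_image n i"
    have "p + z' = (p - (z - z')) + z" by simp
    then show "p + z' \<in> (\<lambda>p. p + z) ` partial_image n i" using partial_image_diff[OF p d] by blast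
  qed
qed

lemma D_proj_self: "z \<in> D_proj n i z"
  unfolding D_proj_eq by (rule image_eqI[of _ _ 0]) simp_all

lemma D_proj_memD: "z' \<in> D_proj n i z \<Longrightarrow> D_proj n i z' = D_proj n i z"
  unfolding D_proj_eq_iff unfolding D_proj_eq by (auto simp del: plus_fun_apply minus_apply)

lemma D_carrier: "carrier (D_module n i) = D_proj n i ` TP n i"
  by (auto simp: D_module_def quotient_module_def A_RCOSETS_def' D_proj_def)

lemma D_zero: "\<zero>\<^bsub>D_module n i\<^esub> = D_proj n i 0"
  by (simp add: D_module_def quotient_module_def D_proj_eq)

lemma D_add: "D_proj n i z \<oplus>\<^bsub>D_module n i\<^esub> D_proj n i z' = D_proj n i (z + z')"
proof -
  have "D_proj n i z \<oplus>\<^bsub>D_module n i\<^esub> D_proj n i z' = {x + y | x y. x \<in> D_proj n i z \<and> y \<in> D_proj n i z'}"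
    unfolding D_module_def quotient_module_def by (auto simp: set_add_def')
  also have "\<dots> = D_proj n i (z + z')"
  proof safe
    fix x y assume "x \<in> D_proj n i z" "y \<in> D_proj n i z'"
    then obtain p q where pq: "x = p + z" "y = q + z'" "p \<in> partial_image n i" "q \<in> partial_image n i"
      by (auto simp: D_proj_eq simp del: plus_fun_apply)
    have "x + y = (p + q) + (z + z')" unfolding pq by (simp only: ac_simps)
    then show "x + y \<in> D_proj n i (z + z')"
      unfolding D_proj_eq using partial_image_add[OF pq(3,4)] by blast
  next
    fix x assume "x \<in> D_proj n i (z + z')"
    then obtain p where p: "x = p + (z + z')" "p \<in> partial_image n i"
      by (auto simp: D_proj_eq simp del: plus_fun_apply)
    have "x = (p + z) + z'" unfolding p(1) by (simp only: ac_simps)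
    moreover have "p + z \<in> D_proj n i z" unfolding D_proj_eq using p(2) by (rule imageI)
    ultimately show "\<exists>u v. x = u + v \<and> u \<in> D_proj n i z \<and> v \<in> D_proj n i z'" using D_proj_self by blast
  qed
  finally show ?thesis .
qed

lemma D_smult:
  assumes "a \<in> polys {..n}"
  shows "a \<odot>\<^bsub>D_module n i\<^esub> D_proj n i z = D_proj n i (\<lambda>x. a * z x)"
proof -
  have "a \<odot>\<^bsub>D_module n i\<^esub> D_proj n i z = (\<Union>z'\<in>D_proj n i z. D_proj n i (\<lambda>x. a * z' x))"
    by (simp add: D_module_def quotient_module_def D_proj_def)
  also have "\<dots> = (\<Union>z'\<in>D_proj n i z. D_proj n i (\<lambda>x. a * z x))"
  proof (rule SUP_cong)
    fix z' assume "z' \<in> D_proj n i z"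
    then have "z' - z \<in> partial_image n i" using D_proj_memD D_proj_eq_iff by blast
    from partial_image_smult[OF assms this]
    have "(\<lambda>x. a * z' x) - (\<lambda>x. a * z x) \<in> partial_image n i" by (simp add: fun_diff_def algebra_simps)
    then show "D_proj n i (\<lambda>x. a * z' x) = D_proj n i (\<lambda>x. a * z x)" by (simp add: D_proj_eq_iff)
  qed simp
  also have "\<dots> = D_proj n i (\<lambda>x. a * z x)" using D_proj_self by blast
  finally show ?thesis .
qed

lemma D_gcomp: "gcomp (D_module n i) d = D_proj n i ` gcomp (ext_tensor_P n i) d"
  by (simp add: D_module_def quotient_module_def D_proj_def)

text \<open>
  The module \<open>G\<^sub>i\<close> before \<open>\<And>\<^sup>iP \<otimes> P\<close> is divided by the image of \<open>\<partial>\<close>.  The surjection \<open>cover\<close> sends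
  representatives to the elements of \<open>G\<^sub>i\<close>.
\<close>

definition cover_module where
  "cover_module n k \<beta> i = direct_sum (ext_tensor_P n i) (ext_tensor_Q n k \<beta> (i - 1))"

definition cover :: "nat \<Rightarrow> nat \<Rightarrow> (nat set \<times> nat \<Rightarrow> 'k::field mpol) \<times> (nat set \<times> nat \<Rightarrow> 'k mpol) \<Rightarrow>
   (nat set \<times> nat \<Rightarrow> 'k mpol) set \<times> (nat set \<times> nat \<Rightarrow> 'k mpol)" where
  "cover n i = (\<lambda>(z, y). (D_proj n i z, y))"

lemma cover_apply [simp]: "cover n i (z, y) = (D_proj n i z, y)"
  by (simp add: cover_def)

lemma cover_module_simps [simp]:
  "carrier (cover_module n k \<beta> i) = TP n i \<times> TQ n k (i - 1)"
  "(x, y) \<oplus>\<^bsub>cover_module n k \<beta> i\<^esub> (x', y') = (x + x', y + y')"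
  "\<zero>\<^bsub>cover_module n k \<beta> i\<^esub> = (0, 0)"
  "a \<odot>\<^bsub>cover_module n k \<beta> i\<^esub> (x, y) = (\<lambda>s. a * x s, \<lambda>s. a * y s)"
  by (simp_all add: cover_module_def)

lemma cover_carrier: "cover n i ` (TP n i \<times> TQ n k (i - 1)) = carrier (G_module n k \<beta> i)"
  by (force simp: G_module_def D_carrier)

lemma cover_gcomp: "cover n i ` gcomp (cover_module n k \<beta> i) d = gcomp (G_module n k \<beta> i) d"
  by (force simp: G_module_def cover_module_def D_gcomp)

lemma cover_add: "cover n i (x + x', y + y') = cover n i (x, y) \<oplus>\<^bsub>G_module n k \<beta> i\<^esub> cover n i (x', y')"
  by (simp add: G_module_def D_add)

lemma cover_smult:
  "a \<in> polys {..n} \<Longrightarrow> cover n i (\<lambda>s. a * x s, \<lambda>s. a * y s) = a \<odot>\<^bsub>G_module n k \<beta> i\<^esub> cover n i (x, y)"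
  by (simp add: G_module_def D_smult)

lemma cover_zero: "cover n i (0, 0) = \<zero>\<^bsub>G_module n k \<beta> i\<^esub>"
  by (simp add: G_module_def D_zero)

lemma linear_map_cover:
  "linear_map (RR n) (cover_module n k \<beta> i) (G_module n k \<beta> i :: ('k::field mpol, _) graded_module) (cover n i)"
  unfolding linear_map_def
proof (intro conjI ballI)
  show "cover n i \<in> carrier (cover_module n k \<beta> i) \<rightarrow> carrier (G_module n k \<beta> i)"
    using cover_carrier by (fastforce simp del: cover_apply)
next
  fix x y :: "(nat set \<times> nat \<Rightarrow> 'k mpol) \<times> (nat set \<times> nat \<Rightarrow> 'k mpol)"
  show "cover n i (x \<oplus>\<^bsub>cover_module n k \<beta> i\<^esub> y) = cover n i x \<oplus>\<^bsub>G_module n k \<beta> i\<^esub> cover n i y"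
    by (cases x, cases y) (simp only: cover_module_simps cover_add)
next
  fix a :: "'k mpol" and x :: "(nat set \<times> nat \<Rightarrow> 'k mpol) \<times> (nat set \<times> nat \<Rightarrow> 'k mpol)"
  assume "a \<in> carrier (RR n)"
  then show "cover n i (a \<odot>\<^bsub>cover_module n k \<beta> i\<^esub> x) = a \<odot>\<^bsub>G_module n k \<beta> i\<^esub> cover n i x"
    by (cases x) (simp only: cover_module_simps cover_smult carrier_RR)
qed

lemma module_G: "module (RR n) (G_module n k \<beta> i :: ('k::field mpol, _) graded_module)"
proof (rule module_surjective_image)
  show "module (RR n) (cover_module n k \<beta> i :: ('k::field mpol, _) graded_module)"
    unfolding cover_module_def ext_tensor_P_def ext_tensor_Q_def
    by (intro module_direct_sum module_free_module)
  show "linear_map (RR n) (cover_module n k \<beta> i) (G_module n k \<beta> i :: ('k::field mpol, _) graded_module) (cover n i)"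
    by (rule linear_map_cover)
qed (simp_all only: cover_module_simps cover_carrier cover_zero)

text \<open>
  Homomorphisms on \<open>G\<^sub>i\<close> can be verified on representatives, since every element, and every homogeneous
  element, has one (in the same degree).
\<close>

lemma graded_hom_from_GI:
  assumes closed: "\<And>z y. z \<in> TP n i \<Longrightarrow> y \<in> TQ n k (i - 1) \<Longrightarrow> f (cover n i (z, y)) \<in> carrier M"
    and smult: "\<And>a z y. a \<in> polys {..n} \<Longrightarrow> z \<in> TP n i \<Longrightarrow> y \<in> TQ n k (i - 1) \<Longrightarrow>
      f (cover n i (\<lambda>x. a * z x, \<lambda>x. a * y x)) = a \<odot>\<^bsub>M\<^esub> f (cover n i (z, y))"
    and add: "\<And>z y z' y'. z \<in> TP n i \<Longrightarrow> y \<in> TQ n k (i - 1) \<Longrightarrow> z' \<in> TP n i \<Longrightarrow> y' \<in> TQ n k (i - 1) \<Longrightarrow>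
      f (cover n i (z + z', y + y')) = f (cover n i (z, y)) \<oplus>\<^bsub>M\<^esub> f (cover n i (z', y'))"
    and graded: "\<And>d z y. z \<in> gcomp (ext_tensor_P n i) d \<Longrightarrow> y \<in> gcomp (ext_tensor_Q n k \<beta> (i - 1)) d \<Longrightarrow>
      f (cover n i (z, y)) \<in> gcomp M d"
  shows "graded_hom n (G_module n k \<beta> i) M f"
proof -
  let ?G = "G_module n k \<beta> i"
  note c = cover_carrier[of n i k \<beta>, symmetric]
  have ex: "\<exists>z y. x = cover n i (z, y) \<and> z \<in> TP n i \<and> y \<in> TQ n k (i - 1)" if "x \<in> carrier ?G" for x
    using that unfolding c by blast
  have "f (x \<oplus>\<^bsub>?G\<^esub> x') = f x \<oplus>\<^bsub>M\<^esub> f x'" if "x \<in> carrier ?G" "x' \<in> carrier ?G" for x x'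
    using ex[OF that(1)] ex[OF that(2)] add cover_add[where k = k and \<beta> = \<beta>] by metis
  moreover have "f (a \<odot>\<^bsub>?G\<^esub> x) = a \<odot>\<^bsub>M\<^esub> f x" if "a \<in> carrier (RR n)" "x \<in> carrier ?G" for a x
    using ex[OF that(2)] that(1) smult cover_smult[where k = k and \<beta> = \<beta>] unfolding carrier_RR by metis
  moreover have "f x \<in> carrier M" if "x \<in> carrier ?G" for x
    using ex[OF that] closed by metis
  moreover have "f ` gcomp ?G d \<subseteq> gcomp M d" for d
    unfolding cover_gcomp[symmetric] cover_module_def direct_sum_simps using graded by blast
  ultimately show ?thesis unfolding graded_hom_def linear_map_def by blast
qed

lemma gcomp_ext_tensor_P: "gcomp (ext_tensor_P n i) d =
    {z \<in> TP n i. \<forall>J l. homog (d - (int (card J) + 1)) (z (J, l))}"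
  unfolding ext_tensor_P_def gcomp_free_module by auto

lemma gcomp_ext_tensor_Q: "gcomp (ext_tensor_Q n k \<beta> i) d =
    {z \<in> TQ n k i. \<forall>J j. homog (d - (int (card J) + int (\<beta> j) + 1)) (z (J, j))}"
  unfolding ext_tensor_Q_def gcomp_free_module by auto

section \<open>A basis of \<open>D\<^sub>i\<close>\<close>

text \<open>
  The image of \<open>e\<^sub>I\<close> under \<open>\<partial>\<close> has the coordinate \<open>\<plusminus>1\<close> at \<open>(I - {Max I}, Max I)\<close>.  Modulo \<open>\<partial>\<close> all basis
  elements of this kind, i.e. the pairs \<open>(J, a)\<close> with \<open>a\<close> greater than every element of \<open>J\<close>, can
  therefore be eliminated; what remains is a basis.
\<close>

definition D_basis :: "nat \<Rightarrow> nat \<Rightarrow> (nat set \<times> nat) set" where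
  "D_basis n i = {(J, a) \<in> ext_basis n i \<times> {..<n - 1}. \<exists>b\<in>J. a \<le> b}"

lemma finite_D_basis [simp]: "finite (D_basis n i)"
  unfolding D_basis_def by (rule finite_subset[of _ "ext_basis n i \<times> {..<n - 1}"]) auto

lemma D_basis_independent:
  assumes v: "v \<in> coords n (D_basis n i)" "v \<in> partial_image n i"
  shows "v = 0"
proof -
  obtain y where y: "y \<in> coords n (ext_basis n (Suc i))" "v = partial n (Suc i) y"
    using v(2) by (auto simp: partial_image_eq)
  have "y I = 0" for I
  proof (cases "I \<in> ext_basis n (Suc i)")
    case True
    let ?m = "Max I"
    have I: "finite I" "I \<noteq> {}" using True ext_basis_finite[OF True] by (auto simp: ext_basis_def)
    \<comment> \<open>The coordinate at \<open>(I - {?m}, ?m)\<close> is one of those that are not in the basis.\<close>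
    have "\<not> (\<exists>b\<in>I - {?m}. ?m \<le> b)" by (metis DiffE I(1) Max_ge antisym singletonI)
    then have "v (I - {?m}, ?m) = 0" using coordsD(2)[OF v(1), of "(I - {?m}, ?m)"] by (auto simp: D_basis_def)
    moreover have "insert ?m (I - {?m}) = I" using I by (auto simp: insert_absorb)
    ultimately show ?thesis by (simp add: y(2) partial_eq[OF y(1)])
  qed (use coordsD(2)[OF y(1)] in auto)
  then have "y = 0" by (simp add: fun_eq_iff)
  then show ?thesis by (simp only: y(2) partial_0)
qed

text \<open>
  Subtracting \<open>\<partial>y\<close> clears the coordinates to be eliminated if \<open>y\<close> is read off from these coordinates.
  The degree is preserved because \<open>\<partial>\<close> is homogeneous.
\<close>

lemma D_basis_generates:
  assumes z: "z \<in> TP n i"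
  shows "\<exists>v\<in>coords n (D_basis n i). z - v \<in> partial_image n i \<and>
    (\<forall>d. z \<in> gcomp (ext_tensor_P n i) d \<longrightarrow> v \<in> gcomp (ext_tensor_P n i) d)"
proof -
  define y where "y = (\<lambda>I. if I \<in> ext_basis n (Suc i) then position_sign (Max I) (I - {Max I}) * z (I - {Max I}, Max I) else 0)"
  have y: "y \<in> coords n (ext_basis n (Suc i))"
    using coordsD(1)[OF z] by (auto simp: y_def coords_def)
  let ?v = "z - partial n (Suc i) y"
  have vz: "?v \<in> TP n i" using z partial_coords[OF y] by (rule coords_diff)
  have "?v (J, a) = 0" if J: "(J, a) \<notin> D_basis n i" for J a
  proof (cases "(J, a) \<in> ext_basis n i \<times> {..<n - 1}")
    case True
    then have le: "\<And>b. b \<in> J \<Longrightarrow> b < a" using J by (auto simp: D_basis_def not_le)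
    then have a: "a \<notin> J" by blast
    have "finite J" using True ext_basis_finite by auto
    then have "Max (insert a J) = a" using le by (intro Max_eqI) (auto intro: less_imp_le)
    moreover have "insert a J \<in> ext_basis n (Suc i)" using True ext_basis_insert[OF a] by simp
    moreover have "insert a J - {a} = J" using a by auto
    ultimately have "y (insert a J) = position_sign a J * z (J, a)" by (simp add: y_def)
    then show ?thesis using a by (simp add: fun_diff_def partial_eq[OF y])
  qed (use coordsD(2)[OF vz] in blast)
  then have "?v \<in> coords n (D_basis n i)" using coordsD(1)[OF vz] by (auto simp: coords_def)
  moreover have "z - ?v \<in> partial_image n i" using partial_imageI[OF y] by simp
  moreover have "?v \<in> gcomp (ext_tensor_P n i) d" if zd: "z \<in> gcomp (ext_tensor_P n i) d" for d
  proof -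
    have hz: "homog (d - (int (card J) + 1)) (z (J, l))" for J l
      using zd by (simp add: gcomp_ext_tensor_P)
    have "homog (d - int (card I)) (y I)" for I
    proof (cases "I \<in> ext_basis n (Suc i)")
      case True
      then have "finite I" "I \<noteq> {}" using ext_basis_finite[OF True] by (auto simp: ext_basis_def)
      then have "int (card (I - {Max I})) + 1 = int (card I)"
        using card_Suc_Diff1[of I "Max I"] Max_in[of I] by linarith
      then show ?thesis using hz[of "I - {Max I}" "Max I"] True
        by (auto simp: y_def homog_position_sign_mult)
    qed (simp add: y_def)
    then have hy: "homog (d - (int (card J) + 1)) (y (insert l J))" if "l \<notin> J" "finite J" for l J
      using that by (metis card_insert_disjoint of_nat_Suc add.commute)
    have "homog (d - (int (card J) + 1)) (?v (J, l))" for J l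
    proof (cases "J \<in> ext_basis n i")
      case True
      then have J: "finite J" by (rule ext_basis_finite)
      have "homog (d - (int (card J) + 1)) (partial n (Suc i) y (J, l))"
        using hy[OF _ J] by (auto simp: partial_eq[OF y] homog_position_sign_mult)
      then have "homog (d - (int (card J) + 1)) (z (J, l) + - partial n (Suc i) y (J, l))"
        using hz by (intro homog_add homog_uminus)
      then show ?thesis by (simp add: fun_diff_def)
    next
      case False
      then show ?thesis using coordsD(2)[OF vz, of "(J, l)"] by simp
    qed
    then show ?thesis using vz by (simp add: gcomp_ext_tensor_P)
  qed
  ultimately show ?thesis by blast
qed

lemma coords_D_basis: "coords n (D_basis n i) \<subseteq> TP n i"
  unfolding D_basis_def by (auto simp: coords_def)

lemma graded_free_G: "graded_free n (G_module n k \<beta> i :: ('k::field mpol, _) graded_module)"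
proof (rule graded_freeI)
  let ?W = "ext_basis n (i - 1) \<times> {..<k}"
  let ?V = "D_basis n i <+> ?W"
  let ?w = "case_sum (\<lambda>(J, l). int (card J) + 1) (\<lambda>(J, j). int (card J) + int (\<beta> j) + 1)"
  let ?F = "free_module n ?V ?w :: ('k mpol, _) graded_module"
  let ?G = "G_module n k \<beta> i :: ('k mpol, _) graded_module"
  let ?s = "\<lambda>f :: nat set \<times> nat + nat set \<times> nat \<Rightarrow> 'k mpol. (\<lambda>x. f (Inl x), \<lambda>x. f (Inr x))"
  let ?f = "\<lambda>f. cover n i (?s f)"
  show "finite ?V" by simp
  show "module (RR n) ?G" by (rule module_G)
  have s: "fst (?s f) \<in> coords n (D_basis n i)" "snd (?s f) \<in> TQ n k (i - 1)" if "f \<in> coords n ?V" for f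
    using that by (auto simp: coords_def)
  have s': "?s f \<in> TP n i \<times> TQ n k (i - 1)" if "f \<in> coords n ?V" for f
    using s[OF that] coords_D_basis[of n i] by auto
  have lin: "linear_map (RR n) ?F ?G ?f"
    unfolding linear_map_def carrier_free_module
  proof (intro conjI ballI)
    show "?f \<in> coords n ?V \<rightarrow> carrier ?G"
      using s' cover_carrier[of n i k \<beta>] by blast
    show "?f (f \<oplus>\<^bsub>?F\<^esub> g) = ?f f \<oplus>\<^bsub>?G\<^esub> ?f g" for f g
      unfolding cover_add[symmetric] by (simp add: plus_fun_def)
    show "?f (a \<odot>\<^bsub>?F\<^esub> f) = a \<odot>\<^bsub>?G\<^esub> ?f f" if "a \<in> carrier (RR n)" for a f
      using that cover_smult[of a n i] by simp
  qed
  have inj: "inj_on ?f (carrier ?F)"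
  proof (rule inj_onI)
    fix f g assume "f \<in> carrier ?F" "g \<in> carrier ?F" and e: "?f f = ?f g"
    then have f: "f \<in> coords n ?V" and g: "g \<in> coords n ?V" by (simp_all add: carrier_free_module)
    have "(\<lambda>x. f (Inl x)) - (\<lambda>x. g (Inl x)) \<in> partial_image n i"
      using e by (simp add: D_proj_eq_iff)
    moreover have "(\<lambda>x. f (Inl x)) - (\<lambda>x. g (Inl x)) \<in> coords n (D_basis n i)"
      using s(1)[OF f] s(1)[OF g] by (auto simp: coords_def)
    ultimately have 0: "(\<lambda>x. f (Inl x)) - (\<lambda>x. g (Inl x)) = 0" by (intro D_basis_independent)
    have "f (Inl x) = g (Inl x)" for x using fun_cong[OF 0, of x] by simp
    moreover have "f (Inr x) = g (Inr x)" for x using e by (simp, metis)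
    ultimately show "f = g" by (metis (no_types) ext sum.exhaust)
  qed
  have surj: "\<exists>f\<in>coords n ?V. ?f f = cover n i (z, y) \<and> (\<forall>d. z \<in> gcomp (ext_tensor_P n i) d \<longrightarrow>
      y \<in> gcomp (ext_tensor_Q n k \<beta> (i - 1)) d \<longrightarrow> f \<in> gcomp ?F d)"
    if zy: "z \<in> TP n i" "y \<in> TQ n k (i - 1)" for z y
  proof -
    obtain v where v: "v \<in> coords n (D_basis n i)" "z - v \<in> partial_image n i"
      "\<And>d. z \<in> gcomp (ext_tensor_P n i) d \<Longrightarrow> v \<in> gcomp (ext_tensor_P n i) d"
      using D_basis_generates[OF zy(1)] by blast
    let ?g = "case_sum v y"
    have g: "?g \<in> coords n ?V" using v(1) zy(2) by (auto simp: coords_def split: sum.splits)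
    have "D_proj n i v = D_proj n i z" using v(2) D_proj_eq_iff by metis
    then have "?f ?g = cover n i (z, y)" by simp
    moreover have "?g \<in> gcomp ?F d" if d: "z \<in> gcomp (ext_tensor_P n i) d" "y \<in> gcomp (ext_tensor_Q n k \<beta> (i - 1)) d" for d
      using v(3)[OF d(1)] d(2) g unfolding gcomp_ext_tensor_P gcomp_ext_tensor_Q gcomp_free_module
      by (auto split: sum.splits)
    ultimately show ?thesis using g by blast
  qed
  have "?f ` carrier ?F = carrier ?G"
  proof
    show "?f ` carrier ?F \<subseteq> carrier ?G" using lin by (auto simp: linear_map_def)
    show "carrier ?G \<subseteq> ?f ` carrier ?F"
    proof
      fix x assume "x \<in> carrier ?G"
      then obtain z y where zy: "x = cover n i (z, y)" "z \<in> TP n i" "y \<in> TQ n k (i - 1)"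
        unfolding cover_carrier[symmetric] by blast
      from surj[OF zy(2,3)] obtain f where "f \<in> coords n ?V" "?f f = x" unfolding zy(1) by blast
      then show "x \<in> ?f ` carrier ?F" unfolding carrier_free_module by blast
    qed
  qed
  then have bij: "bij_betw ?f (carrier ?F) (carrier ?G)" using inj by (simp add: bij_betw_def)
  have "?f ` gcomp ?F d = gcomp ?G d" for d
  proof
    have "?s f \<in> gcomp (cover_module n k \<beta> i) d" if "f \<in> gcomp ?F d" for f
    proof -
      have f: "f \<in> coords n ?V" "\<And>x. homog (d - ?w x) (f x)" using that by (auto simp: gcomp_free_module)
      then show ?thesis using s'[OF f(1)] f(2)[of "Inl _"] f(2)[of "Inr _"]
        by (auto simp: cover_module_def gcomp_ext_tensor_P gcomp_ext_tensor_Q)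
    qed
    then show "?f ` gcomp ?F d \<subseteq> gcomp ?G d" unfolding cover_gcomp[symmetric] by blast
    show "gcomp ?G d \<subseteq> ?f ` gcomp ?F d"
    proof
      fix x assume "x \<in> gcomp ?G d"
      then obtain z y where zy: "x = cover n i (z, y)" "z \<in> gcomp (ext_tensor_P n i) d"
        "y \<in> gcomp (ext_tensor_Q n k \<beta> (i - 1)) d"
        unfolding cover_gcomp[symmetric] by (auto simp: cover_module_def)
      then have "z \<in> TP n i" "y \<in> TQ n k (i - 1)" by (auto simp: gcomp_ext_tensor_P gcomp_ext_tensor_Q)
      from surj[OF this] obtain f where "f \<in> gcomp ?F d" "?f f = x" using zy by metis
      then show "x \<in> ?f ` gcomp ?F d" by blast
    qed
  qed
  then show "graded_iso n ?F ?G ?f" using lin bij by (simp add: graded_iso_def)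
qed

section \<open>The differentials of the mapping cone\<close>

lemma id_tensor_apply: "id_tensor f z (J, l) = f (\<lambda>i. z (J, i)) l"
  by (simp add: id_tensor_def)

lemma id_tensor_tau: "id_tensor (tau n B) y (J, l) = (\<Sum>j<dim_col B. y (J, j) * (if l < n - 1 then B $$ (l, j) else 0))"
  by (simp add: id_tensor_apply tau_def linear_extension_def)

lemma id_tensor_tau_add: "id_tensor (tau n B) (f + g) = id_tensor (tau n B) f + id_tensor (tau n B) g"
  by (auto simp: id_tensor_tau fun_eq_iff distrib_right sum.distrib)

lemma id_tensor_tau_smult: "id_tensor (tau n B) (\<lambda>x. p * f x) = (\<lambda>x. p * id_tensor (tau n B) f x)"
  by (auto simp: id_tensor_tau fun_eq_iff sum_distrib_left mult.assoc)

text \<open>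
  The two maps act on different tensor factors.  This makes the family \<open>\<mu>\<^sub>i\<close> a chain map.
\<close>

lemma tensor_koszul_tau:
  "tensor_id (koszul n i) (id_tensor (tau n B) y) = id_tensor (tau n B) (tensor_id (koszul n i) y)"
proof -
  have "tensor_id (koszul n i) (id_tensor (tau n B) y) (J, l) = id_tensor (tau n B) (tensor_id (koszul n i) y) (J, l)" for J l
    unfolding tensor_id_apply id_tensor_tau koszul_def linear_extension_def sum_distrib_right
    by (subst sum.swap) (simp add: ac_simps)
  then show ?thesis by (simp add: fun_eq_iff)
qed

lemma tensor_koszul_homog:
  assumes z: "z \<in> coords n (ext_basis n (Suc i) \<times> W)"
    and h: "\<And>J l. homog (d - (int (card J) + v l)) (z (J, l))"
  shows "homog (d - (int (card J) + v l)) (tensor_id (koszul n (Suc i)) z (J, l))"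
proof (cases "J \<in> ext_basis n i")
  case True
  have "homog (d - (int (card J) + v l)) (position_sign a J * (var a * z (insert a J, l)))" if "a \<notin> J" for a
    using h[of "insert a J" l] ext_basis_finite[OF True] that
    by (intro homog_position_sign_mult homog_mult[OF homog_var]) auto
  then have "homog (d - (int (card J) + v l)) (contraction n (\<lambda>I. z (I, l)) J)"
    unfolding contraction_def by (intro homog_sum) auto
  then show ?thesis by (simp add: tensor_id_apply koszul_eq[OF coords_slice[OF z]])
next
  case False
  then show ?thesis using coordsD(2)[OF tensor_koszul_coords[OF z], of "(J, l)"] by simp
qed

text \<open>
  The map \<open>\<delta>\<^sub>1 : P \<rightarrow> R\<close>, with \<open>P\<close> regarded as \<open>\<And>\<^sup>0P \<otimes> P\<close>; thus \<open>\<mu>\<^sub>1\<close> is \<open>linear_form\<close> after \<open>\<tau>\<^sub>B\<close>.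
\<close>

definition linear_form :: "nat \<Rightarrow> (nat set \<times> nat \<Rightarrow> 'k::field mpol) \<Rightarrow> 'k mpol" where
  "linear_form n z = (\<Sum>l<n - 1. z ({}, l) * var l)"

lemma mu1_eq: "mu1 n B y = linear_form n (id_tensor (tau n B) y)"
  by (simp add: mu1_def linear_form_def id_tensor_apply)

lemma linear_form_koszul:
  assumes "z \<in> TP n (Suc 0)"
  shows "linear_form n (tensor_id (koszul n (Suc 0)) z) = quadratic_form n z"
  unfolding linear_form_def quadratic_form_def tensor_id_apply koszul_eq[OF coords_slice[OF assms]] contraction_def
  by (subst sum.swap) (simp add: position_sign_def sum_distrib_left sum_distrib_right ac_simps)

lemma linear_form_add: "linear_form n (z + w) = linear_form n z + linear_form n w"
  and linear_form_smult: "linear_form n (\<lambda>x. p * z x) = p * linear_form n z"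
  by (simp_all add: linear_form_def distrib_right sum.distrib sum_distrib_left mult.assoc)

lemma quadratic_form_add: "quadratic_form n (z + w) = quadratic_form n z + quadratic_form n w"
  and quadratic_form_diff: "quadratic_form n (z - w) = quadratic_form n z - quadratic_form n w"
  and quadratic_form_smult: "quadratic_form n (\<lambda>x. p * z x) = p * quadratic_form n z"
  by (simp_all add: quadratic_form_def distrib_right left_diff_distrib sum.distrib sum_subtractf sum_distrib_left mult.assoc)

lemma quadratic_form_partial_image: "p \<in> partial_image n (Suc 0) \<Longrightarrow> quadratic_form n p = 0"
  using quadratic_form_partial by (auto simp: partial_image_eq numeral_2_eq_2)

text \<open>
  The quadratic form is constant on cosets, as \<open>x\<^sub>ax\<^sub>b - x\<^sub>bx\<^sub>a = 0\<close>.
\<close>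

lemma d1_map_D_proj: "d1_map n (D_proj n 1 z) = quadratic_form n z"
proof -
  have "d1_map n (D_proj n 1 z) = the_elem (quadratic_form n ` D_proj n 1 z)"
    by (simp add: d1_map_def quadratic_form_def[abs_def])
  also have "quadratic_form n ` D_proj n 1 z = {quadratic_form n z}"
  proof -
    have "quadratic_form n z' = quadratic_form n z" if "z' \<in> D_proj n 1 z" for z'
      using that quadratic_form_partial_image
      by (auto simp: D_proj_eq quadratic_form_add simp del: plus_fun_apply)
    then show ?thesis using D_proj_self[of z n 1] by blast
  qed
  finally show ?thesis by simp
qed

lemma tensor_koszul_partial_image:
  assumes "p \<in> partial_image n (Suc i)"
  shows "tensor_id (koszul n (Suc i)) p \<in> partial_image n i"
proof -
  obtain y where y: "y \<in> coords n (ext_basis n (Suc (Suc i)))" "p = partial n (Suc (Suc i)) y"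
    using assms by (auto simp: partial_image_eq)
  have "- koszul n (Suc (Suc i)) y \<in> coords n (ext_basis n (Suc i))"
    unfolding koszul_eq[OF y(1)] by (intro coords_uminus contraction_coords y(1))
  from partial_imageI[OF this] show ?thesis
    unfolding y(2) koszul_partial[OF y(1)] partial_uminus .
qed

lemma d_map_D_proj: "d_map n (Suc i) (D_proj n (Suc i) z) = D_proj n i (tensor_id (koszul n (Suc i)) z)"
proof -
  have "d_map n (Suc i) (D_proj n (Suc i) z) = (\<Union>z'\<in>D_proj n (Suc i) z. D_proj n i (tensor_id (koszul n (Suc i)) z'))"
    by (simp add: d_map_def)
  also have "\<dots> = (\<Union>z'\<in>D_proj n (Suc i) z. D_proj n i (tensor_id (koszul n (Suc i)) z))"
  proof (rule SUP_cong)
    fix z' assume "z' \<in> D_proj n (Suc i) z"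
    then have "z' - z \<in> partial_image n (Suc i)" using D_proj_memD D_proj_eq_iff by blast
    from tensor_koszul_partial_image[OF this]
    show "D_proj n i (tensor_id (koszul n (Suc i)) z') = D_proj n i (tensor_id (koszul n (Suc i)) z)"
      unfolding D_proj_eq_iff tensor_koszul_diff .
  qed simp
  also have "\<dots> = D_proj n i (tensor_id (koszul n (Suc i)) z)" using D_proj_self by blast
  finally show ?thesis .
qed

text \<open>
  Modulo the square of the ideal \<open>I\<close> generated by the variables in \<open>A\<close>, an element of \<open>I\<close> has a unique
  expression as a linear combination of these variables with coefficients in which they do not occur.
  The operator \<open>restr A \<circ> quo l\<close> reads off the coefficient of the variable \<open>l\<close>: it vanishes on \<open>I\<^sup>2\<close>, by
  this lemma, and has the expected value on multiples of one variable, by the next.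
\<close>

lemma restr_quo_mult_var_var:
  assumes "i \<in> A" "j \<in> A"
  shows "restr A (quo l (p * (var i * var j))) = 0"
proof -
  have "quo l (p * (var i * var j)) = (if l = i then var j * p else var i * quo l (var j * p))"
    using quo_var_same[of i "var j * p"] quo_var_other[of l i "var j * p"] by (simp add: ac_simps)
  then show ?thesis using assms by (simp add: restr_mult restr_var)
qed

lemma restr_quo_mult_var:
  assumes "i \<in> A"
  shows "restr A (quo l (p * var i)) = (if i = l then restr A p else 0)"
proof -
  have "quo l (p * var i) = (if l = i then p else var i * quo l p)"
    using quo_var_same[of i p] quo_var_other[of l i p] by (simp add: mult.commute)
  then show ?thesis using assms by (simp add: restr_mult restr_var)
qed

locale rope_matrix =
  fixes n k :: nat and \<beta> :: "nat \<Rightarrow> nat" and B :: "'k::field mpol mat"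
  assumes n: "n \<ge> 3"
    and B_carrier: "B \<in> carrier_mat (n - 1) k"
    and B_entry: "\<And>i j. i < n - 1 \<Longrightarrow> j < k \<Longrightarrow> B $$ (i, j) \<in> SS_carrier n \<and> homog (int (\<beta> j)) (B $$ (i, j))"
    and minors: "no_common_zero_of_maximal_minors n B"
begin

abbreviation \<kappa> :: "nat \<Rightarrow> (nat set \<times> nat \<Rightarrow> 'k mpol) \<Rightarrow> nat set \<times> nat \<Rightarrow> 'k mpol" where
  "\<kappa> i \<equiv> tensor_id (koszul n i)"

abbreviation \<tau> :: "(nat set \<times> nat \<Rightarrow> 'k mpol) \<Rightarrow> nat set \<times> nat \<Rightarrow> 'k mpol" where
  "\<tau> \<equiv> id_tensor (tau n B)"

lemma dim_B: "dim_row B = n - 1" "dim_col B = k"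
  using B_carrier by auto

lemma B_polys: "i < n - 1 \<Longrightarrow> j < k \<Longrightarrow> B $$ (i, j) \<in> polys {..n}"
  using B_entry[of i j] polys_mono[of "{n - 1, n}" "{..n}"] by (auto simp: SS_carrier_def)

lemma \<tau>_apply: "\<tau> y (J, l) = (\<Sum>j<k. y (J, j) * (if l < n - 1 then B $$ (l, j) else 0))"
  by (simp add: id_tensor_tau dim_B)

lemma \<tau>_coords: "y \<in> TQ n k i \<Longrightarrow> \<tau> y \<in> TP n i"
  by (rule coords_prodI) (auto simp: \<tau>_apply coordsD B_polys intro!: polys_sum polys_mult sum.neutral)

lemma \<tau>_homog:
  assumes h: "\<And>J j. homog (d - (int (card J) + int (\<beta> j) + 1)) (y (J, j))"
  shows "homog (d - (int (card J) + 1)) (\<tau> y (J, l))"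
  unfolding \<tau>_apply
proof (rule homog_sum)
  fix j assume "j \<in> {..<k}"
  then show "homog (d - (int (card J) + 1)) (y (J, j) * (if l < n - 1 then B $$ (l, j) else 0))"
    using B_entry[of l j] by (auto intro!: homog_mult[OF h])
qed

text \<open>
  The map \<open>d'\<^sub>i\<close> on representatives.
\<close>

definition cone_map :: "nat \<Rightarrow> (nat set \<times> nat \<Rightarrow> 'k mpol) \<times> (nat set \<times> nat \<Rightarrow> 'k mpol) \<Rightarrow>
    (nat set \<times> nat \<Rightarrow> 'k mpol) \<times> (nat set \<times> nat \<Rightarrow> 'k mpol)" where
  "cone_map i = (\<lambda>(z, y). (\<kappa> i z + (\<lambda>x. (- 1) ^ i * \<tau> y x), \<kappa> (i - 1) y))"

lemma cone_map_coords:
  assumes "z \<in> TP n (Suc (Suc i))" "y \<in> TQ n k (Suc i)"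
  shows "cone_map (Suc (Suc i)) (z, y) \<in> TP n (Suc i) \<times> TQ n k i"
  unfolding cone_map_def using tensor_koszul_coords[OF assms(1)] tensor_koszul_coords[OF assms(2)] \<tau>_coords[OF assms(2)]
  by (auto intro!: coords_add coords_smult simp del: plus_fun_apply)

lemma cone_map_add: "cone_map i (z + z', y + y') = (fst (cone_map i (z, y)) + fst (cone_map i (z', y')), snd (cone_map i (z, y)) + snd (cone_map i (z', y')))"
  by (auto simp: cone_map_def tensor_koszul_add id_tensor_tau_add fun_eq_iff algebra_simps)

lemma cone_map_smult: "cone_map i (\<lambda>x. p * z x, \<lambda>x. p * y x) = (\<lambda>x. p * fst (cone_map i (z, y)) x, \<lambda>x. p * snd (cone_map i (z, y)) x)"
  by (auto simp: cone_map_def tensor_koszul_smult id_tensor_tau_smult fun_eq_iff algebra_simps)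

lemma TP_n: "z \<in> TP n n \<Longrightarrow> z = 0" and TQ_n: "y \<in> TQ n k n \<Longrightarrow> y = 0"
  using ext_basis_eq_empty[of n n] n by (auto simp: coords_def fun_eq_iff)

text \<open>
  The separate definition of \<open>d'\<^sub>n\<close> agrees with the general formula, because for \<open>i = n\<close> the only
  representative of an element of \<open>D\<^sub>n\<close> is zero.
\<close>

lemma dd_cover:
  assumes i: "Suc (Suc i) \<le> n" and z: "z \<in> TP n (Suc (Suc i))"
  shows "dd n B (Suc (Suc i)) (cover n (Suc (Suc i)) (z, y)) = cover n (Suc i) (cone_map (Suc (Suc i)) (z, y))"
proof -
  have mu: "(- 1) ^ Suc (Suc i) \<odot>\<^bsub>D_module n (Suc i)\<^esub> mu n B (Suc (Suc i)) y =
      D_proj n (Suc i) (\<lambda>x. (- 1) ^ Suc (Suc i) * \<tau> y x)"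
    unfolding mu_def diff_Suc_1 by (rule D_smult) (rule polys_sign)
  show ?thesis
  proof (cases "Suc (Suc i) < n")
    case True
    then show ?thesis unfolding dd_def cone_map_def cover_apply prod.case diff_Suc_1 mu d_map_D_proj D_add by simp
  next
    case False
    then have "n = Suc (Suc i)" using i by simp
    then have "z = 0" using TP_n z by simp
    then show ?thesis using False unfolding dd_def cone_map_def cover_apply prod.case diff_Suc_1 mu
      by (simp add: tensor_koszul_0)
  qed
qed

lemma dd1_cover: "dd1 n B (cover n 1 (z, y)) = quadratic_form n z - linear_form n (\<tau> y)"
  using d1_map_D_proj[of n z] by (simp add: dd1_def mu1_eq)

lemma graded_hom_dd:
  assumes i: "Suc (Suc i) \<le> n"
  shows "graded_hom n (G_module n k \<beta> (Suc (Suc i))) (G_module n k \<beta> (Suc i)) (dd n B (Suc (Suc i)))"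
proof (rule graded_hom_from_GI, unfold diff_Suc_1)
  let ?i = "Suc (Suc i)"
  fix z y z' y' :: "nat set \<times> nat \<Rightarrow> 'k mpol"
  assume z: "z \<in> TP n ?i" and y: "y \<in> TQ n k (Suc i)"
  show "dd n B ?i (cover n ?i (z, y)) \<in> carrier (G_module n k \<beta> (Suc i))"
    unfolding dd_cover[OF i z] cover_carrier[symmetric] diff_Suc_1 by (rule imageI) (rule cone_map_coords[OF z y])
  show "dd n B ?i (cover n ?i (\<lambda>x. a * z x, \<lambda>x. a * y x)) =
      a \<odot>\<^bsub>G_module n k \<beta> (Suc i)\<^esub> dd n B ?i (cover n ?i (z, y))" if "a \<in> polys {..n}" for a
    unfolding dd_cover[OF i z] dd_cover[OF i coords_smult[OF that z]] cone_map_smult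
    unfolding cover_smult[where k = k and \<beta> = \<beta>, OF that] by simp
  assume z': "z' \<in> TP n ?i"
  show "dd n B ?i (cover n ?i (z + z', y + y')) =
      dd n B ?i (cover n ?i (z, y)) \<oplus>\<^bsub>G_module n k \<beta> (Suc i)\<^esub> dd n B ?i (cover n ?i (z', y'))"
    unfolding dd_cover[OF i z] dd_cover[OF i z'] dd_cover[OF i coords_add[OF z z']] cone_map_add
    unfolding cover_add[where k = k and \<beta> = \<beta>] by simp
next
  let ?i = "Suc (Suc i)"
  fix d and z y :: "nat set \<times> nat \<Rightarrow> 'k mpol"
  assume "z \<in> gcomp (ext_tensor_P n ?i) d" "y \<in> gcomp (ext_tensor_Q n k \<beta> (Suc i)) d"
  then have z: "z \<in> TP n ?i" "\<And>J l. homog (d - (int (card J) + 1)) (z (J, l))"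
      and y: "y \<in> TQ n k (Suc i)" "\<And>J j. homog (d - (int (card J) + int (\<beta> j) + 1)) (y (J, j))"
    by (simp_all add: gcomp_ext_tensor_P gcomp_ext_tensor_Q)
  have "homog (d - (int (card J) + 1)) (fst (cone_map ?i (z, y)) (J, l))" for J l
    using tensor_koszul_homog[OF z, of J l] homog_mult[OF homog_sign \<tau>_homog[OF y(2), of J l] refl, of ?i]
    by (simp add: cone_map_def homog_add)
  moreover have "homog (d - (int (card J) + int (\<beta> j) + 1)) (snd (cone_map ?i (z, y)) (J, j))" for J j
    using tensor_koszul_homog[OF y(1), of d "\<lambda>j. int (\<beta> j) + 1" J j] y(2)
    by (simp add: cone_map_def add.assoc)
  ultimately have "cone_map ?i (z, y) \<in> gcomp (cover_module n k \<beta> (Suc i)) d"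
    using cone_map_coords[OF z(1) y(1)]
    by (cases "cone_map ?i (z, y)") (simp add: cover_module_def gcomp_ext_tensor_P gcomp_ext_tensor_Q)
  then show "dd n B ?i (cover n ?i (z, y)) \<in> gcomp (G_module n k \<beta> (Suc i)) d"
    unfolding dd_cover[OF i z(1)] cover_gcomp[symmetric] by (rule imageI)
qed

lemma graded_hom_dd1: "graded_hom n (G_module n k \<beta> 1) (regular_module n) (dd1 n B)"
proof (rule graded_hom_from_GI, unfold diff_self_eq_0)
  have R: "carrier (regular_module n :: ('k mpol, _) graded_module) = polys {..n}"
     "gcomp (regular_module n) = RR_comp n"
     "f \<oplus>\<^bsub>regular_module n\<^esub> g = f + g" "f \<odot>\<^bsub>regular_module n\<^esub> g = f * g" for f g :: "'k mpol"
    by (simp_all add: regular_module_def)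
  fix z y z' y' :: "nat set \<times> nat \<Rightarrow> 'k mpol"
  have cl: "quadratic_form n z - linear_form n (\<tau> y) \<in> polys {..n}"
    if "z \<in> TP n 1" "y \<in> TQ n k 0" for z y
    using that coordsD(1)[OF \<tau>_coords, of y 0] unfolding quadratic_form_def linear_form_def
    by (intro polys_diff polys_sum polys_mult) (auto simp: coordsD)
  show "dd1 n B (cover n 1 (z, y)) \<in> carrier (regular_module n)" if "z \<in> TP n 1" "y \<in> TQ n k 0"
    unfolding R dd1_cover using that by (rule cl)
  show "dd1 n B (cover n 1 (z + z', y + y')) =
      dd1 n B (cover n 1 (z, y)) \<oplus>\<^bsub>regular_module n\<^esub> dd1 n B (cover n 1 (z', y'))"
    unfolding R dd1_cover quadratic_form_add id_tensor_tau_add linear_form_add by simp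
  show "dd1 n B (cover n 1 (\<lambda>x. a * z x, \<lambda>x. a * y x)) =
      a \<odot>\<^bsub>regular_module n\<^esub> dd1 n B (cover n 1 (z, y))" for a
    unfolding R dd1_cover quadratic_form_smult id_tensor_tau_smult linear_form_smult right_diff_distrib ..
  fix d
  assume "z \<in> gcomp (ext_tensor_P n 1) d" "y \<in> gcomp (ext_tensor_Q n k \<beta> 0) d"
  then have z: "z \<in> TP n 1" "\<And>J l. homog (d - (int (card J) + 1)) (z (J, l))"
      and y: "y \<in> TQ n k 0" "\<And>J j. homog (d - (int (card J) + int (\<beta> j) + 1)) (y (J, j))"
    by (simp_all add: gcomp_ext_tensor_P gcomp_ext_tensor_Q)
  have "homog d (z ({i}, j) * (var i * var j))" for i j
    using z(2)[of "{i}" j] by (intro homog_mult[OF _ homog_mult[OF homog_var homog_var refl]]) auto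
  then have "homog d (quadratic_form n z)" unfolding quadratic_form_def by (intro homog_sum)
  moreover have "homog d (linear_form n (\<tau> y))" unfolding linear_form_def
    using \<tau>_homog[OF y(2), of "{}"] by (intro homog_sum homog_mult[OF _ homog_var]) auto
  ultimately have "homog d (quadratic_form n z + - linear_form n (\<tau> y))" by (intro homog_add homog_uminus)
  then show "dd1 n B (cover n 1 (z, y)) \<in> gcomp (regular_module n) d"
    unfolding R dd1_cover using cl[OF z(1) y(1)] by (simp add: RR_comp_def)
qed

section \<open>Exactness of the mapping cone\<close>

text \<open>
  The mixed terms \<open>(- 1)\<^sup>i\<^sup>+\<^sup>1 \<delta>\<tau>\<close> and \<open>(- 1)\<^sup>i \<tau>\<delta>\<close> cancel.
\<close>

lemma cone_map_cone_map:
  assumes "z \<in> TP n (Suc (Suc (Suc i)))" "y \<in> TQ n k (Suc (Suc i))"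
  shows "cone_map (Suc (Suc i)) (cone_map (Suc (Suc (Suc i))) (z, y)) = (0, 0)"
  unfolding cone_map_def prod.case diff_Suc_1 tensor_koszul_add tensor_koszul_smult tensor_koszul_koszul[OF assms(1)]
    tensor_koszul_koszul[OF assms(2)] tensor_koszul_tau
  by (simp add: fun_eq_iff)

text \<open>
  The second component of a cycle is a boundary \<open>\<delta>w\<close>.  Subtracting the image of \<open>w\<close> leaves a cycle of
  the complex \<open>D\<close> in the first component, and \<open>D_exact\<close> applies.
\<close>

lemma cone_exact:
  assumes z: "z \<in> TP n (Suc (Suc i))" and y: "y \<in> TQ n k (Suc i)"
    and k1: "fst (cone_map (Suc (Suc i)) (z, y)) \<in> partial_image n (Suc i)"
    and k2: "snd (cone_map (Suc (Suc i)) (z, y)) = 0"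
  shows "\<exists>z'\<in>TP n (Suc (Suc (Suc i))). \<exists>y'\<in>TQ n k (Suc (Suc i)).
    cover n (Suc (Suc i)) (z, y) = cover n (Suc (Suc i)) (cone_map (Suc (Suc (Suc i))) (z', y'))"
proof -
  let ?s = "(- 1 :: 'k mpol) ^ Suc (Suc i)"
  have "\<kappa> (Suc i) y = 0" using k2 by (simp add: cone_map_def)
  then obtain w where w: "w \<in> TQ n k (Suc (Suc i))" "y = \<kappa> (Suc (Suc i)) w"
    using tensor_koszul_exact[OF y] by blast
  \<comment> \<open>The correction of \<open>z\<close> by \<open>w\<close>, so that its differential is the first component of the given cycle.\<close>
  let ?z = "z + (\<lambda>x. ?s * \<tau> w x)"
  have zc: "?z \<in> TP n (Suc (Suc i))" by (intro coords_add z coords_smult \<tau>_coords w(1) polys_sign)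
  have "\<kappa> (Suc (Suc i)) ?z = fst (cone_map (Suc (Suc i)) (z, y))"
    unfolding cone_map_def prod.case fst_conv tensor_koszul_add tensor_koszul_smult tensor_koszul_tau w(2) ..
  then obtain z' where z': "z' \<in> TP n (Suc (Suc (Suc i)))"
      "?z - \<kappa> (Suc (Suc (Suc i))) z' \<in> partial_image n (Suc (Suc i))"
    using D_exact[OF zc] k1 by metis
  have "?z - \<kappa> (Suc (Suc (Suc i))) z' = z - (\<kappa> (Suc (Suc (Suc i))) z' + (\<lambda>x. (- 1) ^ Suc (Suc (Suc i)) * \<tau> w x))"
    by (auto simp: fun_eq_iff)
  then have "D_proj n (Suc (Suc i)) z = D_proj n (Suc (Suc i)) (\<kappa> (Suc (Suc (Suc i))) z' + (\<lambda>x. (- 1) ^ Suc (Suc (Suc i)) * \<tau> w x))"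
    using z'(2) D_proj_eq_iff by metis
  then have "cover n (Suc (Suc i)) (z, y) = cover n (Suc (Suc i)) (cone_map (Suc (Suc (Suc i))) (z', w))"
    unfolding cone_map_def prod.case cover_apply diff_Suc_1 w(2) by simp
  then show ?thesis using z'(1) w(1) by blast
qed

text \<open>
  Otherwise the generic point of \<open>L\<close> would be a common zero of the maximal minors.
\<close>

lemma nonzero_minor: "\<exists>I. I \<subseteq> {..<n - 1} \<and> card I = k \<and> det (submatrix B I {..<k}) \<noteq> 0"
proof (rule ccontr)
  assume none: "\<not> ?thesis"
  have p: "(line_ideal n :: 'k mpol set) \<in> support n (line_ideal n)"
    by (rule line_ideal_in_support) (use n in simp)
  have "(0 :: 'k mpol) \<in> line_ideal n" by (simp add: line_ideal_eq)
  then have "\<forall>I. I \<subseteq> {..<dim_row B} \<and> card I = dim_col B \<longrightarrow> det (submatrix B I {..<dim_col B}) \<in> line_ideal n"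
    using none unfolding dim_B by metis
  then show False using minors p unfolding no_common_zero_of_maximal_minors_def by blast
qed

lemma B_injective:
  assumes c: "\<And>l. l < n - 1 \<Longrightarrow> (\<Sum>j<k. B $$ (l, j) * c j) = 0" and j: "j < k"
  shows "c j = 0"
proof -
  obtain I where I: "I \<subseteq> {..<n - 1}" "card I = k" "det (submatrix B I {..<k}) \<noteq> 0"
    using nonzero_minor by blast
  let ?M = "submatrix B I {..<k}"
  have cI: "{i. i < n - 1 \<and> i \<in> I} = I" and ck: "{j. j < k \<and> j \<in> {..<k}} = {..<k}" using I(1) by auto
  have M: "?M \<in> carrier_mat k k"
    by (rule carrier_matI) (simp_all only: dim_submatrix dim_B cI ck I(2) card_lessThan)
  have Mrj: "?M $$ (r, j) = B $$ (pick I r, j)" if "r < k" "j < k" for r j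
  proof -
    have "{a \<in> {..<k}. a < j} = {..<j}" using that by auto
    then have "pick {..<k} j = j" using pick_card_in_set[of j "{..<k}"] that by simp
    moreover have "?M $$ (r, j) = B $$ (pick I r, pick {..<k} j)"
      by (rule submatrix_index) (simp_all only: dim_B cI ck I(2) card_lessThan that)
    ultimately show ?thesis by simp
  qed
  have pick: "pick I r < n - 1" if "r < k" for r
    by (rule pick_le) (simp only: cI I(2) that)
  let ?v = "vec k c"
  have "?M *\<^sub>v ?v = 0\<^sub>v k"
  proof (rule eq_vecI)
    fix r assume "r < dim_vec (0\<^sub>v k :: 'k mpol vec)"
    then have r: "r < k" by simp
    have "(?M *\<^sub>v ?v) $ r = (\<Sum>j<k. B $$ (pick I r, j) * c j)"
      using M r by (simp add: scalar_prod_def Mrj atLeast0LessThan)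
    then show "(?M *\<^sub>v ?v) $ r = 0\<^sub>v k $ r" using c[OF pick[OF r]] r by simp
  qed (use M in simp)
  then have "?v = 0\<^sub>v k" using det_0_iff_vec_prod_zero[OF M] I(3) vec_carrier[of k c] by blast
  then have "?v $ j = (0\<^sub>v k :: 'k mpol vec) $ j" by simp
  then show ?thesis using j by simp
qed

text \<open>
  The equation says that the \<open>\<tau>\<close>-part lies in \<open>I\<^sub>L\<^sup>2\<close>.  Comparing the coefficients of the variables
  modulo \<open>I\<^sub>L\<^sup>2\<close> shows that \<open>B\<close> kills \<open>y\<close> modulo \<open>I\<^sub>L\<close>, so the coordinates of \<open>y\<close> lie in \<open>I\<^sub>L\<close> since \<open>B\<close> is
  injective over \<open>S\<close>.  Hence \<open>y = \<delta>w\<close>, and the remaining argument is that of \<open>cone_exact\<close>.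
\<close>

lemma cone_exact_1:
  assumes z: "z \<in> TP n 1" and y: "y \<in> TQ n k 0" and e: "quadratic_form n z = linear_form n (\<tau> y)"
  shows "\<exists>z'\<in>TP n 2. \<exists>y'\<in>TQ n k 1. cover n 1 (z, y) = cover n 1 (cone_map 2 (z', y'))"
proof -
  let ?A = "{..<n - 1}"
  have "restr ?A (\<tau> y ({}, l)) = 0" if l: "l < n - 1" for l
  proof -
    have "restr ?A (quo l (quadratic_form n z)) = 0"
      unfolding quadratic_form_def quo_sum restr_sum by (simp add: restr_quo_mult_var_var)
    moreover have "restr ?A (quo l (linear_form n (\<tau> y))) = restr ?A (\<tau> y ({}, l))"
      unfolding linear_form_def quo_sum restr_sum using l by (simp add: restr_quo_mult_var)
    ultimately show ?thesis using e by simp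
  qed
  then have "(\<Sum>j<k. B $$ (l, j) * restr ?A (y ({}, j))) = 0" if l: "l < n - 1" for l
  proof -
    have "restr ?A (\<tau> y ({}, l)) = (\<Sum>j<k. B $$ (l, j) * restr ?A (y ({}, j)))"
      unfolding \<tau>_apply restr_sum restr_mult
    proof (rule sum.cong)
      fix j assume "j \<in> {..<k}"
      then have "restr ?A (B $$ (l, j)) = B $$ (l, j)"
        using B_entry[OF l, of j] n by (intro restr_id[of _ "{n - 1, n}"]) (auto simp: SS_carrier_def)
      then show "restr ?A (y ({}, j)) * restr ?A (if l < n - 1 then B $$ (l, j) else 0) = B $$ (l, j) * restr ?A (y ({}, j))"
        using l by (simp add: mult.commute)
    qed simp
    then show ?thesis using \<open>\<And>l. l < n - 1 \<Longrightarrow> restr ?A (\<tau> y ({}, l)) = 0\<close>[OF l] by simp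
  qed
  then have r: "restr ?A (y ({}, j)) = 0" if "j < k" for j
    by (rule B_injective[where c = "\<lambda>j. restr ?A (y ({}, j))", OF _ that])
  have "\<exists>g. (\<forall>a. g a \<in> polys {..n}) \<and> y ({}, j) = (\<Sum>a<n - 1. var a * g a)" if "j < k" for j
    using restr_eq_0_obtain[OF _ r[OF that] coordsD(1)[OF y]] by simp
  then obtain g where g: "\<And>j a. j < k \<Longrightarrow> g j a \<in> polys {..n}" "\<And>j. j < k \<Longrightarrow> y ({}, j) = (\<Sum>a<n - 1. var a * g j a)"
    by metis
  \<comment> \<open>The coefficient of \<open>x\<^sub>a\<close> in \<open>y ({}, j)\<close> becomes the coordinate at \<open>e\<^sub>a \<otimes> q\<^sub>j\<close>.\<close>
  define w where "w = (\<lambda>(I, j). if I \<in> ext_basis n (Suc 0) \<and> j < k then g j (the_elem I) else 0)"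
  have w: "w \<in> TQ n k (Suc 0)" by (rule coords_prodI) (auto simp: w_def g(1))
  have "\<kappa> (Suc 0) w (J, j) = y (J, j)" for J j
  proof (cases "J = {} \<and> j < k")
    case True
    have "{a} \<in> ext_basis n (Suc 0)" if "a < n - 1" for a using that by (simp add: ext_basis_def)
    then show ?thesis using True g(2)[of j]
      unfolding tensor_id_apply koszul_eq[OF coords_slice[OF w]]
      by (simp add: contraction_def position_sign_def w_def)
  next
    case False
    then have "(J, j) \<notin> ext_basis n 0 \<times> {..<k}" by (auto simp: ext_basis_0)
    then show ?thesis using coordsD(2)[OF y] coordsD(2)[OF tensor_koszul_coords[OF w]] by metis
  qed
  then have yw: "\<kappa> (Suc 0) w = y" by (simp add: fun_eq_iff)
  have \<tau>w: "\<tau> w \<in> TP n (Suc 0)" using w by (rule \<tau>_coords)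
  have "quadratic_form n (z - \<tau> w) = 0"
    unfolding quadratic_form_diff e linear_form_koszul[OF \<tau>w, symmetric] tensor_koszul_tau yw by simp
  moreover have "z - \<tau> w \<in> TP n 1" using z \<tau>w by (intro coords_diff) auto
  ultimately obtain z' where z': "z' \<in> TP n 2" "(z - \<tau> w) - \<kappa> 2 z' \<in> partial_image n 1"
    using D_exact_1 by blast
  have "(z - \<tau> w) - \<kappa> 2 z' = z - (\<kappa> 2 z' + (\<lambda>x. (- 1) ^ 2 * \<tau> w x))" by (simp add: fun_eq_iff)
  then have "D_proj n 1 z = D_proj n 1 (\<kappa> 2 z' + (\<lambda>x. (- 1) ^ 2 * \<tau> w x))"
    using z'(2) D_proj_eq_iff by metis
  then have "cover n 1 (z, y) = cover n 1 (cone_map 2 (z', w))"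
    unfolding cone_map_def prod.case cover_apply using yw by simp
  then show ?thesis using z'(1) w by (metis One_nat_def)
qed

end

section \<open>The ideal of the rope\<close>

context rope_matrix
begin

lemma cover_eq_zero: "cover n i (z, y) = \<zero>\<^bsub>G_module n k \<beta> i\<^esub> \<longleftrightarrow> z \<in> partial_image n i \<and> y = 0"
  unfolding cover_zero[symmetric] cover_apply prod.inject D_proj_eq_iff by simp

lemma G_carrierE:
  assumes "x \<in> carrier (G_module n k \<beta> (Suc i))"
  obtains z y where "x = cover n (Suc i) (z, y)" "z \<in> TP n (Suc i)" "y \<in> TQ n k i"
  using assms unfolding cover_carrier[symmetric] diff_Suc_1 by blast

lemma cover_in_G: "z \<in> TP n (Suc i) \<Longrightarrow> y \<in> TQ n k i \<Longrightarrow> cover n (Suc i) (z, y) \<in> carrier (G_module n k \<beta> (Suc i))"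
  unfolding cover_carrier[symmetric] diff_Suc_1 by (intro imageI SigmaI)

lemma cone_map_in_G:
  assumes "z \<in> TP n (Suc (Suc i))" "y \<in> TQ n k (Suc i)"
  shows "cover n (Suc i) (cone_map (Suc (Suc i)) (z, y)) \<in> carrier (G_module n k \<beta> (Suc i))"
  unfolding cover_carrier[symmetric] diff_Suc_1 by (intro imageI cone_map_coords assms)

lemma kernel_dd:
  assumes i: "Suc (Suc (Suc i)) \<le> n"
  shows "a_kernel (G_module n k \<beta> (Suc (Suc i))) (G_module n k \<beta> (Suc i)) (dd n B (Suc (Suc i))) =
    dd n B (Suc (Suc (Suc i))) ` carrier (G_module n k \<beta> (Suc (Suc (Suc i))))"
  unfolding a_kernel_def'
proof (intro subset_antisym subsetI)
  have i': "Suc (Suc i) \<le> n" using i by simp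
  fix x assume "x \<in> {x \<in> carrier (G_module n k \<beta> (Suc (Suc i))).
    dd n B (Suc (Suc i)) x = \<zero>\<^bsub>G_module n k \<beta> (Suc i)\<^esub>}"
  then have x: "x \<in> carrier (G_module n k \<beta> (Suc (Suc i)))"
    "dd n B (Suc (Suc i)) x = \<zero>\<^bsub>G_module n k \<beta> (Suc i)\<^esub>" by blast+
  obtain z y where zy: "x = cover n (Suc (Suc i)) (z, y)" "z \<in> TP n (Suc (Suc i))" "y \<in> TQ n k (Suc i)"
    using x(1) by (rule G_carrierE)
  obtain u v where uv: "cone_map (Suc (Suc i)) (z, y) = (u, v)" by fastforce
  have "u \<in> partial_image n (Suc i) \<and> v = 0"
    using x(2) unfolding zy(1) dd_cover[OF i' zy(2)] uv cover_eq_zero .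
  then obtain z' y' where z': "z' \<in> TP n (Suc (Suc (Suc i)))" "y' \<in> TQ n k (Suc (Suc i))"
      "x = cover n (Suc (Suc i)) (cone_map (Suc (Suc (Suc i))) (z', y'))"
    using cone_exact[OF zy(2,3)] unfolding uv zy(1) fst_conv snd_conv by blast
  have "x = dd n B (Suc (Suc (Suc i))) (cover n (Suc (Suc (Suc i))) (z', y'))"
    unfolding z'(3) dd_cover[OF i z'(1)] ..
  then show "x \<in> dd n B (Suc (Suc (Suc i))) ` carrier (G_module n k \<beta> (Suc (Suc (Suc i))))"
    using cover_in_G[OF z'(1,2)] by (rule image_eqI)
next
  have i': "Suc (Suc i) \<le> n" using i by simp
  fix s assume "s \<in> dd n B (Suc (Suc (Suc i))) ` carrier (G_module n k \<beta> (Suc (Suc (Suc i))))"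
  then obtain x where s: "s = dd n B (Suc (Suc (Suc i))) x" and "x \<in> carrier (G_module n k \<beta> (Suc (Suc (Suc i))))"
    by blast
  from this(2) obtain z y where zy: "x = cover n (Suc (Suc (Suc i))) (z, y)" "z \<in> TP n (Suc (Suc (Suc i)))" "y \<in> TQ n k (Suc (Suc i))"
    by (rule G_carrierE)
  have d: "s = cover n (Suc (Suc i)) (cone_map (Suc (Suc (Suc i))) (z, y))"
    unfolding s zy(1) by (rule dd_cover[OF i zy(2)])
  have 1: "s \<in> carrier (G_module n k \<beta> (Suc (Suc i)))"
    unfolding d by (rule cone_map_in_G[OF zy(2,3)])
  obtain u v where uv: "cone_map (Suc (Suc (Suc i))) (z, y) = (u, v)" by fastforce
  have u: "u \<in> TP n (Suc (Suc i))" using cone_map_coords[OF zy(2,3)] unfolding uv by simp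
  have "dd n B (Suc (Suc i)) s = \<zero>\<^bsub>G_module n k \<beta> (Suc i)\<^esub>"
    unfolding d uv dd_cover[OF i' u] unfolding uv[symmetric] cone_map_cone_map[OF zy(2,3)] by (rule cover_zero)
  with 1 show "s \<in> {x \<in> carrier (G_module n k \<beta> (Suc (Suc i))).
    dd n B (Suc (Suc i)) x = \<zero>\<^bsub>G_module n k \<beta> (Suc i)\<^esub>}" by blast
qed

lemma kernel_dd1:
  "a_kernel (G_module n k \<beta> 1) (regular_module n) (dd1 n B) = dd n B 2 ` carrier (G_module n k \<beta> 2)"
proof -
  have n2: "Suc (Suc 0) \<le> n" using n by simp
  have z0: "\<zero>\<^bsub>regular_module n\<^esub> = (0 :: 'k mpol)" by (simp add: regular_module_def)
  have "x \<in> dd n B (Suc (Suc 0)) ` carrier (G_module n k \<beta> (Suc (Suc 0)))"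
    if x: "x \<in> carrier (G_module n k \<beta> (Suc 0))" "dd1 n B x = 0" for x
  proof -
    obtain z y where zy: "x = cover n (Suc 0) (z, y)" "z \<in> TP n (Suc 0)" "y \<in> TQ n k 0"
      using x(1) by (rule G_carrierE)
    have "quadratic_form n z = linear_form n (\<tau> y)"
      using x(2) dd1_cover[of z y] unfolding zy(1) by simp
    then obtain z' y' where z': "z' \<in> TP n (Suc (Suc 0))" "y' \<in> TQ n k (Suc 0)"
        "x = cover n (Suc 0) (cone_map (Suc (Suc 0)) (z', y'))"
      using cone_exact_1[of z y] zy unfolding numeral_2_eq_2 One_nat_def by blast
    have "x = dd n B (Suc (Suc 0)) (cover n (Suc (Suc 0)) (z', y'))"
      unfolding z'(3) dd_cover[OF n2 z'(1)] ..
    then show ?thesis using cover_in_G[OF z'(1,2)] by (rule image_eqI)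
  qed
  moreover have "dd n B (Suc (Suc 0)) x \<in> carrier (G_module n k \<beta> (Suc 0))"
      "dd1 n B (dd n B (Suc (Suc 0)) x) = 0" if x: "x \<in> carrier (G_module n k \<beta> (Suc (Suc 0)))" for x
  proof -
    obtain z y where zy: "x = cover n (Suc (Suc 0)) (z, y)" "z \<in> TP n (Suc (Suc 0))" "y \<in> TQ n k (Suc 0)"
      using x by (rule G_carrierE)
    have d: "dd n B (Suc (Suc 0)) x = cover n (Suc 0) (cone_map (Suc (Suc 0)) (z, y))"
      unfolding zy(1) by (rule dd_cover[OF n2 zy(2)])
    show "dd n B (Suc (Suc 0)) x \<in> carrier (G_module n k \<beta> (Suc 0))"
      unfolding d by (rule cone_map_in_G[OF zy(2,3)])
    have q: "quadratic_form n (\<kappa> (Suc (Suc 0)) z) = 0"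
      using quadratic_form_koszul[of z n] zy(2) by (simp add: numeral_2_eq_2)
    have "dd1 n B (dd n B (Suc (Suc 0)) x) = quadratic_form n (\<tau> y) - linear_form n (\<kappa> (Suc 0) (\<tau> y))"
      unfolding d cone_map_def prod.case diff_Suc_1 dd1_cover[unfolded One_nat_def] tensor_koszul_tau
        quadratic_form_add q quadratic_form_smult by simp
    then show "dd1 n B (dd n B (Suc (Suc 0)) x) = 0"
      unfolding linear_form_koszul[OF \<tau>_coords[OF zy(3)]] by simp
  qed
  ultimately show ?thesis unfolding a_kernel_def' z0 numeral_2_eq_2 One_nat_def by blast
qed

text \<open>
  Both complexes end: \<open>D\<^sub>n = 0\<close>, and the last Koszul differential is injective by exactness.
\<close>

lemma inj_dd: "inj_on (dd n B n) (carrier (G_module n k \<beta> n))"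
proof -
  obtain m where m: "n = Suc (Suc m)" using n by (intro that[of "n - 2"]) simp
  show ?thesis
  proof (rule inj_onI)
    fix x x' assume x: "x \<in> carrier (G_module n k \<beta> n)" and x': "x' \<in> carrier (G_module n k \<beta> n)"
      and e: "dd n B n x = dd n B n x'"
    have "x \<in> carrier (G_module n k \<beta> (Suc (Suc m)))" using x by (simp only: m[symmetric])
    then obtain z y where zy: "x = cover n (Suc (Suc m)) (z, y)" "z \<in> TP n (Suc (Suc m))" "y \<in> TQ n k (Suc m)"
      by (rule G_carrierE)
    have "x' \<in> carrier (G_module n k \<beta> (Suc (Suc m)))" using x' by (simp only: m[symmetric])
    then obtain z' y' where zy': "x' = cover n (Suc (Suc m)) (z', y')" "z' \<in> TP n (Suc (Suc m))" "y' \<in> TQ n k (Suc m)"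
      by (rule G_carrierE)
    have "z = 0" by (rule TP_n) (use zy(2) in \<open>simp only: m[symmetric]\<close>)
    have "z' = 0" by (rule TP_n) (use zy'(2) in \<open>simp only: m[symmetric]\<close>)
    have mn: "Suc (Suc m) \<le> n" using m by simp
    have e1: "dd n B (Suc (Suc m)) x = dd n B (Suc (Suc m)) x'" using e by (simp only: m[symmetric])
    have "\<kappa> (Suc m) y = \<kappa> (Suc m) y'"
      using e1 unfolding zy(1) zy'(1) dd_cover[OF mn zy(2)] dd_cover[OF mn zy'(2)] cone_map_def by simp
    then have "\<kappa> (Suc m) (y - y') = 0" unfolding tensor_koszul_diff by simp
    then obtain w where w: "w \<in> TQ n k (Suc (Suc m))" "y - y' = \<kappa> (Suc (Suc m)) w"
      using tensor_koszul_exact[OF coords_diff[OF zy(3) zy'(3)]] by blast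
    have "w = 0" by (rule TQ_n) (use w(1) in \<open>simp only: m[symmetric]\<close>)
    then have "y - y' = 0" unfolding w(2) by (simp only: tensor_koszul_0)
    then have "y = y'" by (simp only: right_minus_eq)
    then show "x = x'" unfolding zy(1) zy'(1) \<open>z = 0\<close> \<open>z' = 0\<close> by simp
  qed
qed

lemma line_ideal_E:
  assumes "f \<in> line_ideal n"
  obtains g where "\<And>a. g a \<in> polys {..n}" "f = (\<Sum>a<n - 1. var a * g a)"
proof -
  have A: "{..n - 2} = {..<n - 1}" using n by auto
  show ?thesis using assms restr_eq_0_obtain[of "{..<n - 1}" f "{..n}"] that
    unfolding line_ideal_eq A by auto
qed

lemma var_in_line_ideal: "a < n - 1 \<Longrightarrow> var a \<in> (line_ideal n :: 'k mpol set)"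
  using n by (auto simp: line_ideal_eq restr_var)

abbreviation gen :: "nat \<Rightarrow> 'k mpol" where
  "gen j \<equiv> (\<Sum>i<n - 1. var i * B $$ (i, j))"

lemma gen_polys: "j < k \<Longrightarrow> gen j \<in> polys {..n}"
  using n by (intro polys_sum polys_mult B_polys polys_var) auto

lemma linear_form_\<tau>: "linear_form n (\<tau> y) = (\<Sum>j<k. y ({}, j) * gen j)"
  unfolding linear_form_def \<tau>_apply sum_distrib_left sum_distrib_right
  by (subst sum.swap) (auto simp: ac_simps intro!: sum.cong)

lemma image_dd1: "dd1 n B ` carrier (G_module n k \<beta> 1) = {quadratic_form n z - linear_form n (\<tau> y) | z y. z \<in> TP n 1 \<and> y \<in> TQ n k 0}"
proof -
  have "dd1 n B ` carrier (G_module n k \<beta> 1) = (\<lambda>x. dd1 n B (cover n 1 x)) ` (TP n 1 \<times> TQ n k 0)"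
    unfolding cover_carrier[symmetric] by (simp add: image_comp o_def)
  also have "\<dots> = {dd1 n B (cover n 1 (z, y)) | z y. z \<in> TP n 1 \<and> y \<in> TQ n k 0}" by blast
  finally show ?thesis unfolding dd1_cover .
qed

lemma rope_ideal_generators:
  fixes S defines "S \<equiv> ideal_prod (RR n) (line_ideal n) (line_ideal n) \<union> {\<Sum>i<n - 1. var i * B $$ (i, j) | j. j < dim_col B}"
  shows "S \<subseteq> polys {..n}" "rope_ideal n B = Idl\<^bsub>RR n\<^esub> S"
proof -
  have "f \<in> polys {..n}" if "f \<in> ideal_prod (RR n) (line_ideal n) (line_ideal n)" for f :: "'k mpol"
    using that by induction (auto simp: line_ideal_eq)
  then show "S \<subseteq> polys {..n}" unfolding S_def dim_B using gen_polys by auto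
  show "rope_ideal n B = Idl\<^bsub>RR n\<^esub> S" by (simp add: rope_ideal_def S_def)
qed

lemma rope_ideal_ideal: "ideal (rope_ideal n B) (RR n)"
  unfolding rope_ideal_generators(2) by (rule Idl_polys_iff(1)[OF rope_ideal_generators(1)])

lemma rope_ideal_gen:
  assumes "j < k" shows "gen j \<in> rope_ideal n B"
  unfolding rope_ideal_generators(2)
  by (rule subsetD[OF Idl_polys_iff(2)[OF rope_ideal_generators(1)]]) (use assms dim_B in auto)

lemma rope_ideal_square:
  assumes "f \<in> line_ideal n" "g \<in> line_ideal n" shows "f * g \<in> rope_ideal n B"
  unfolding rope_ideal_generators(2)
  by (rule subsetD[OF Idl_polys_iff(2)[OF rope_ideal_generators(1)]])
    (use ideal_prod.prod[OF assms, of "RR n"] in simp)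

text \<open>
  The quadratic forms make up \<open>I\<^sub>L\<^sup>2\<close>, whose elements are sums of products of linear combinations of
  \<open>x\<^sub>0, \<dots>, x\<^sub>r\<close>; and \<open>- q\<^sub>j\<close> is mapped to the \<open>j\<close>-th entry of \<open>[x\<^sub>0, \<dots>, x\<^sub>r] B\<close>.
\<close>

lemma rope_ideal_eq_image: "dd1 n B ` carrier (G_module n k \<beta> 1) = rope_ideal n B"
proof
  let ?I = "dd1 n B ` carrier (G_module n k \<beta> 1)"
  note I = image_dd1
  have mem: "quadratic_form n z - linear_form n (\<tau> y) \<in> ?I" if "z \<in> TP n 1" "y \<in> TQ n k 0" for z y
    unfolding I using that by blast
  show "?I \<subseteq> rope_ideal n B"
  proof
    fix f assume "f \<in> ?I"
    then obtain z y where zy: "z \<in> TP n 1" "y \<in> TQ n k 0" and f: "f = quadratic_form n z - linear_form n (\<tau> y)"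
      unfolding I by blast
    have mult: "p * g \<in> rope_ideal n B" if "p \<in> polys {..n}" "g \<in> rope_ideal n B" for p g
      using that rope_ideal_ideal unfolding ideal_RR_iff by blast
    have "quadratic_form n z \<in> rope_ideal n B" unfolding quadratic_form_def
      by (intro ideal_RR_sum[OF rope_ideal_ideal] mult coordsD(1)[OF zy(1)] rope_ideal_square var_in_line_ideal) auto
    moreover have "(- 1) * linear_form n (\<tau> y) \<in> rope_ideal n B" unfolding linear_form_\<tau>
      by (intro ideal_RR_sum[OF rope_ideal_ideal] mult coordsD(1)[OF zy(2)] rope_ideal_gen polys_uminus polys_1) auto
    moreover have "f = quadratic_form n z + (- 1) * linear_form n (\<tau> y)" unfolding f by simp
    ultimately show "f \<in> rope_ideal n B" using rope_ideal_ideal unfolding ideal_RR_iff by metis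
  qed
  have add: "f + g \<in> ?I" if fg: "f \<in> ?I" "g \<in> ?I" for f g
  proof -
    obtain z y z' y' where f: "f = quadratic_form n z - linear_form n (\<tau> y)" "z \<in> TP n 1" "y \<in> TQ n k 0"
      and g: "g = quadratic_form n z' - linear_form n (\<tau> y')" "z' \<in> TP n 1" "y' \<in> TQ n k 0"
      using fg unfolding I by blast
    have "f + g = quadratic_form n (z + z') - linear_form n (\<tau> (y + y'))"
      unfolding f(1) g(1) quadratic_form_add id_tensor_tau_add linear_form_add by simp
    then show ?thesis using mem[OF coords_add[OF f(2) g(2)] coords_add[OF f(3) g(3)]] by simp
  qed
  have smult: "p * f \<in> ?I" if p: "p \<in> polys {..n}" and f0: "f \<in> ?I" for p f
  proof -
    obtain z y where f: "f = quadratic_form n z - linear_form n (\<tau> y)" "z \<in> TP n 1" "y \<in> TQ n k 0"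
      using f0 unfolding I by blast
    have "p * f = quadratic_form n (\<lambda>x. p * z x) - linear_form n (\<tau> (\<lambda>x. p * y x))"
      unfolding f(1) quadratic_form_smult id_tensor_tau_smult linear_form_smult by (simp only: right_diff_distrib)
    then show ?thesis using mem[OF coords_smult[OF p f(2)] coords_smult[OF p f(3)]] by simp
  qed
  have q0: "quadratic_form n 0 = 0" and l0: "linear_form n (\<tau> 0) = 0"
    by (simp_all add: quadratic_form_def linear_form_\<tau>)
  have zero: "0 \<in> ?I" using mem[OF coords_0 coords_0] unfolding q0 l0 by simp
  have sub: "?I \<subseteq> polys {..n}"
    using \<open>?I \<subseteq> rope_ideal n B\<close> rope_ideal_ideal unfolding ideal_RR_iff by blast
  have id: "ideal ?I (RR n)" unfolding ideal_RR_iff using sub zero add smult by blast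
  show "rope_ideal n B \<subseteq> ?I"
    unfolding rope_ideal_generators(2)
  proof (rule Idl_polys_iff(3)[OF rope_ideal_generators(1) id], rule Un_least)
    show "ideal_prod (RR n) (line_ideal n) (line_ideal n) \<subseteq> ?I"
    proof
      fix f :: "'k mpol" assume "f \<in> ideal_prod (RR n) (line_ideal n) (line_ideal n)"
      then show "f \<in> ?I"
      proof induction
        case (prod f g)
        obtain f' where f': "\<And>a. f' a \<in> polys {..n}" "f = (\<Sum>a<n - 1. var a * f' a)"
          using line_ideal_E[OF prod(1)] by blast
        obtain g' where g': "\<And>a. g' a \<in> polys {..n}" "g = (\<Sum>a<n - 1. var a * g' a)"
          using line_ideal_E[OF prod(2)] by blast
        \<comment> \<open>The coefficient of \<open>x\<^sub>ax\<^sub>b\<close> in the product becomes the coordinate at \<open>e\<^sub>a \<otimes> e\<^sub>b\<close>.\<close>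
        define z where "z = (\<lambda>(I, j). if I \<in> ext_basis n 1 \<and> j < n - 1 then f' (the_elem I) * g' j else 0)"
        have z: "z \<in> TP n 1" by (rule coords_prodI) (auto simp: z_def f'(1) g'(1) polys_mult)
        have "f * g = quadratic_form n z"
          unfolding f'(2) g'(2) quadratic_form_def sum_product
          by (intro sum.cong refl) (simp add: z_def ext_basis_def ac_simps)
        then show ?case using mem[OF z coords_0] unfolding l0 by simp
      next
        case (sum f g)
        then show ?case using add by simp
      qed
    qed
    show "{\<Sum>i<n - 1. var i * B $$ (i, j) | j. j < dim_col B} \<subseteq> ?I"
    proof safe
      fix j assume "j < dim_col B"
      then have j: "j < k" by (simp add: dim_B)
      define y :: "nat set \<times> nat \<Rightarrow> 'k mpol" where "y = (\<lambda>(I, i). if I = {} \<and> i = j then - 1 else 0)"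
      have y: "y \<in> TQ n k 0" by (rule coords_prodI) (use j in \<open>auto simp: y_def ext_basis_0 polys_uminus\<close>)
      have "linear_form n (\<tau> y) = (\<Sum>i<k. if i = j then - gen j else 0)"
        unfolding linear_form_\<tau> by (rule sum.cong) (auto simp: y_def)
      then have "linear_form n (\<tau> y) = - gen j" using j by simp
      then show "gen j \<in> ?I" using mem[OF coords_0 y] unfolding q0 by simp
    qed
  qed
qed

lemma resolution_of_rope_ideal: "graded_free_resolution n n (G_module n k \<beta>) (dd n B) (dd1 n B) (rope_ideal n B)"
  unfolding graded_free_resolution_def
proof (intro conjI ballI)
  show "graded_free n (G_module n k \<beta> i :: ('k mpol, _) graded_module)" for i by (rule graded_free_G)
  show "graded_hom n (G_module n k \<beta> i) (G_module n k \<beta> (i - 1)) (dd n B i)" if i: "i \<in> {2..n}" for i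
  proof -
    obtain j where "i = Suc (Suc j)" using i by (intro that[of "i - 2"]) auto
    then show ?thesis using graded_hom_dd[of j] i by simp
  qed
  show "a_kernel (G_module n k \<beta> i) (G_module n k \<beta> (i - 1)) (dd n B i) = dd n B (Suc i) ` carrier (G_module n k \<beta> (Suc i))"
    if i: "i \<in> {2..<n}" for i
  proof -
    obtain j where "i = Suc (Suc j)" using i by (intro that[of "i - 2"]) auto
    then show ?thesis using kernel_dd[of j] i by simp
  qed
qed (rule graded_hom_dd1 rope_ideal_eq_image kernel_dd1 inj_dd)+

end

section \<open>Minimality and non-degeneracy\<close>

lemma ideal_times_module_add:
  "u \<in> ideal_times_module I M \<Longrightarrow> v \<in> ideal_times_module I M \<Longrightarrow> u \<oplus>\<^bsub>M\<^esub> v \<in> ideal_times_module I M"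
  unfolding ideal_times_module_def using generate.eng[of u "add_monoid M" _ v] by simp

text \<open>
  The element \<open>z\<close> is a linear combination of basis vectors with coefficients in \<open>I\<close>.
\<close>

lemma linear_map_ideal_times_module:
  assumes M: "module (RR n) M" and f: "linear_map (RR n) (free_module n V w) M f"
    and "finite V" and z: "z \<in> coords n V" "\<And>x. z x \<in> I"
  shows "f z \<in> ideal_times_module I M"
proof -
  interpret M: module "RR n" M by fact
  let ?F = "free_module n V w"
  have add: "f (u + v) = f u \<oplus>\<^bsub>M\<^esub> f v" if "u \<in> coords n V" "v \<in> coords n V" for u v
    using f that unfolding linear_map_def carrier_free_module free_module_simps by blast
  have smult: "f (\<lambda>x. a * u x) = a \<odot>\<^bsub>M\<^esub> f u" if "a \<in> polys {..n}" "u \<in> coords n V" for a u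
    using f that unfolding linear_map_def carrier_free_module free_module_simps carrier_RR by blast
  have closed: "f u \<in> carrier M" if "u \<in> coords n V" for u
    using f that unfolding linear_map_def carrier_free_module by blast
  have f0: "f 0 = \<zero>\<^bsub>M\<^esub>"
  proof -
    have "f 0 = f (\<lambda>x. 0 * 0 x)" by (simp add: zero_fun_def)
    also have "\<dots> = \<zero>\<^bsub>RR n\<^esub> \<odot>\<^bsub>M\<^esub> f 0" using smult[of 0 0] by simp
    also have "\<dots> = \<zero>\<^bsub>M\<^esub>" by (rule M.smult_l_null) (rule closed, simp)
    finally show ?thesis .
  qed
  have "A \<subseteq> V \<Longrightarrow> f (\<lambda>x. if x \<in> A then z x else 0) \<in> ideal_times_module I M" if "finite A" for A
    using that
  proof induction
    case empty
    have "f (\<lambda>x. 0) = \<one>\<^bsub>add_monoid M\<^esub>" using f0 by (simp add: zero_fun_def)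
    then show ?case unfolding ideal_times_module_def by (simp only: empty_iff if_False generate.one)
  next
    case (insert a A)
    let ?u = "\<lambda>x. if x \<in> A then z x else 0"
    have b: "basis_vec a \<in> coords n V" using insert.prems by (auto simp: basis_vec_def coords_def)
    have u: "?u \<in> coords n V" using z(1) by (auto simp: coords_def)
    have "(\<lambda>x. if x \<in> insert a A then z x else 0) = ?u + (\<lambda>x. z a * basis_vec a x)"
      using insert.hyps by (auto simp: basis_vec_def fun_eq_iff)
    then have "f (\<lambda>x. if x \<in> insert a A then z x else 0) = f ?u \<oplus>\<^bsub>M\<^esub> (z a \<odot>\<^bsub>M\<^esub> f (basis_vec a))"
      using add[OF u coords_smult[OF coordsD(1)[OF z(1), of a] b]] smult[OF coordsD(1)[OF z(1)] b] by simp
    moreover have "z a \<odot>\<^bsub>M\<^esub> f (basis_vec a) \<in> ideal_times_module I M"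
      unfolding ideal_times_module_def using z(2) closed[OF b] by (intro generate.incl) blast
    moreover have "f ?u \<in> ideal_times_module I M" using insert by blast
    ultimately show ?case by (simp only: ideal_times_module_add)
  qed
  from this[OF \<open>finite V\<close> subset_refl] have "f (\<lambda>x. if x \<in> V then z x else 0) \<in> ideal_times_module I M" .
  moreover have "(\<lambda>x. if x \<in> V then z x else 0) = z" using coordsD(2)[OF z(1)] by auto
  ultimately show ?thesis by simp
qed

lemma irrelevant_ideal_ideal: "ideal (irrelevant_ideal n) (RR n :: 'k::field mpol ring)"
  unfolding irrelevant_ideal_def by (rule Idl_polys_iff(1)) auto

lemma irrelevant_ideal_mult: "p \<in> polys {..n} \<Longrightarrow> f \<in> irrelevant_ideal n \<Longrightarrow> p * f \<in> irrelevant_ideal n"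
  and irrelevant_ideal_add: "f \<in> irrelevant_ideal n \<Longrightarrow> g \<in> irrelevant_ideal n \<Longrightarrow> f + g \<in> irrelevant_ideal n"
  and irrelevant_ideal_0: "0 \<in> irrelevant_ideal n"
  and irrelevant_ideal_sum: "(\<And>x. x \<in> A \<Longrightarrow> h x \<in> irrelevant_ideal n) \<Longrightarrow> sum h A \<in> irrelevant_ideal n"
  using irrelevant_ideal_ideal[of n] ideal_RR_sum[OF irrelevant_ideal_ideal] unfolding ideal_RR_iff by blast+

lemma irrelevant_ideal_var: "a \<le> n \<Longrightarrow> var a \<in> irrelevant_ideal n"
  by (simp add: irrelevant_ideal_eq)

lemma homog_pos_irrelevant:
  assumes "homog (int d) f" "d \<ge> 1" "f \<in> polys {..n}"
  shows "f \<in> irrelevant_ideal n"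
proof -
  have "0 \<notin> Poly_Mapping.keys f" using assms(1,2) monom_deg_eq_0_iff[of 0] unfolding homog_def by fastforce
  then show ?thesis using assms(3) by (simp add: irrelevant_ideal_eq in_keys_iff)
qed

lemma homog_0_not_irrelevant:
  assumes "homog 0 f" "f \<noteq> 0"
  shows "f \<notin> irrelevant_ideal n"
proof -
  obtain m where m: "m \<in> Poly_Mapping.keys f" using assms(2) by (metis keys_eq_empty all_not_in_conv)
  then have "monom_deg m = 0" using assms(1) by (auto simp: homog_def)
  then have "m = 0" by (simp add: monom_deg_eq_0_iff)
  then show ?thesis using m by (simp add: irrelevant_ideal_eq in_keys_iff)
qed

lemma tensor_koszul_irrelevant:
  assumes "z \<in> coords n (ext_basis n (Suc i) \<times> W)"
  shows "tensor_id (koszul n (Suc i)) z (J, l) \<in> irrelevant_ideal n"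
proof -
  have "position_sign a J * (z (insert a J, l) * var a) \<in> irrelevant_ideal n" if "a \<in> {..<n - 1} - J" for a
    using that by (intro irrelevant_ideal_mult polys_position_sign coordsD(1)[OF assms] irrelevant_ideal_var) auto
  then show ?thesis unfolding tensor_id_apply koszul_eq[OF coords_slice[OF assms]] contraction_def
    by (intro irrelevant_ideal_sum) (simp add: mult.commute[of "var _"])
qed

definition order_ge :: "nat \<Rightarrow> 'k::field mpol \<Rightarrow> bool" where
  "order_ge d f \<longleftrightarrow> (\<forall>m\<in>Poly_Mapping.keys f. d \<le> monom_deg m)"

lemma order_ge_0: "order_ge 0 f"
  by (simp add: order_ge_def)

lemma order_ge_add: "order_ge d f \<Longrightarrow> order_ge d g \<Longrightarrow> order_ge d (f + g)"
  unfolding order_ge_def using Poly_Mapping.keys_add[of f g] by blast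

lemma order_ge_uminus: "order_ge d f \<Longrightarrow> order_ge d (- f)"
  by (auto simp: order_ge_def in_keys_iff)

lemma order_ge_sum: "(\<And>x. x \<in> A \<Longrightarrow> order_ge d (f x)) \<Longrightarrow> order_ge d (sum f A)"
  by (induction A rule: infinite_finite_induct) (auto simp: order_ge_add, auto simp: order_ge_def)

lemma order_ge_mult:
  assumes "order_ge d f" "order_ge e g" "s \<le> d + e"
  shows "order_ge s (f * g)"
  unfolding order_ge_def
proof
  fix m assume "m \<in> Poly_Mapping.keys (f * g)"
  then obtain a b where m: "m = a + b" "a \<in> Poly_Mapping.keys f" "b \<in> Poly_Mapping.keys g"
    using Poly_Mapping.keys_mult[of f g] by blast
  then have "d \<le> monom_deg a" "e \<le> monom_deg b" using assms(1,2) by (auto simp: order_ge_def)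
  then show "s \<le> monom_deg m" using assms(3) by (simp add: m(1))
qed

lemma homog_order_ge: "homog (int d) f \<Longrightarrow> e \<le> d \<Longrightarrow> order_ge e f"
  by (auto simp: homog_def order_ge_def)

lemma order_ge_var: "order_ge 1 (var a)"
  by (rule homog_order_ge[of 1]) simp_all

context rope_matrix
begin

text \<open>
  A column of zeros would make \<open>B\<close> kill a basis vector.
\<close>

lemma column_nonzero:
  assumes "j < k"
  shows "\<exists>l<n - 1. B $$ (l, j) \<noteq> 0"
proof (rule ccontr)
  assume "\<not> ?thesis"
  then have "(\<Sum>i<k. B $$ (l, i) * (if i = j then 1 else 0)) = 0" if "l < n - 1" for l
    using that by (intro sum.neutral) auto
  then have "(if j = j then 1 else 0) = (0 :: 'k mpol)"
    by (rule B_injective[where c = "\<lambda>i. if i = j then 1 else 0", OF _ assms])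
  then show False by simp
qed

lemma cover_irrelevant:
  fixes z y :: "nat set \<times> nat \<Rightarrow> 'k mpol"
  assumes z: "z \<in> TP n (Suc i)" "\<And>x. z x \<in> irrelevant_ideal n"
    and y: "y \<in> TQ n k i" "\<And>x. y x \<in> irrelevant_ideal n"
  shows "cover n (Suc i) (z, y) \<in> ideal_times_module (irrelevant_ideal n) (G_module n k \<beta> (Suc i))"
proof -
  let ?G = "G_module n k \<beta> (Suc i) :: ('k mpol, _) graded_module"
  have "linear_map (RR n) (free_module n (ext_basis n (Suc i) \<times> {..<n - 1}) (\<lambda>_. 0)) ?G (\<lambda>z. cover n (Suc i) (z, 0))"
    unfolding linear_map_def carrier_free_module free_module_simps carrier_RR
  proof (intro conjI ballI Pi_I)
    show "cover n (Suc i) (z, 0) \<in> carrier ?G" if "z \<in> TP n (Suc i)" for z using that coords_0 by (rule cover_in_G)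
    show "cover n (Suc i) (u + v, 0) = cover n (Suc i) (u, 0) \<oplus>\<^bsub>?G\<^esub> cover n (Suc i) (v, 0)" for u v
      unfolding cover_add[symmetric] by (simp only: add_0)
    show "cover n (Suc i) (\<lambda>x. a * u x, 0) = a \<odot>\<^bsub>?G\<^esub> cover n (Suc i) (u, 0)" if "a \<in> polys {..n}" for a u
      unfolding cover_smult[OF that, symmetric] by (simp add: zero_fun_def)
  qed
  from linear_map_ideal_times_module[OF module_G this _ z]
  have 1: "cover n (Suc i) (z, 0) \<in> ideal_times_module (irrelevant_ideal n) ?G" by simp
  have "linear_map (RR n) (free_module n (ext_basis n i \<times> {..<k}) (\<lambda>_. 0)) ?G (\<lambda>y. cover n (Suc i) (0, y))"
    unfolding linear_map_def carrier_free_module free_module_simps carrier_RR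
  proof (intro conjI ballI Pi_I)
    show "cover n (Suc i) (0, y) \<in> carrier ?G" if "y \<in> TQ n k i" for y using coords_0 that by (rule cover_in_G)
    show "cover n (Suc i) (0, u + v) = cover n (Suc i) (0, u) \<oplus>\<^bsub>?G\<^esub> cover n (Suc i) (0, v)" for u v
      unfolding cover_add[symmetric] by (simp only: add_0)
    show "cover n (Suc i) (0, \<lambda>x. a * u x) = a \<odot>\<^bsub>?G\<^esub> cover n (Suc i) (0, u)" if "a \<in> polys {..n}" for a u
      unfolding cover_smult[OF that, symmetric] by (simp add: zero_fun_def)
  qed
  from linear_map_ideal_times_module[OF module_G this _ y]
  have 2: "cover n (Suc i) (0, y) \<in> ideal_times_module (irrelevant_ideal n) ?G" by simp
  have "cover n (Suc i) (z, 0) \<oplus>\<^bsub>?G\<^esub> cover n (Suc i) (0, y) = cover n (Suc i) (z, y)"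
    unfolding cover_add[symmetric] by (simp only: add_0 add_0_right)
  then show ?thesis using ideal_times_module_add[OF 1 2] by simp
qed

lemma minimal_if_positive:
  assumes "\<And>j. j < k \<Longrightarrow> \<beta> j \<ge> 1"
  shows "minimal_resolution n n (G_module n k \<beta>) (dd n B)"
  unfolding minimal_resolution_def
proof (intro ballI subsetI)
  fix i' s assume i': "i' \<in> {2..n}" and "s \<in> dd n B i' ` carrier (G_module n k \<beta> i')"
  then obtain x where s: "s = dd n B i' x" and x: "x \<in> carrier (G_module n k \<beta> i')" by blast
  obtain i where i: "i' = Suc (Suc i)" using i' by (intro that[of "i' - 2"]) auto
  have le: "Suc (Suc i) \<le> n" using i' i by simp
  obtain z y where zy: "x = cover n (Suc (Suc i)) (z, y)" "z \<in> TP n (Suc (Suc i))" "y \<in> TQ n k (Suc i)"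
    using x unfolding i by (rule G_carrierE)
  have B: "B $$ (l, j) \<in> irrelevant_ideal n" if "l < n - 1" "j < k" for l j
    using B_entry[OF that] B_polys[OF that] assms[OF that(2)] by (intro homog_pos_irrelevant) auto
  have "\<tau> y (J, l) \<in> irrelevant_ideal n" for J l
    unfolding \<tau>_apply
    by (intro irrelevant_ideal_sum irrelevant_ideal_mult coordsD(1)[OF zy(3)]) (auto simp: B irrelevant_ideal_0)
  then have 1: "fst (cone_map (Suc (Suc i)) (z, y)) p \<in> irrelevant_ideal n" for p
    using tensor_koszul_irrelevant[OF zy(2)]
    by (cases p) (simp add: cone_map_def irrelevant_ideal_add irrelevant_ideal_mult)
  have 2: "snd (cone_map (Suc (Suc i)) (z, y)) p \<in> irrelevant_ideal n" for p
    using tensor_koszul_irrelevant[OF zy(3)] by (cases p) (simp add: cone_map_def)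
  obtain u v where uv: "cone_map (Suc (Suc i)) (z, y) = (u, v)" by fastforce
  have "u \<in> TP n (Suc i)" "v \<in> TQ n k i" using cone_map_coords[OF zy(2,3)] unfolding uv by auto
  then show "s \<in> ideal_times_module (irrelevant_ideal n) (G_module n k \<beta> (i' - 1))"
    using 1 2 unfolding s zy(1) i dd_cover[OF le zy(2)] uv diff_Suc_1 fst_conv snd_conv
    by (intro cover_irrelevant)
qed

text \<open>
  Hence the coordinates at the pairs \<open>(J, l)\<close> with \<open>l \<in> J\<close> are well defined on \<open>D\<^sub>i\<close>.
\<close>

lemma partial_image_diagonal:
  assumes "p \<in> partial_image n i" "l \<in> J" shows "p (J, l) = 0"
  using assms by (auto simp: partial_image_eq partial_eq)

text \<open>
  Suppose that \<open>\<beta>\<^sub>j = 0\<close>, and let \<open>B\<^sub>l\<^sub>j\<close> be a nonzero entry of the \<open>j\<close>-th column, hence a nonzero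
  constant.  The component of \<open>d'\<^sub>2 (e\<^sub>l \<otimes> q\<^sub>j)\<close> in \<open>D\<^sub>1\<close> has this constant as coordinate at \<open>e\<^sub>l \<otimes> e\<^sub>l\<close>, which
  is a coordinate that does not depend on the representative.  For the elements of \<open>M G\<^sub>1\<close>, where \<open>M\<close>
  is the irrelevant ideal, it would have to lie in \<open>M\<close>.
\<close>

lemma positive_if_minimal:
  assumes min: "minimal_resolution n n (G_module n k \<beta>) (dd n B)" and j: "j < k"
  shows "\<beta> j \<ge> 1"
proof (rule ccontr)
  assume "\<not> \<beta> j \<ge> 1"
  then have \<beta>: "\<beta> j = 0" by simp
  obtain l where l: "l < n - 1" "B $$ (l, j) \<noteq> 0" using column_nonzero[OF j] by blast
  have Bl: "B $$ (l, j) \<notin> irrelevant_ideal n"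
    using B_entry[OF l(1) j] l(2) \<beta> by (intro homog_0_not_irrelevant) auto
  \<comment> \<open>This is \<open>e\<^sub>l \<otimes> q\<^sub>j\<close>.\<close>
  define y :: "nat set \<times> nat \<Rightarrow> 'k mpol" where "y = (\<lambda>(I, i). if I = {l} \<and> i = j then 1 else 0)"
  have y: "y \<in> TQ n k (Suc 0)" by (rule coords_prodI) (use l(1) j in \<open>auto simp: y_def ext_basis_def\<close>)
  have \<tau>y: "\<tau> y ({l}, l) = B $$ (l, j)"
  proof -
    have "\<tau> y ({l}, l) = (\<Sum>i<k. if i = j then B $$ (l, j) else 0)"
      unfolding \<tau>_apply by (rule sum.cong) (use l(1) in \<open>auto simp: y_def\<close>)
    then show ?thesis using j by simp
  qed
  let ?G = "G_module n k \<beta> (Suc 0) :: ('k mpol, _) graded_module"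
  interpret G: module "RR n" ?G by (rule module_G)
  have n2: "Suc (Suc 0) \<le> n" using n by simp
  have "dd n B (Suc (Suc 0)) ` carrier (G_module n k \<beta> (Suc (Suc 0))) \<subseteq> ideal_times_module (irrelevant_ideal n) ?G"
    using min[unfolded minimal_resolution_def, rule_format, of "Suc (Suc 0)"] n by simp
  then have "dd n B (Suc (Suc 0)) (cover n (Suc (Suc 0)) (0, y)) \<in> ideal_times_module (irrelevant_ideal n) ?G"
    by (rule subsetD[OF _ imageI[OF cover_in_G[OF coords_0 y]]])
  moreover have "dd n B (Suc (Suc 0)) (cover n (Suc (Suc 0)) (0, y)) = cover n (Suc 0) (\<tau> y, \<kappa> (Suc 0) y)"
    unfolding dd_cover[OF n2 coords_0] cone_map_def prod.case diff_Suc_1 tensor_koszul_0 by (simp del: cover_apply)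
  ultimately have mem: "cover n (Suc 0) (\<tau> y, \<kappa> (Suc 0) y) \<in> ideal_times_module (irrelevant_ideal n) ?G" by simp
  have "\<exists>u v. x = cover n (Suc 0) (u, v) \<and> u \<in> TP n (Suc 0) \<and> v \<in> TQ n k 0 \<and> u ({l}, l) \<in> irrelevant_ideal n"
    if "x \<in> ideal_times_module (irrelevant_ideal n) ?G" for x
    using that unfolding ideal_times_module_def
  proof induction
    case one
    have "\<one>\<^bsub>add_monoid ?G\<^esub> = cover n (Suc 0) (0, 0)" by (simp add: cover_zero[where k = k and \<beta> = \<beta>] del: cover_apply)
    then show ?case using irrelevant_ideal_0 coords_0 by (metis zero_fun_apply)
  next
    case (incl h)
    then obtain a x where h: "h = a \<odot>\<^bsub>?G\<^esub> x" "a \<in> irrelevant_ideal n" "x \<in> carrier ?G" by blast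
    obtain u v where uv: "x = cover n (Suc 0) (u, v)" "u \<in> TP n (Suc 0)" "v \<in> TQ n k 0"
      using h(3) by (rule G_carrierE)
    have a: "a \<in> polys {..n}" using h(2) by (simp add: irrelevant_ideal_eq)
    have "h = cover n (Suc 0) (\<lambda>s. a * u s, \<lambda>s. a * v s)"
      unfolding h(1) uv(1) by (rule cover_smult[OF a, symmetric])
    moreover have "a * u ({l}, l) \<in> irrelevant_ideal n"
      using irrelevant_ideal_mult[OF coordsD(1)[OF uv(2)] h(2)] by (simp add: mult.commute)
    ultimately show ?case using coords_smult[OF a uv(2)] coords_smult[OF a uv(3)] by blast
  next
    case (inv h)
    then obtain a x where h: "h = a \<odot>\<^bsub>?G\<^esub> x" "a \<in> irrelevant_ideal n" "x \<in> carrier ?G" by blast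
    obtain u v where uv: "x = cover n (Suc 0) (u, v)" "u \<in> TP n (Suc 0)" "v \<in> TQ n k 0"
      using h(3) by (rule G_carrierE)
    have a: "a \<in> polys {..n}" using h(2) by (simp add: irrelevant_ideal_eq)
    have a': "- a \<in> polys {..n}" using a by (rule polys_uminus)
    have hh: "h = cover n (Suc 0) (\<lambda>s. a * u s, \<lambda>s. a * v s)"
      unfolding h(1) uv(1) by (rule cover_smult[OF a, symmetric])
    let ?m = "cover n (Suc 0) (\<lambda>s. - a * u s, \<lambda>s. - a * v s)"
    have "?m \<oplus>\<^bsub>?G\<^esub> h = cover n (Suc 0) ((\<lambda>s. - a * u s) + (\<lambda>s. a * u s), (\<lambda>s. - a * v s) + (\<lambda>s. a * v s))"
      unfolding hh by (rule cover_add[symmetric])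
    also have "\<dots> = cover n (Suc 0) (0, 0)"
      by (rule arg_cong[where f = "cover n (Suc 0)"]) (simp add: fun_eq_iff)
    also have "\<dots> = \<zero>\<^bsub>?G\<^esub>" by (rule cover_zero)
    finally have "\<ominus>\<^bsub>?G\<^esub> h = ?m"
      using cover_in_G[OF coords_smult[OF a uv(2)] coords_smult[OF a uv(3)]]
        cover_in_G[OF coords_smult[OF a' uv(2)] coords_smult[OF a' uv(3)]]
      unfolding hh[symmetric] by (intro G.minus_equality)
    then have "inv\<^bsub>add_monoid ?G\<^esub> h = ?m" by (simp only: a_inv_def)
    moreover have "- a * u ({l}, l) \<in> irrelevant_ideal n"
      using irrelevant_ideal_mult[OF polys_uminus[OF coordsD(1)[OF uv(2)]] h(2)] by (simp add: mult.commute)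
    ultimately show ?case using coords_smult[OF a' uv(2)] coords_smult[OF a' uv(3)] by blast
  next
    case (eng h1 h2)
    then obtain u v u' v' where h: "h1 = cover n (Suc 0) (u, v)" "u \<in> TP n (Suc 0)" "v \<in> TQ n k 0" "u ({l}, l) \<in> irrelevant_ideal n"
        "h2 = cover n (Suc 0) (u', v')" "u' \<in> TP n (Suc 0)" "v' \<in> TQ n k 0" "u' ({l}, l) \<in> irrelevant_ideal n" by blast
    have "h1 \<otimes>\<^bsub>add_monoid ?G\<^esub> h2 = cover n (Suc 0) (u + u', v + v')"
      unfolding h(1,5) by (simp add: cover_add[where k = k and \<beta> = \<beta>] del: cover_apply)
    moreover have "(u + u') ({l}, l) \<in> irrelevant_ideal n" using h(4,8) by (simp add: irrelevant_ideal_add)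
    ultimately show ?case using coords_add[OF h(2,6)] coords_add[OF h(3,7)] by blast
  qed
  from this[OF mem] obtain u v where uv: "cover n (Suc 0) (\<tau> y, \<kappa> (Suc 0) y) = cover n (Suc 0) (u, v)"
    "u ({l}, l) \<in> irrelevant_ideal n" by blast
  then have "\<tau> y - u \<in> partial_image n (Suc 0)" by (simp add: D_proj_eq_iff)
  then have "(\<tau> y - u) ({l}, l) = 0" by (rule partial_image_diagonal) simp
  then have "\<tau> y ({l}, l) = u ({l}, l)" by simp
  then show False using uv(2) Bl unfolding \<tau>y by simp
qed

lemma rope_ideal_order_ge_2:
  assumes pos: "\<And>j. j < k \<Longrightarrow> \<beta> j \<ge> 1" and f: "f \<in> rope_ideal n B"
  shows "order_ge 2 f"
proof -
  obtain z y where zy: "f = quadratic_form n z - linear_form n (\<tau> y)"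
    using f unfolding rope_ideal_eq_image[symmetric] image_dd1 by blast
  have gen: "order_ge 2 (gen j)" if "j < k" for j
  proof (intro order_ge_sum)
    fix i assume "i \<in> {..<n - 1}"
    then have "order_ge 1 (B $$ (i, j))"
      using B_entry[of i j] pos[OF that] that by (intro homog_order_ge[of "\<beta> j"]) auto
    from order_ge_mult[OF order_ge_var this, of 2 i] show "order_ge 2 (var i * B $$ (i, j))" by simp
  qed
  have "order_ge 2 (quadratic_form n z)" unfolding quadratic_form_def
    by (intro order_ge_sum order_ge_mult[OF order_ge_0 order_ge_mult[OF order_ge_var order_ge_var order_refl]]) simp
  moreover have "order_ge 2 (linear_form n (\<tau> y))" unfolding linear_form_\<tau>
  proof (rule order_ge_sum)
    fix j assume "j \<in> {..<k}"
    then have "order_ge 2 (gen j)" by (intro gen) simp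
    from order_ge_mult[OF order_ge_0 this, of 2] show "order_ge 2 (y ({}, j) * gen j)" by simp
  qed
  ultimately have "order_ge 2 (quadratic_form n z + - linear_form n (\<tau> y))"
    by (intro order_ge_add order_ge_uminus)
  then show ?thesis by (simp add: zy)
qed

text \<open>
  If \<open>\<beta>\<^sub>j = 0\<close> then the \<open>j\<close>-th entry of \<open>[x\<^sub>0, \<dots>, x\<^sub>r] B\<close> is a linear form in \<open>I\<^sub>C\<close>; it is not zero because the
  \<open>j\<close>-th column of \<open>B\<close> is not.  If all \<open>\<beta>\<^sub>j\<close> are positive then \<open>I\<^sub>C\<close> has no nonzero elements of
  degree one.
\<close>

lemma nondegenerate_iff: "nondegenerate n (rope_ideal n B) \<longleftrightarrow> (\<forall>j<k. \<beta> j \<ge> 1)"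
proof
  assume nd: "nondegenerate n (rope_ideal n B)"
  show "\<forall>j<k. \<beta> j \<ge> 1"
  proof (intro allI impI, rule ccontr)
    fix j assume j: "j < k" "\<not> \<beta> j \<ge> 1"
    obtain l where l: "l < n - 1" "B $$ (l, j) \<noteq> 0" using column_nonzero[OF j(1)] by blast
    have b0: "\<beta> j = 0" using j(2) by simp
    have "homog 1 (var i * B $$ (i, j))" if "i \<in> {..<n - 1}" for i
      using B_entry[of i j] j(1) that b0 by (intro homog_mult[OF homog_var]) auto
    then have "homog 1 (gen j)" by (rule homog_sum)
    then have "gen j \<in> RR_comp n 1" using gen_polys[OF j(1)] by (simp add: RR_comp_def)
    moreover have "gen j \<noteq> 0"
    proof
      assume "gen j = 0"
      then have "restr {..<n - 1} (quo l (\<Sum>i<n - 1. B $$ (i, j) * var i)) = 0" by (simp add: mult.commute)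
      then have "restr {..<n - 1} (B $$ (l, j)) = 0"
        unfolding quo_sum restr_sum using l(1) by (simp add: restr_quo_mult_var)
      moreover have "restr {..<n - 1} (B $$ (l, j)) = B $$ (l, j)"
        using B_entry[OF l(1) j(1)] n by (intro restr_id[of _ "{n - 1, n}"]) (auto simp: SS_carrier_def)
      ultimately show False using l(2) by simp
    qed
    moreover have "Idl\<^bsub>RR n\<^esub> {gen j} \<subseteq> rope_ideal n B"
      using gen_polys[OF j(1)] rope_ideal_gen[OF j(1)] by (intro Idl_polys_iff(3)[OF _ rope_ideal_ideal]) auto
    ultimately show False using nd unfolding nondegenerate_def by blast
  qed
next
  assume pos: "\<forall>j<k. \<beta> j \<ge> 1"
  show "nondegenerate n (rope_ideal n B)"
    unfolding nondegenerate_def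
  proof safe
    fix f :: "'k mpol" assume f: "f \<in> RR_comp n 1" "f \<noteq> 0" "Idl\<^bsub>RR n\<^esub> {f} \<subseteq> rope_ideal n B"
    have "f \<in> Idl\<^bsub>RR n\<^esub> {f}" using Idl_polys_iff(2)[of "{f}" n] RR_comp_polys[OF f(1)] by simp
    then have "order_ge 2 f" using f(3) pos by (intro rope_ideal_order_ge_2) auto
    moreover have "homog 1 f" using f(1) by (simp add: RR_comp_def)
    ultimately have "m \<notin> Poly_Mapping.keys f" for m by (auto simp: order_ge_def homog_def)
    then have "f = 0" by (metis keys_eq_empty all_not_in_conv)
    then show False using f(2) by simp
  qed
qed

end

theorem theorem3p4:
  fixes n k :: nat and \<beta> :: "nat \<Rightarrow> nat"
    and B :: "'k::field mpol mat" and I\<^sub>C :: "'k mpol set"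
  assumes "n \<ge> 3" and "1 \<le> k" and "k \<le> n - 2"
    and "rope n I\<^sub>C" and "curve_has_degree n I\<^sub>C (n - k)"
    and "B \<in> carrier_mat (n - 1) k"
    and "\<And>i j. i < n - 1 \<Longrightarrow> j < k \<Longrightarrow> B $$ (i, j) \<in> SS_carrier n \<and> homog (int (\<beta> j)) (B $$ (i, j))"
    and "no_common_zero_of_maximal_minors n B"
    and "I\<^sub>C = rope_ideal n B"
  shows "graded_free_resolution n n (G_module n k \<beta>) (dd n B) (dd1 n B) I\<^sub>C \<and>
         (minimal_resolution n n (G_module n k \<beta>) (dd n B) \<longleftrightarrow> nondegenerate n I\<^sub>C)"
proof -
  interpret rope_matrix n k \<beta> B
    using assms(1,6,7,8) by unfold_locales
  show ?thesis
    unfolding \<open>I\<^sub>C = rope_ideal n B\<close> nondegenerate_iff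
    using resolution_of_rope_ideal minimal_if_positive positive_if_minimal by blast
qed

end
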